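(* Let $w_0\in\mathbb R$. Assume that $U$ satisfies the utility assumption and that we are in the whole-line setting. Suppose that: (i) $\mathscr S=\mathscr S^{*}$; (ii) there exist $C>0$ and $\alpha\in[0,1)$ with $U(x)\le C(x^\alpha+1)$ for all $x\ge0$; (iii) for every $S\in\mathscr S$ and $t\in\{1,\ldots,T\}$ there exist $\mathcal F_{t-1}$-measurable random variables $\beta_t^S>0$, $\kappa_t^S>0$ a.s. satisfying $$\operatorname*{ess\,inf}_{\xi\in\Xi_t^{S}}\mathbb P\big(\langle\xi,\Delta S_t\rangle\le-\beta_t^S\|\xi\|\,\big|\,\mathcal F_{t-1}\big)\ge\kappa_t^S\quad\text{a.s. on }\{D_t^{S}\neq\{0\}\},$$ where $\Xi_t^{S}=\{\xi\in L^0(\mathcal F_{t-1};\mathbb R^d):\xi\in D_t^{S}\text{ a.s.}\}$, and such that $1/\beta_t^S,\ 1/\kappa_t^S,\ \|\Delta S_t\|\in\mathscr W$. Then there exists $\hat\phi\in\mathscr L$ such that $$u(w_0)=\inf_{S\in\mathscr S}\mathbb E_{\mathbb P}\big[U(W_T^S(w_0,\hat\phi))\big]<+\infty.$$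
   Context: Fix $d,T\in\mathbb N$ and a filtered probability space $(\Omega,\mathcal F,\mathbb F=(\mathcal F_t)_{t=0}^T,\mathbb P)$ whose $\sigma$-algebras all contain the $\mathbb P$-null sets; random variables equal a.s. are identified. For $\mathcal G\subseteq\mathcal F$, $L^0(\mathcal G;\mathbb R^n)$ is the space of $\mathcal G$-measurable $\mathbb R^n$-valued random variables with the topology of convergence in probability. Let $\mathscr S$ be a nonempty family of $\mathbb F$-adapted $\mathbb R^d$-valued processes $S=(S_t)_{t=0}^T$, and write $\Delta S_t=S_t-S_{t-1}$. Let $\mathscr L=\prod_{t=1}^T L^0(\mathcal F_{t-1};\mathbb R^d)$. For $w\in\mathbb R$, $\phi\in\mathscr L$, $S\in\mathscr S$, set $W_t^S(w,\phi)=w+\sum_{s=1}^t\langle\phi_s,\Delta S_s\rangle$. For $S\in\mathscr S$ and $t\ge1$, $D_t^S(\omega)$ is the smallest affine subspace of $\mathbb R^d$ containing the support of the regular conditional distribution of $\Delta S_t$ given $\mathcal F_{t-1}$ at $\omega$. NA($S$) means: for every $\phi\in\mathscr L$, $W_T^S(0,\phi)\ge0$ a.s. implies $W_T^S(0,\phi)=0$ a.s. $\mathscr S^{*}$ denotes the set of $S^*\in\mathscr S$ such that NA($S^*$) holds and, for every $S\in\mathscr S$ and $t$, $D_t^S\subseteq D_t^{S^*}$ a.s. $\mathscr W=\{X\in L^0(\mathcal F_T;\mathbb R):\mathbb E_{\mathbb P}[|X|^p]<\infty\text{ for all }p>0\}$. Utility assumption: $U:\mathbb R\to\mathbb R\cup\{-\infty\}$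 is non-decreasing, concave and upper semicontinuous. Whole-line setting: $U(x)>-\infty$ for all $x\in\mathbb R$, and every $\phi\in\mathscr L$ is admissible. Value $u(w_0)=\sup_{\varphi\in\mathscr L}\inf_{S\in\mathscr S}\mathbb E_{\mathbb P}[U(W_T^S(w_0,\varphi))]$, with the convention that the expectation of a random variable whose positive and negative parts both have infinite expectation is $-\infty$. *)

theory Defs
  imports "HOL-Probability.Probability"
begin

definition filtered_ps :: "'a measure \<Rightarrow> (nat \<Rightarrow> 'a measure) \<Rightarrow> nat \<Rightarrow> bool" where
  "filtered_ps M Fl T \<longleftrightarrow> prob_space M \<and>
     (\<forall>t\<le>T. subalgebra M (Fl t)) \<and>
     (\<forall>s t. s \<le> t \<and> t \<le> T \<longrightarrow> sets (Fl s) \<subseteq> sets (Fl t)) \<and>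
     (\<forall>t\<le>T. \<forall>A B. B \<in> null_sets M \<and> A \<subseteq> B \<longrightarrow> A \<in> sets (Fl t))"

definition adapted :: "(nat \<Rightarrow> 'a measure) \<Rightarrow> nat \<Rightarrow> (nat \<Rightarrow> 'a \<Rightarrow> 'd::euclidean_space) \<Rightarrow> bool" where
  "adapted Fl T S \<longleftrightarrow> (\<forall>t\<le>T. S t \<in> borel_measurable (Fl t))"

definition incr :: "(nat \<Rightarrow> 'a \<Rightarrow> 'd::euclidean_space) \<Rightarrow> nat \<Rightarrow> 'a \<Rightarrow> 'd" where
  "incr S t \<omega> = S t \<omega> - S (t - 1) \<omega>"

definition strategies :: "(nat \<Rightarrow> 'a measure) \<Rightarrow> nat \<Rightarrow> (nat \<Rightarrow> 'a \<Rightarrow> 'd::euclidean_space) set" where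
  "strategies Fl T = {\<phi>. \<forall>t\<in>{1..T}. \<phi> t \<in> borel_measurable (Fl (t - 1))}"

definition wealth :: "(nat \<Rightarrow> 'a \<Rightarrow> 'd::euclidean_space) \<Rightarrow> nat \<Rightarrow> real \<Rightarrow> (nat \<Rightarrow> 'a \<Rightarrow> 'd) \<Rightarrow> 'a \<Rightarrow> real" where
  "wealth S t w \<phi> \<omega> = w + (\<Sum>s\<in>{1..t}. \<phi> s \<omega> \<bullet> incr S s \<omega>)"

definition NA :: "'a measure \<Rightarrow> (nat \<Rightarrow> 'a measure) \<Rightarrow> nat \<Rightarrow> (nat \<Rightarrow> 'a \<Rightarrow> 'd::euclidean_space) \<Rightarrow> bool" where
  "NA M Fl T S \<longleftrightarrow> (\<forall>\<phi>\<in>strategies Fl T.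
      (AE \<omega> in M. wealth S T 0 \<phi> \<omega> \<ge> 0) \<longrightarrow> (AE \<omega> in M. wealth S T 0 \<phi> \<omega> = 0))"

definition is_rcd :: "'a measure \<Rightarrow> 'a measure \<Rightarrow> ('a \<Rightarrow> 'd::euclidean_space) \<Rightarrow> ('a \<Rightarrow> 'd measure) \<Rightarrow> bool" where
  "is_rcd M G X K \<longleftrightarrow>
     (\<forall>\<omega>\<in>space M. prob_space (K \<omega>) \<and> sets (K \<omega>) = sets borel) \<and>
     (\<forall>B\<in>sets borel. (\<lambda>\<omega>. emeasure (K \<omega>) B) \<in> borel_measurable G) \<and>
     (\<forall>A\<in>sets G. \<forall>B\<in>sets borel.
        emeasure M (A \<inter> (X -` B \<inter> space M)) = (\<integral>\<^sup>+\<omega>\<in>A. emeasure (K \<omega>) B \<partial>M))"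

definition rcd :: "'a measure \<Rightarrow> 'a measure \<Rightarrow> ('a \<Rightarrow> 'd::euclidean_space) \<Rightarrow> ('a \<Rightarrow> 'd measure)" where
  "rcd M G X = (SOME K. is_rcd M G X K)"

definition msupport :: "'d::euclidean_space measure \<Rightarrow> 'd set" where
  "msupport \<mu> = {x. \<forall>e>0. emeasure \<mu> (ball x e) > 0}"

definition Dset :: "'a measure \<Rightarrow> (nat \<Rightarrow> 'a measure) \<Rightarrow> (nat \<Rightarrow> 'a \<Rightarrow> 'd::euclidean_space) \<Rightarrow> nat \<Rightarrow> 'a \<Rightarrow> 'd set" where
  "Dset M Fl S t \<omega> = affine hull (msupport (rcd M (Fl (t - 1)) (incr S t) \<omega>))"

definition S_star :: "'a measure \<Rightarrow> (nat \<Rightarrow> 'a measure) \<Rightarrow> nat \<Rightarrow> (nat \<Rightarrow> 'a \<Rightarrow> 'd::euclidean_space) set \<Rightarrow> (nat \<Rightarrow> 'a \<Rightarrow> 'd) set" where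
  "S_star M Fl T SS = {S\<in>SS. NA M Fl T S \<and>
      (\<forall>S'\<in>SS. \<forall>t\<in>{1..T}. AE \<omega> in M. Dset M Fl S' t \<omega> \<subseteq> Dset M Fl S t \<omega>)}"

definition Wclass :: "'a measure \<Rightarrow> (nat \<Rightarrow> 'a measure) \<Rightarrow> nat \<Rightarrow> ('a \<Rightarrow> real) set" where
  "Wclass M Fl T = {X. X \<in> borel_measurable (Fl T) \<and>
      (\<forall>p>0. integrable M (\<lambda>\<omega>. \<bar>X \<omega>\<bar> powr p))}"

definition usc :: "(real \<Rightarrow> real) \<Rightarrow> bool" where
  "usc U \<longleftrightarrow> (\<forall>x c. U x < c \<longrightarrow> eventually (\<lambda>y. U y < c) (at x))"

text \<open>x^a with the convention x^0 = 1 (also for x = 0).\<close>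
definition rpow :: "real \<Rightarrow> real \<Rightarrow> real" where
  "rpow x a = (if a = 0 then 1 else x powr a)"

text \<open>Extended expectation: E[X^+] - E[X^-], and -infinity when E[X^-] is infinite
 (in particular when both parts have infinite expectation).\<close>
definition ext_expect :: "'a measure \<Rightarrow> ('a \<Rightarrow> real) \<Rightarrow> ereal" where
  "ext_expect M X =
     (let p = (\<integral>\<^sup>+\<omega>. ennreal (max 0 (X \<omega>)) \<partial>M);
          n = (\<integral>\<^sup>+\<omega>. ennreal (max 0 (- X \<omega>)) \<partial>M)
      in if n = \<infinity> then -\<infinity> else enn2ereal p - enn2ereal n)"

definition value_fn :: "'a measure \<Rightarrow> (nat \<Rightarrow> 'a measure) \<Rightarrow> nat \<Rightarrow> (nat \<Rightarrow> 'a \<Rightarrow> 'd::euclidean_space) set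
    \<Rightarrow> (real \<Rightarrow> real) \<Rightarrow> real \<Rightarrow> ereal" where
  "value_fn M Fl T SS U w0 =
     (SUP \<phi>\<in>strategies Fl T. INF S\<in>SS. ext_expect M (\<lambda>\<omega>. U (wealth S T w0 \<phi> \<omega>)))"

end

theory Submission
  imports Defs
begin

text \<open>
  Every strategy may be projected onto the conditional spans \<open>D\<^sub>t\<close>, which coincide for all
  \<open>S\<close>, without changing any wealth process. For projected strategies the quantitative no-arbitrage
  condition bounds \<open>E[V W\<^sub>T\<^sup>+]\<close> and \<open>E[V |\<phi>\<^sub>t|]\<close> by a multiple of \<open>1 + E[W\<^sub>T\<^sup>-]\<close>, where the weight \<open>V\<close>
  does not depend on the strategy and \<open>1/V\<close> has all moments: on the events where every position loses, the
  negative part of the wealth can only increase, so \<open>W\<^sub>T\<^sup>-\<close> controls all earlier positions. Young's inequality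
  turns sublinear growth of \<open>U\<close> into \<open>U(W) \<le> \<epsilon> V W\<^sup>+ + D V\<^sup>-\<^sup>N - \<kappa> W\<^sup>-\<close>; hence \<open>E[W\<^sub>T\<^sup>-]\<close> is bounded along
  strategies of bounded-below utility, and Fatou's lemma makes expected utility upper semicontinuous. The sets of
  near-optimal strategies are convex, and near-minimisers in them of the strictly convex functional
  \<open>\<Sum>\<^sub>t E[V\<^sub>t (1 + |\<phi>\<^sub>t|\<^sup>2)\<^sup>1\<^sup>/\<^sup>2]\<close> converge almost surely along a subsequence to an optimiser.
\<close>

section \<open>Regular conditional distributions\<close>

text \<open>Two obstacles shape the argument. A component of a position that is orthogonal to all
  increments never shows in the wealth and so cannot be bounded. It is removed by projecting onto
  \<open>Dset\<close>, and no arbitrage is what makes this affine hull pass through 0 and hence be a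
  linear span. Since the projection has to be measurable in \<omega>, it is obtained as the limit of
  an explicit iteration. Secondly, \<open>SS\<close> may be uncountable and each market has its own
  weights. The convergent sequence is therefore extracted with the bounds of one fixed market
  \<open>S0\<close>; the other markets enter one at a time, through convexity of their superlevel
  sets and Fatou. The weights come from a backward recursion: if Z is the weight at t and the
  position loses with conditional probability at least k, then Cauchy-Schwarz gives E[Z 1_loss | F]
  \<ge> k^2 / E[1/Z | F], and the inverse of the right-hand side again has all moments.\<close>

lemma rcd_exists_unit_interval:
  fixes Y :: "'a \<Rightarrow> real"
  assumes M: "prob_space M" and sub: "subalgebra M G" and Y[measurable]: "Y \<in> borel_measurable M"
    and Y01: "\<And>w. w \<in> space M \<Longrightarrow> 0 \<le> Y w \<and> Y w \<le> 1"
  shows "\<exists>K. is_rcd M G Y K"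
proof -
  interpret prob_space M by fact
  interpret fs: finite_measure_subalgebra M G by standard (rule sub)
  have spG: "space G = space M" using sub by (simp add: subalgebra_def)
  have setsG: "A \<in> sets G \<Longrightarrow> A \<in> sets M" for A using sub by (auto simp: subalgebra_def)
  define I where "I q = (indicator {w\<in>space M. Y w \<le> q} :: 'a \<Rightarrow> real)" for q
  have I[measurable]: "I q \<in> borel_measurable M" for q unfolding I_def by measurable
  have intI[simp]: "integrable M (I q)" for q
    unfolding I_def by (intro integrable_real_indicator) (auto simp: emeasure_eq_measure)
  define f where "f q = real_cond_exp M G (I q)" for q
  have f[measurable]: "f q \<in> borel_measurable G" for q unfolding f_def by simp
  \<comment> \<open>\<open>f\<close> is a conditional distribution function known only up to a null
    set for each q; \<open>P\<close> collects the countably many rational relations on one event.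
    Values in [0, 1] make both tails exact, so no limits at infinity have to be controlled.\<close>
  define P where "P w \<longleftrightarrow> (\<forall>p\<in>\<rat>. \<forall>q\<in>\<rat>. p \<le> q \<longrightarrow> f p w \<le> f q w) \<and> (\<forall>q\<in>\<rat>. q < 0 \<longrightarrow> f q w = 0)
      \<and> (\<forall>q\<in>\<rat>. q \<ge> 1 \<longrightarrow> f q w = 1)" for w
  have Pm[measurable]: "Measurable.pred G P"
    unfolding P_def using countable_rat by (intro pred_intros_logic pred_intros_countable_bounded) measurable
  have PAE: "AE w in M. P w"
  proof -
    have 1: "AE w in M. p \<le> q \<longrightarrow> f p w \<le> f q w" for p q
    proof (cases "p \<le> q")
      case True
      have "AE w in M. f p w \<le> f q w" unfolding f_def
        by (rule fs.real_cond_exp_mono) (use True in \<open>auto intro!: intI\<close>, auto simp: I_def indicator_def)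
      then show ?thesis by simp
    qed simp
    have 2: "AE w in M. q < 0 \<longrightarrow> f q w = 0" for q
    proof (cases "q < 0")
      case True
      have "AE w in M. f q w = real_cond_exp M G (\<lambda>_. 0) w" unfolding f_def
        by (rule fs.real_cond_exp_cong) (use True Y01 in \<open>fastforce simp: I_def indicator_def\<close>)+
      moreover have "AE w in M. real_cond_exp M G (\<lambda>_. 0) w = 0"
        by (rule fs.real_cond_exp_F_meas) auto
      ultimately show ?thesis by eventually_elim simp
    qed simp
    have 3: "AE w in M. q \<ge> 1 \<longrightarrow> f q w = 1" for q
    proof (cases "q \<ge> 1")
      case True
      have "AE w in M. f q w = real_cond_exp M G (\<lambda>_. 1) w" unfolding f_def
        by (rule fs.real_cond_exp_cong) (use True Y01 in \<open>force simp: I_def indicator_def\<close>)+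
      moreover have "AE w in M. real_cond_exp M G (\<lambda>_. 1) w = 1"
        by (rule fs.real_cond_exp_F_meas) auto
      ultimately show ?thesis by eventually_elim simp
    qed simp
    show ?thesis unfolding P_def
      by (intro AE_conjI AE_ball_countable' countable_rat 1 2 3)
  qed
  \<comment> \<open>Off \<open>P\<close> the distribution function of the point mass at 0 is
    substituted, so that every \<open>w\<close> yields a genuine distribution.\<close>
  define g where "g q w = (if P w then f q w else indicator {0..} q)" for q w
  have g[measurable]: "g q \<in> borel_measurable G" for q unfolding g_def by measurable
  have gM[measurable]: "g q \<in> borel_measurable M" for q by (rule measurable_from_subalg[OF sub g])
  have gAE: "AE w in M. g q w = f q w" for q using PAE by eventually_elim (simp add: g_def)
  have gmono: "p \<in> \<rat> \<Longrightarrow> q \<in> \<rat> \<Longrightarrow> p \<le> q \<Longrightarrow> g p w \<le> g q w" for p q w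
    by (auto simp: g_def P_def indicator_def)
  have g0: "q \<in> \<rat> \<Longrightarrow> q < 0 \<Longrightarrow> g q w = 0" for q w by (auto simp: g_def P_def)
  have g1: "q \<in> \<rat> \<Longrightarrow> q \<ge> 1 \<Longrightarrow> g q w = 1" for q w by (auto simp: g_def P_def)
  have gnn: "q \<in> \<rat> \<Longrightarrow> 0 \<le> g q w" for q w
    using gmono[of "min q (-1)" q w] g0[of "min q (-1)" w] by (auto simp: min_def split: if_splits)
  have gle: "q \<in> \<rat> \<Longrightarrow> g q w \<le> 1" for q w
    using gmono[of q "max q 1" w] g1[of "max q 1" w] by (auto simp: max_def split: if_splits)
  \<comment> \<open>Right-continuous regularisation. It may alter \<open>g\<close> at rational
    points, which \<open>main\<close> repairs by letting rationals decrease to x under the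
    integral.\<close>
  define F where "F w x = (INF q\<in>{q\<in>\<rat>. x < q}. g q w)" for w x
  have bdd: "bdd_below ((\<lambda>q. g q w) ` {q\<in>\<rat>. x < q})" for w x
    using gnn by (intro bdd_belowI2[of _ 0]) auto
  have ne: "{q\<in>\<rat>. x < q} \<noteq> {}" for x :: real using Rats_dense_in_real[of x "x+1"] by auto
  have Fle: "q \<in> \<rat> \<Longrightarrow> x < q \<Longrightarrow> F w x \<le> g q w" for q x w
    unfolding F_def by (rule cINF_lower[OF bdd]) auto
  have Fge: "(\<And>q. q \<in> \<rat> \<Longrightarrow> x < q \<Longrightarrow> c \<le> g q w) \<Longrightarrow> c \<le> F w x" for c x w
    unfolding F_def by (rule cINF_greatest[OF ne]) auto
  have Flt: "F w x < c \<Longrightarrow> \<exists>q\<in>\<rat>. x < q \<and> g q w < c" for c x w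
    unfolding F_def using cINF_less_iff[OF ne bdd] by auto
  have Fmono: "x \<le> y \<Longrightarrow> F w x \<le> F w y" for x y w by (rule Fge) (auto intro: Fle)
  have Fnn: "0 \<le> F w x" for x w by (rule Fge) (auto intro: gnn)
  have F0: "F w x = 0" if x0: "x < 0" for x w
  proof -
    obtain q where "q \<in> \<rat>" "x < q" "q < 0" using Rats_dense_in_real[OF x0] by auto
    then show ?thesis using Fle[of q x w] g0[of q w] Fnn[of w x] by simp
  qed
  have F1: "F w x = 1" if "x \<ge> 1" for x w
  proof -
    obtain q where "q \<in> \<rat>" "x < q" using ne[of x] by auto
    then have "F w x \<le> 1" using Fle[of q x w] gle[of q w] by simp
    moreover have "1 \<le> F w x" by (rule Fge) (use that g1 in auto)
    ultimately show ?thesis by simp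
  qed
  have F1': "F w x \<le> 1" for w x using Fmono[of x "max x 1" w] F1[of "max x 1" w] by simp
  have Frc: "continuous (at_right x) (F w)" for x w
    unfolding continuous_within
  proof (rule order_tendstoI)
    fix c assume "c < F w x" then show "\<forall>\<^sub>F y in at_right x. c < F w y"
      unfolding eventually_at_right_field using Fmono by (meson less_imp_le less_le_trans lt_ex gt_ex)
  next
    fix c assume "F w x < c"
    then obtain q where "q \<in> \<rat>" "x < q" "g q w < c" using Flt by blast
    then show "\<forall>\<^sub>F y in at_right x. F w y < c"
      unfolding eventually_at_right_field using Fle le_less_trans by blast
  qed
  have F_bot: "(F w \<longlongrightarrow> 0) at_bot" for w
    by (rule tendsto_eventually) (auto simp: eventually_at_bot_dense intro!: exI[of _ 0] F0)
  have F_top: "(F w \<longlongrightarrow> 1) at_top" for w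
    by (rule tendsto_eventually) (auto simp: eventually_at_top_dense intro!: exI[of _ 1] F1)
  define K where "K w = interval_measure (F w)" for w
  have rdK: "real_distribution (K w)" for w
    unfolding K_def by (rule real_distribution_interval_measure[OF Fmono Frc F_bot F_top])
  have probK: "prob_space (K w)" for w using rdK by (simp add: real_distribution_def)
  have setsK[simp]: "sets (K w) = sets borel" for w by (simp add: K_def)
  have KIic: "emeasure (K w) {..x} = ennreal (F w x)" for w x
    unfolding K_def by (rule emeasure_interval_measure_Iic[OF Fmono Frc F_bot])
  have seq: "\<exists>q. (\<forall>n::nat. q n \<in> \<rat> \<and> x < q n) \<and> q \<longlonglongrightarrow> x" for x :: real
  proof -
    have "\<forall>n::nat. \<exists>q\<in>\<rat>. x < q \<and> q < x + 1 / Suc n"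
      by (intro allI Rats_dense_in_real) simp
    then obtain q where q: "\<And>n::nat. q n \<in> \<rat> \<and> x < q n \<and> q n < x + 1 / Suc n" by metis
    have "q \<longlonglongrightarrow> x"
    proof (rule tendsto_sandwich[where f="\<lambda>_. x"])
      show "(\<lambda>n. x + 1 / Suc n) \<longlonglongrightarrow> x" 
        using LIMSEQ_inverse_real_of_nat_add[of x] by (simp add: inverse_eq_divide)
      show "\<forall>\<^sub>F n in sequentially. x \<le> q n" "\<forall>\<^sub>F n in sequentially. q n \<le> x + 1 / Suc n"
        using q by (simp_all add: less_imp_le del: of_nat_Suc)
    qed simp
    with q show ?thesis by blast
  qed
  have glim: "(\<lambda>n. g (q n) w) \<longlonglongrightarrow> F w x" if q: "\<And>n::nat. q n \<in> \<rat> \<and> x < q n" "q \<longlonglongrightarrow> x" for q x w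
  proof (rule order_tendstoI)
    fix c assume "c < F w x" then show "\<forall>\<^sub>F n in sequentially. c < g (q n) w"
      using Fle q(1) by (intro always_eventually) (meson less_le_trans)
  next
    fix c assume "F w x < c"
    then obtain r where r: "r \<in> \<rat>" "x < r" "g r w < c" using Flt by blast
    have "\<forall>\<^sub>F n in sequentially. q n < r" using q(2) r(2) by (rule order_tendstoD)
    then show "\<forall>\<^sub>F n in sequentially. g (q n) w < c"
      by eventually_elim (use q(1) r gmono in \<open>meson le_less_trans less_imp_le\<close>)
  qed
  have Fm[measurable]: "(\<lambda>w. F w x) \<in> borel_measurable G" for x
  proof -
    obtain q where q: "\<And>n::nat. q n \<in> \<rat> \<and> x < q n" "q \<longlonglongrightarrow> x" using seq[of x] by blast
    show ?thesis by (rule borel_measurable_LIMSEQ_real[OF glim[OF q]]) auto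
  qed
  have Fm'[measurable]: "(\<lambda>w. F w x) \<in> borel_measurable M" for x
    by (rule measurable_from_subalg[OF sub Fm])
  have main: "(\<integral>w. indicator A w * F w x \<partial>M) = (\<integral>w. indicator A w * I x w \<partial>M)" if A: "A \<in> sets G" for A x
  proof -
    have [measurable]: "A \<in> sets M" using setsG A .
    obtain q where q: "\<And>n::nat. q n \<in> \<rat> \<and> x < q n" "q \<longlonglongrightarrow> x" using seq[of x] by blast
    have eq: "(\<integral>w. indicator A w * g (q n) w \<partial>M) = (\<integral>w. indicator A w * I (q n) w \<partial>M)" for n
    proof -
      have "(\<integral>w. indicator A w * g (q n) w \<partial>M) = (\<integral>w. indicator A w * f (q n) w \<partial>M)"
        using gAE[of "q n"] by (intro integral_cong_AE) (auto simp: f_def)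
      also have "\<dots> = (\<integral>w. indicator A w * I (q n) w \<partial>M)"
        using fs.real_cond_exp_intA[OF intI A] by (simp add: f_def set_lebesgue_integral_def)
      finally show ?thesis .
    qed
    have 1: "(\<lambda>n. (\<integral>w. indicator A w * g (q n) w \<partial>M)) \<longlonglongrightarrow> (\<integral>w. indicator A w * F w x \<partial>M)"
      by (rule integral_dominated_convergence[where w="\<lambda>_. 1"])
        (use glim[OF q] gnn gle q(1) in \<open>auto intro!: tendsto_intros simp: indicator_def\<close>)
    have Ilim: "(\<lambda>n. I (q n) w) \<longlonglongrightarrow> I x w" for w
    proof (cases "Y w \<le> x")
      case True then show ?thesis using q(1) by (auto simp: I_def indicator_def less_imp_le order_trans)
    next
      case False
      then have "\<forall>\<^sub>F n in sequentially. q n < Y w" using order_tendstoD(2)[OF q(2)] by auto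
      then have "\<forall>\<^sub>F n in sequentially. I (q n) w = I x w"
        by eventually_elim (use False in \<open>auto simp: I_def indicator_def\<close>)
      then show ?thesis by (rule tendsto_eventually)
    qed
    have 2: "(\<lambda>n. (\<integral>w. indicator A w * I (q n) w \<partial>M)) \<longlonglongrightarrow> (\<integral>w. indicator A w * I x w \<partial>M)"
      by (rule integral_dominated_convergence[where w="\<lambda>_. 1"])
        (use Ilim in \<open>auto intro!: tendsto_intros AE_I2\<close>, auto simp: indicator_def I_def)
    show ?thesis using LIMSEQ_unique[OF 1] 2 by (simp add: eq)
  qed
  have Kms: "K \<in> measurable G (subprob_algebra borel)"
    by (rule measurable_subprob_algebra_generated[where \<Omega>=UNIV and G="range (\<lambda>a. {..a})"])
      (auto simp: borel_eq_atMost KIic Int_stable_def sets_eq_imp_space_eq[OF setsK] prob_space.emeasure_space_1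
         prob_space_imp_subprob_space[OF probK] prob_space.emeasure_space_1[OF probK, unfolded sets_eq_imp_space_eq[OF setsK], simplified])
  have Km[measurable]: "(\<lambda>w. emeasure (K w) B) \<in> borel_measurable G" if "B \<in> sets borel" for B
    using measurable_emeasure_kernel[OF Kms that] .
  have "emeasure M (A \<inter> (Y -` B \<inter> space M)) = (\<integral>\<^sup>+w\<in>A. emeasure (K w) B \<partial>M)"
    if A: "A \<in> sets G" and B: "B \<in> sets borel" for A B
  proof -
    have Am[measurable]: "A \<in> sets M" using setsG A .
    have KmM[measurable]: "(\<lambda>w. emeasure (K w) B) \<in> borel_measurable M" if "B \<in> sets borel" for B
      using measurable_from_subalg[OF sub Km[OF that]] .
    \<comment> \<open>With \<open>M\<close> restricted to \<open>A\<close>, the claim compares two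
      finite measures, the law of \<open>Y\<close> and the mixture of the kernel. Half-lines form an
      intersection-stable generator, so \<open>main\<close> suffices.\<close>
    define N where "N = density M (indicator A)"
    have Nsp: "space N = space M" and Nse[measurable_cong]: "sets N = sets M" by (auto simp: N_def)
    have [measurable]: "K \<in> measurable N (subprob_algebra borel)"
      using measurable_from_subalg[OF sub Kms] by (simp cong: measurable_cong_sets add: Nse)
    have bindN: "emeasure (N \<bind> K) B = (\<integral>\<^sup>+w\<in>A. emeasure (K w) B \<partial>M)" if "B \<in> sets borel" for B
      using that by (subst emeasure_bind[where N=borel]) (auto simp: Nsp not_empty N_def nn_integral_density ac_simps)
    have distrN: "emeasure (distr N borel Y) B = emeasure M (A \<inter> (Y -` B \<inter> space M))" if [measurable]: "B \<in> sets borel" for B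
      by (subst emeasure_distr) (auto simp: Nsp N_def emeasure_density indicator_inter_arith[symmetric])
    have "distr N borel Y = N \<bind> K"
    proof (rule measure_eqI_generator_eq[where \<Omega>=UNIV and E="range (\<lambda>a. {..a})" and A="\<lambda>n. {..real n}"])
      fix B assume "B \<in> range (\<lambda>a::real. {..a})"
      then obtain x where B: "B = {..x}" by auto
      have "emeasure M (A \<inter> (Y -` B \<inter> space M)) = ennreal (\<integral>w. indicator (A \<inter> (Y -` B \<inter> space M)) w \<partial>M)"
        by (simp add: emeasure_eq_measure B)
      also have "(\<integral>w. indicator (A \<inter> (Y -` B \<inter> space M)) w \<partial>M) = (\<integral>w. indicator A w * I x w \<partial>M)"
        by (rule Bochner_Integration.integral_cong) (auto simp: I_def indicator_def B)
      also have "\<dots> = (\<integral>w. indicator A w * F w x \<partial>M)" using main[OF A] by simp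
      also have "ennreal \<dots> = (\<integral>\<^sup>+w. ennreal (indicator A w * F w x) \<partial>M)"
        by (rule nn_integral_eq_integral[symmetric], rule integrable_const_bound[where B=1])
           (use Fnn F1' in \<open>auto simp: indicator_def\<close>)
      also have "\<dots> = (\<integral>\<^sup>+w\<in>A. emeasure (K w) B \<partial>M)"
        by (rule nn_integral_cong) (auto simp: B KIic indicator_def)
      finally show "emeasure (distr N borel Y) B = emeasure (N \<bind> K) B" by (simp add: bindN distrN B)
    next
      show "sets (N \<bind> K) = sigma_sets UNIV (range (\<lambda>a. {..a}))"
        by (subst sets_bind[where N=borel]) (auto simp: Nsp not_empty borel_eq_atMost)
      show "emeasure (distr N borel Y) {..real i} \<noteq> \<infinity>" for i by (simp add: distrN emeasure_eq_measure)
    qed (auto simp: Int_stable_def borel_eq_atMost real_arch_simple)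
    then show ?thesis using bindN[OF B] distrN[OF B] by simp
  qed
  then show ?thesis using probK Km unfolding is_rcd_def by (intro exI[of _ K]) auto
qed

text \<open>Encode a point by the ternary digits recording which balls of a countable base contain it.\<close>

lemma borel_embedding_unit_interval:
  "\<exists>(i :: 'd::euclidean_space \<Rightarrow> real) (j :: real \<Rightarrow> 'd). i \<in> borel_measurable borel \<and> j \<in> borel_measurable borel \<and>
     (\<forall>x. j (i x) = x) \<and> (\<forall>x. 0 \<le> i x \<and> i x \<le> 1)"
proof -
  obtain D :: "'d set" where D: "countable D" "\<And>X. open X \<Longrightarrow> X \<noteq> {} \<Longrightarrow> \<exists>d \<in> D. d \<in> X"
    using countable_dense_setE by blast
  define e where "e = from_nat_into D"
  have Dne: "D \<noteq> {}" using D(2)[of UNIV] by auto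
  have e: "\<exists>m. dist (e m) x < 1 / Suc n" for x and n :: nat
  proof -
    obtain d where "d \<in> D" "d \<in> ball x (1 / Suc n)" using D(2)[of "ball x (1 / Suc n)"] by auto
    then show ?thesis using from_nat_into_surj[OF D(1)] unfolding e_def by (metis dist_commute mem_ball)
  qed
  define c :: "nat \<Rightarrow> 'd \<Rightarrow> real" where
    "c k = indicator (ball (e (snd (prod_decode k))) (1 / Suc (fst (prod_decode k))))" for k
  have c01: "c k x = 0 \<or> c k x = 1" for k x by (auto simp: c_def indicator_def)
  have cm[measurable]: "c k \<in> borel_measurable borel" for k
    unfolding c_def by (intro borel_measurable_indicator) simp
  have cn: "0 \<le> 2 * c k x * (1/3) ^ Suc j" and cu: "2 * c k x * (1/3) ^ Suc j \<le> 2 * (1/3) ^ Suc j" for k j x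
    using c01[of k x] by auto
  \<comment> \<open>Digits 0 and 2, as in the Cantor set: by \<open>rec\<close> a leading digit 0
    forces a value at most 1/3 and a leading digit 2 a value at least 2/3, so comparison with 1/2
    reads it off.\<close>
  define r where "r k x = (\<Sum>j. 2 * c (k + j) x * (1/3) ^ Suc j)" for k x
  have geo: "(\<lambda>j. 2 * (1/3) ^ Suc j) sums (1::real)"
    using sums_mult[OF geometric_sums[of "1/3::real"], of "2/3"] by simp
  have summ: "summable (\<lambda>j. 2 * c (k + j) x * (1/3) ^ Suc j)" for k x
  proof (rule summable_comparison_test'[OF sums_summable[OF geo], of 0])
    show "norm (2 * c (k + n) x * (1/3) ^ Suc n) \<le> 2 * (1/3) ^ Suc n" for n
      unfolding real_norm_def abs_of_nonneg[OF cn] by (rule cu)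
  qed
  have r0: "0 \<le> r k x" for k x
    unfolding r_def by (rule suminf_nonneg[OF summ cn])
  have r1: "r k x \<le> 1" for k x
    using suminf_le[OF cu summ sums_summable[OF geo]] sums_unique[OF geo] by (simp add: r_def)
  have rec: "3 * r k x = 2 * c k x + r (Suc k) x" for k x
  proof -
    have "r k x = 2 * c k x * (1/3) + (\<Sum>j. 2 * c (k + Suc j) x * (1/3) ^ Suc (Suc j))"
      using suminf_split_head[OF summ[of k x]] by (simp add: r_def)
    also have "(\<Sum>j. 2 * c (k + Suc j) x * (1/3) ^ Suc (Suc j)) = (1/3) * r (Suc k) x"
      unfolding r_def by (subst suminf_mult[OF summ, symmetric]) (auto intro!: arg_cong[where f=suminf])
    finally show ?thesis by simp
  qed
  have rm[measurable]: "r k \<in> borel_measurable borel" for k unfolding r_def by measurable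
  \<comment> \<open>The digit shift: triple and remove the leading digit. It is defined on all reals
    and visibly measurable.\<close>
  define s :: "nat \<Rightarrow> real \<Rightarrow> real" where
    "s = rec_nat (\<lambda>y. y) (\<lambda>k f y. 3 * f y - 2 * (if f y \<ge> 1/2 then 1 else 0))"
  have s0: "s 0 y = y" and sS: "s (Suc k) y = 3 * s k y - 2 * (if s k y \<ge> 1/2 then 1 else 0)" for k y
    by (auto simp: s_def)
  have sm[measurable]: "s k \<in> borel_measurable borel" for k
  proof (induction k)
    case 0 have "s 0 = (\<lambda>y. y)" by (auto simp: s0) then show ?case by simp
  next
    case (Suc k) have "s (Suc k) = (\<lambda>y. 3 * s k y - 2 * (if s k y \<ge> 1/2 then 1 else 0))" by (auto simp: sS)
    with Suc show ?case by simp
  qed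
  have dig: "r k x \<ge> 1/2 \<longleftrightarrow> c k x = 1" for k x
    using rec[of k x] r0[of "Suc k" x] r1[of "Suc k" x] c01[of k x] by auto
  have sr: "s k (r 0 x) = r k x" for k x
  proof (induction k)
    case 0 show ?case by (simp add: s0)
  next
    case (Suc k) then show ?case using rec[of k x] dig[of k x] c01[of k x] by (auto simp: sS)
  qed
  \<comment> \<open>Decoding: for each n the digits reveal the first dense point within 1/(n+1) of
    the encoded point, and these points converge to it.\<close>
  define j where "j y = lim (\<lambda>n. e (LEAST m. s (prod_encode (n, m)) y \<ge> 1/2))" for y
  have [measurable]: "j \<in> borel_measurable borel" unfolding j_def by measurable
  have "j (r 0 x) = x" for x
  proof -
    have d: "dist (e (LEAST m. s (prod_encode (n, m)) (r 0 x) \<ge> 1/2)) x < 1 / Suc n" for n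
    proof -
      have eq: "s (prod_encode (n, m)) (r 0 x) \<ge> 1/2 \<longleftrightarrow> dist (e m) x < 1 / Suc n" for m
        unfolding sr dig by (simp add: c_def indicator_def)
      show ?thesis unfolding eq by (rule LeastI_ex) (rule e)
    qed
    have "(\<lambda>n. e (LEAST m. s (prod_encode (n, m)) (r 0 x) \<ge> 1/2)) \<longlonglongrightarrow> x"
    proof (rule metric_LIMSEQ_I)
      fix \<epsilon> :: real assume "\<epsilon> > 0"
      then obtain N where N: "inverse (real (Suc N)) < \<epsilon>" using reals_Archimedean by blast
      have "1 / Suc n < \<epsilon>" if "n \<ge> N" for n
      proof -
        have "1 / Suc n \<le> inverse (real (Suc N))" using that by (simp add: inverse_eq_divide frac_le)
        then show ?thesis using N by simp
      qed
      then show "\<exists>N. \<forall>n\<ge>N. dist (e (LEAST m. s (prod_encode (n, m)) (r 0 x) \<ge> 1/2)) x < \<epsilon>"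
        using d by (meson less_trans)
    qed
    then show ?thesis unfolding j_def by (rule limI)
  qed
  then show ?thesis using r0 r1 by (intro exI[of _ "r 0"] exI[of _ j]) simp
qed

text \<open>The conditional law is built for the real code of X and pushed forward by the decoder
  \<open>j\<close>. As \<open>j\<close> inverts \<open>i\<close>, the event that X lies in B is the
  event that \<open>i (X w)\<close> lies in the preimage of B under \<open>j\<close>.\<close>

lemma rcd_exists:
  fixes X :: "'a \<Rightarrow> 'd::euclidean_space"
  assumes M: "prob_space M" and sub: "subalgebra M G" and X[measurable]: "X \<in> borel_measurable M"
  shows "\<exists>K. is_rcd M G X K"
proof -
  obtain i :: "'d \<Rightarrow> real" and j :: "real \<Rightarrow> 'd" where
    i[measurable]: "i \<in> borel_measurable borel" and j[measurable]: "j \<in> borel_measurable borel"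
    and ji: "\<And>x. j (i x) = x" and i01: "\<And>x. 0 \<le> i x \<and> i x \<le> 1"
    using borel_embedding_unit_interval by blast
  obtain K where K: "is_rcd M G (\<lambda>w. i (X w)) K"
    using rcd_exists_unit_interval[OF M sub, of "\<lambda>w. i (X w)"] i01 by auto
  have KP: "prob_space (K w)" and Ks[measurable_cong]: "sets (K w) = sets borel" if "w \<in> space M" for w
    using K that by (auto simp: is_rcd_def)
  have spG: "space G = space M" using sub by (simp add: subalgebra_def)
  have jm: "j \<in> measurable (K w) borel" if "w \<in> space M" for w
    using Ks[OF that] by (simp cong: measurable_cong_sets)
  have em: "emeasure (distr (K w) borel j) B = emeasure (K w) (j -` B)"
    if "w \<in> space M" "B \<in> sets borel" for w B
    using that by (subst emeasure_distr[OF jm]) (auto simp: sets_eq_imp_space_eq[OF Ks])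
  have jB: "j -` B \<in> sets borel" if "B \<in> sets borel" for B :: "'d set"
    using measurable_sets_borel[OF j that] .
  have "is_rcd M G X (\<lambda>w. distr (K w) borel j)"
    unfolding is_rcd_def
  proof (intro conjI ballI)
    fix w assume "w \<in> space M" then show "prob_space (distr (K w) borel j)"
      using prob_space.prob_space_distr[OF KP jm] by simp
  next
    fix B :: "'d set" assume B: "B \<in> sets borel"
    have "(\<lambda>w. emeasure (K w) (j -` B)) \<in> borel_measurable G"
      using K jB[OF B] by (auto simp: is_rcd_def)
    then show "(\<lambda>w. emeasure (distr (K w) borel j) B) \<in> borel_measurable G"
      by (rule measurable_cong[THEN iffD1, rotated]) (simp add: em B spG)
  next
    fix A and B :: "'d set" assume A: "A \<in> sets G" and B: "B \<in> sets borel"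
    have "emeasure M (A \<inter> (X -` B \<inter> space M)) = emeasure M (A \<inter> ((\<lambda>w. i (X w)) -` (j -` B) \<inter> space M))"
      by (auto simp: ji intro!: arg_cong[where f="emeasure M"])
    also have "\<dots> = (\<integral>\<^sup>+w\<in>A. emeasure (K w) (j -` B) \<partial>M)"
      using K A jB[OF B] by (auto simp: is_rcd_def)
    also have "\<dots> = (\<integral>\<^sup>+w\<in>A. emeasure (distr (K w) borel j) B \<partial>M)"
      by (rule nn_integral_cong) (simp add: em B)
    finally show "emeasure M (A \<inter> (X -` B \<inter> space M)) = (\<integral>\<^sup>+w\<in>A. emeasure (distr (K w) borel j) B \<partial>M)" .
  qed simp
  then show ?thesis by blast
qed

text \<open>\<open>rcd\<close> is a Hilbert choice and carries no information until existence is
  known; from here on it is accessible through \<open>is_rcd\<close>.\<close>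

lemma is_rcd_rcd:
  assumes "prob_space M" "subalgebra M G" "X \<in> borel_measurable M"
  shows "is_rcd M G X (rcd M G X)"
  unfolding rcd_def using rcd_exists[OF assms] by (rule someI_ex)

section \<open>Measurable projection onto the span of the conditional support\<close>

text \<open>A point outside the support is witnessed by one of uncountably many balls; a countable
  base leaves only countably many null sets. The family is independent of the measure, as kernels
  require, where the measure varies with the point.\<close>

lemma countable_separating_msupport:
  "\<exists>\<B> :: 'd::euclidean_space set set. countable \<B> \<and> (\<forall>B\<in>\<B>. open B) \<and>
     (\<forall>\<mu> x. sets \<mu> = sets borel \<longrightarrow> x \<notin> msupport \<mu> \<longrightarrow> (\<exists>B\<in>\<B>. x \<in> B \<and> emeasure \<mu> B = 0))"
proof -
  obtain \<B> :: "'d set set" where B: "countable \<B>" "topological_basis \<B>"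
    using ex_countable_basis by blast
  have "\<exists>B\<in>\<B>. x \<in> B \<and> emeasure \<mu> B = 0" if s: "sets \<mu> = sets borel" and x: "x \<notin> msupport \<mu>" for \<mu> :: "'d measure" and x
  proof -
    obtain e where e: "e > 0" "emeasure \<mu> (ball x e) = 0" using x by (auto simp: msupport_def)
    obtain B where "B \<in> \<B>" "x \<in> B" "B \<subseteq> ball x e"
      using topological_basisE[OF B(2), of "ball x e" x] e(1) by auto
    moreover have "emeasure \<mu> B \<le> emeasure \<mu> (ball x e)" using calculation s by (intro emeasure_mono) auto
    ultimately show ?thesis using e(2) by auto
  qed
  then show ?thesis using B topological_basis_open[OF B(2)] by blast
qed

lemma AE_msupport:
  fixes \<mu> :: "'d::euclidean_space measure"
  assumes s: "sets \<mu> = sets borel"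
  shows "AE x in \<mu>. x \<in> msupport \<mu>"
proof -
  obtain \<B> :: "'d set set" where B: "countable \<B>" "\<forall>B\<in>\<B>. open B"
    "\<forall>\<mu> x. sets \<mu> = sets borel \<longrightarrow> x \<notin> msupport \<mu> \<longrightarrow> (\<exists>B\<in>\<B>. x \<in> B \<and> emeasure \<mu> B = 0)"
    using countable_separating_msupport[where 'd='d] by (elim exE conjE) (rule that)
  have "AE x in \<mu>. \<forall>B\<in>{B\<in>\<B>. emeasure \<mu> B = 0}. x \<notin> B"
    by (intro AE_ball_countable' countable_subset[OF _ B(1)])
      (use B(2) in \<open>auto intro!: AE_not_in simp: null_sets_def s\<close>)
  then show ?thesis by eventually_elim (use B(3) s in blast)
qed

text \<open>For a basic open B, the set A on which the kernel gives B mass 0 belongs to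
  \<open>G\<close>, so the probability of A together with X in B is an integral of 0 over A.
  Countably many B exhaust the complement of the support.\<close>

lemma AE_rcd_msupport:
  fixes X :: "'a \<Rightarrow> 'd::euclidean_space"
  assumes M: "prob_space M" and sub: "subalgebra M G" and X[measurable]: "X \<in> borel_measurable M"
    and K: "is_rcd M G X K"
  shows "AE \<omega> in M. X \<omega> \<in> msupport (K \<omega>)"
proof -
  obtain \<B> :: "'d set set" where B: "countable \<B>" "\<forall>B\<in>\<B>. open B"
    "\<forall>\<mu> x. sets \<mu> = sets borel \<longrightarrow> x \<notin> msupport \<mu> \<longrightarrow> (\<exists>B\<in>\<B>. x \<in> B \<and> emeasure \<mu> B = 0)"
    using countable_separating_msupport[where 'd='d] by (elim exE conjE) (rule that)
  have "AE \<omega> in M. \<not> (emeasure (K \<omega>) B = 0 \<and> X \<omega> \<in> B)" if "B \<in> \<B>" for B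
  proof -
    have Bb[measurable]: "B \<in> sets borel" using B(2) that by simp
    have Km[measurable]: "(\<lambda>\<omega>. emeasure (K \<omega>) B) \<in> borel_measurable G" using K Bb by (auto simp: is_rcd_def)
    have spG: "space G = space M" using sub by (simp add: subalgebra_def)
    define A where "A = {\<omega>\<in>space G. emeasure (K \<omega>) B = 0}"
    have A: "A \<in> sets G" unfolding A_def by measurable
    then have A'[measurable]: "A \<in> sets M" using sub by (auto simp: subalgebra_def)
    have "emeasure M (A \<inter> (X -` B \<inter> space M)) = (\<integral>\<^sup>+\<omega>\<in>A. emeasure (K \<omega>) B \<partial>M)"
      using K A Bb by (auto simp: is_rcd_def)
    also have "\<dots> = (\<integral>\<^sup>+\<omega>. 0 \<partial>M)" by (rule nn_integral_cong) (auto simp: A_def indicator_def)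
    finally have "A \<inter> (X -` B \<inter> space M) \<in> null_sets M" by (auto simp: null_sets_def)
    then have "AE \<omega> in M. \<omega> \<notin> A \<inter> (X -` B \<inter> space M)" by (rule AE_not_in)
    with AE_space show ?thesis by eventually_elim (auto simp: A_def spG)
  qed
  then have "AE \<omega> in M. \<forall>B\<in>\<B>. \<not> (emeasure (K \<omega>) B = 0 \<and> X \<omega> \<in> B)" by (intro AE_ball_countable' B(1))
  with AE_space show ?thesis
  proof eventually_elim
    case (elim \<omega>)
    have "sets (K \<omega>) = sets borel" using K elim(1) by (simp add: is_rcd_def)
    then show ?case using B(3) elim(2) by blast
  qed
qed

text \<open>Turns a condition on every support point into a single integral equation, and integrals
  against a kernel are measurable in the parameter. A nonzero value at a support point persists on a
  ball of positive mass.\<close>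

lemma integral_zero_iff_msupport:
  fixes \<mu> :: "'d::euclidean_space measure"
  assumes s: "sets \<mu> = sets borel" and f: "continuous_on UNIV f" "\<And>x. 0 \<le> f x" and i: "integrable \<mu> f"
  shows "(\<integral>x. f x \<partial>\<mu>) = 0 \<longleftrightarrow> (\<forall>s\<in>msupport \<mu>. f s = (0::real))"
proof
  assume f0: "\<forall>s\<in>msupport \<mu>. f s = 0"
  have "AE x in \<mu>. f x = 0" using AE_msupport[OF s] by eventually_elim (use f0 in blast)
  then show "(\<integral>x. f x \<partial>\<mu>) = 0" by (rule integral_eq_zero_AE)
next
  assume "(\<integral>x. f x \<partial>\<mu>) = 0"
  then have ae: "AE x in \<mu>. f x = 0"
    by (rule integral_nonneg_eq_0_iff_AE[OF i AE_I2[OF f(2)], THEN iffD1])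
  show "\<forall>s\<in>msupport \<mu>. f s = 0"
  proof (rule ballI, rule ccontr)
    fix y assume y: "y \<in> msupport \<mu>" "f y \<noteq> 0"
    have "open {x. f x \<noteq> 0}" by (rule open_Collect_neq[OF f(1) continuous_on_const])
    moreover have "y \<in> {x. f x \<noteq> 0}" using y(2) by simp
    ultimately obtain e where e: "e > 0" "ball y e \<subseteq> {x. f x \<noteq> 0}" by (meson openE)
    have "AE x in \<mu>. x \<notin> ball y e" using ae by eventually_elim (use e(2) in auto)
    then have "ball y e \<in> null_sets \<mu>" using AE_iff_null_sets[of "ball y e" \<mu>] s by simp
    then have "emeasure \<mu> (ball y e) = 0" by (rule null_setsD1)
    then show False using y(1) e(1) by (auto simp: msupport_def)
  qed
qed

text \<open>The second-moment operator, with a weight that makes it finite and bounded by the identity; its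
  range is the span of the support.\<close>

definition wgt :: "'d::euclidean_space \<Rightarrow> real" where
  "wgt x = 1 / (1 + (norm x)\<^sup>2)"

definition covop :: "'d::euclidean_space measure \<Rightarrow> 'd \<Rightarrow> 'd" where
  "covop \<mu> u = (\<integral>x. (wgt x * (x \<bullet> u)) *\<^sub>R x \<partial>\<mu>)"

definition cmean :: "'d::euclidean_space measure \<Rightarrow> 'd" where
  "cmean \<mu> = (\<integral>x. wgt x *\<^sub>R x \<partial>\<mu>)"

definition cmass :: "'d::euclidean_space measure \<Rightarrow> real" where
  "cmass \<mu> = (\<integral>x. wgt x \<partial>\<mu>)"

text \<open>An explicit iteration in place of a pseudo-inverse: each iterate, hence the limit,
  depends measurably on a kernel. The start at 0 keeps the iterates in the span of the support
  whenever b lies there.\<close>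

primrec covit :: "'d::euclidean_space measure \<Rightarrow> 'd \<Rightarrow> nat \<Rightarrow> 'd" where
  "covit \<mu> b 0 = 0"
| "covit \<mu> b (Suc n) = covit \<mu> b n + (b - covop \<mu> (covit \<mu> b n))"

lemma
  fixes x :: "'d::euclidean_space" and S :: "'d set"
  shows wgt_pos: "0 < wgt x" and wgt_le_1: "wgt x \<le> 1" and wgt_norm2: "wgt x * (norm x)\<^sup>2 \<le> 1"
    and wgt_norm: "wgt x * norm x \<le> 1" and continuous_wgt: "continuous_on S wgt"
proof -
  have p: "1 + (norm y)\<^sup>2 > 0" for y :: 'd by (simp add: add_pos_nonneg)
  show "0 < wgt x" unfolding wgt_def using p[of x] by simp
  show "wgt x \<le> 1" unfolding wgt_def using p[of x] by (simp add: divide_le_eq)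
  show "wgt x * (norm x)\<^sup>2 \<le> 1" unfolding wgt_def using p[of x] by (simp add: divide_le_eq)
  have "norm x \<le> 1 + (norm x)\<^sup>2"
    using zero_le_power2[of "norm x - 1/2"] by (simp add: power2_eq_square algebra_simps)
  then show "wgt x * norm x \<le> 1" unfolding wgt_def using p[of x] by (simp add: divide_le_eq)
  show "continuous_on S wgt" unfolding wgt_def by (intro continuous_intros ballI less_imp_neq[OF p, symmetric])
qed

lemma wgt_measurable[measurable]: "wgt \<in> borel_measurable borel"
  by (rule borel_measurable_continuous_onI[OF continuous_wgt])

lemma wgt_inner2: "wgt x * (x \<bullet> u)\<^sup>2 \<le> (norm u)\<^sup>2"
proof -
  have "(x \<bullet> u)\<^sup>2 \<le> (norm x)\<^sup>2 * (norm u)\<^sup>2"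
    by (metis Cauchy_Schwarz_ineq power2_norm_eq_inner)
  then have "wgt x * (x \<bullet> u)\<^sup>2 \<le> wgt x * ((norm x)\<^sup>2 * (norm u)\<^sup>2)" using wgt_pos[of x] by simp
  also have "\<dots> \<le> 1 * (norm u)\<^sup>2" unfolding mult.assoc[symmetric] by (rule mult_right_mono[OF wgt_norm2]) simp
  finally show ?thesis by simp
qed

context
  fixes \<mu> :: "'d::euclidean_space measure"
  assumes P: "prob_space \<mu>" and s[measurable_cong]: "sets \<mu> = sets borel"
begin

interpretation prob_space \<mu> by (rule P)

lemma covop_integrable: "integrable \<mu> (\<lambda>x. (wgt x * (x \<bullet> u)) *\<^sub>R x)"
proof (rule integrable_const_bound[where B="norm u"])
  have "norm ((wgt x * (x \<bullet> u)) *\<^sub>R x) \<le> norm u" for x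
  proof -
    have "norm ((wgt x * (x \<bullet> u)) *\<^sub>R x) = wgt x * \<bar>x \<bullet> u\<bar> * norm x"
      using wgt_pos[of x] by (simp add: abs_mult)
    also have "\<dots> \<le> wgt x * (norm x * norm u) * norm x"
      using wgt_pos[of x] by (intro mult_right_mono mult_left_mono Cauchy_Schwarz_ineq2) auto
    also have "\<dots> = (wgt x * (norm x)\<^sup>2) * norm u" by (simp add: power2_eq_square)
    also have "\<dots> \<le> 1 * norm u" by (rule mult_right_mono[OF wgt_norm2]) simp
    finally show ?thesis by simp
  qed
  then show "AE x in \<mu>. norm ((wgt x * (x \<bullet> u)) *\<^sub>R x) \<le> norm u" by simp
qed measurable

lemma cmean_integrable: "integrable \<mu> (\<lambda>x. wgt x *\<^sub>R x)"
  by (rule integrable_const_bound[where B=1])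
    (simp_all add: abs_of_pos[OF wgt_pos] wgt_norm)

lemma cmass_integrable: "integrable \<mu> wgt"
  by (rule integrable_const_bound[where B=1])
    (simp_all add: abs_of_pos[OF wgt_pos] wgt_le_1)

lemma covop_inner: "covop \<mu> u \<bullet> y = (\<integral>x. wgt x * (x \<bullet> u) * (x \<bullet> y) \<partial>\<mu>)"
  and covop_inner_integrable: "integrable \<mu> (\<lambda>x. wgt x * (x \<bullet> u) * (x \<bullet> y))"
  using integral_inner_left[OF covop_integrable[of u], of y] integrable_inner_left[OF covop_integrable[of u], of y]
  by (simp_all add: covop_def)

lemma linear_covop: "linear (covop \<mu>)"
proof
  show "covop \<mu> (a + b) = covop \<mu> a + covop \<mu> b" for a b
    unfolding covop_def by (subst Bochner_Integration.integral_add[symmetric, OF covop_integrable covop_integrable])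
      (simp add: inner_add_right algebra_simps)
  show "covop \<mu> (c *\<^sub>R a) = c *\<^sub>R covop \<mu> a" for c a
    unfolding covop_def by (subst integral_scaleR_right[symmetric]) (simp add: mult.left_commute)
qed

lemma covop_in_span: "covop \<mu> u \<in> span (msupport \<mu>)"
proof -
  obtain y z where yz: "y \<in> span (msupport \<mu>)" "\<And>w. w \<in> span (msupport \<mu>) \<Longrightarrow> orthogonal z w" "covop \<mu> u = y + z"
    using orthogonal_subspace_decomp_exists by blast
  have "AE x in \<mu>. wgt x * (x \<bullet> u) * (x \<bullet> z) = 0" 
    using AE_msupport[OF s] by eventually_elim (use yz(2) span_base in \<open>auto simp: orthogonal_def inner_commute\<close>)
  then have "covop \<mu> u \<bullet> z = 0" unfolding covop_inner by (rule integral_eq_zero_AE)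
  moreover have "y \<bullet> z = 0" using yz(1,2) by (simp add: orthogonal_def inner_commute)
  ultimately have "z \<bullet> z = 0" by (simp add: yz(3) inner_add_left)
  then show ?thesis using yz by simp
qed

lemma covop_orthogonal:
  assumes "\<And>w. w \<in> span (msupport \<mu>) \<Longrightarrow> z \<bullet> w = 0"
  shows "covop \<mu> z = 0"
proof -
  have "AE x in \<mu>. (wgt x * (x \<bullet> z)) *\<^sub>R x = 0"
    using AE_msupport[OF s] by eventually_elim (use assms span_base in \<open>auto simp: inner_commute\<close>)
  then show ?thesis unfolding covop_def by (rule integral_eq_zero_AE)
qed

text \<open>Expresses that the operator C dominates its square, which justifies step size 1 in
  \<open>covit\<close>. For a = C u, the arithmetic-geometric mean inequality under the integral
  gives |a|^2 \<le> (a . u + a . C a) / 2, and the weight makes a . C a at most |a|^2.\<close>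

lemma covop_norm_le: "(norm (covop \<mu> u))\<^sup>2 \<le> covop \<mu> u \<bullet> u"
proof -
  define a where "a = covop \<mu> u"
  have i: "integrable \<mu> (\<lambda>x. wgt x * (x \<bullet> v)\<^sup>2)" for v
    using covop_inner_integrable[of v v] by (simp add: power2_eq_square ac_simps)
  have "a \<bullet> a = (\<integral>x. wgt x * (x \<bullet> u) * (x \<bullet> a) \<partial>\<mu>)" unfolding a_def covop_inner ..
  also have "\<dots> \<le> (\<integral>x. (wgt x * (x \<bullet> u)\<^sup>2 + wgt x * (x \<bullet> a)\<^sup>2) / 2 \<partial>\<mu>)"
  proof (rule integral_mono)
    show "wgt x * (x \<bullet> u) * (x \<bullet> a) \<le> (wgt x * (x \<bullet> u)\<^sup>2 + wgt x * (x \<bullet> a)\<^sup>2) / 2" for x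
    proof -
      have "wgt x * (2 * (x \<bullet> u) * (x \<bullet> a)) \<le> wgt x * ((x \<bullet> u)\<^sup>2 + (x \<bullet> a)\<^sup>2)"
        using wgt_pos[of x] sum_squares_bound by (intro mult_left_mono) auto
      then show ?thesis by (simp add: algebra_simps)
    qed
  qed (use i covop_inner_integrable in auto)
  also have "\<dots> = ((\<integral>x. wgt x * (x \<bullet> u)\<^sup>2 \<partial>\<mu>) + (\<integral>x. wgt x * (x \<bullet> a)\<^sup>2 \<partial>\<mu>)) / 2"
    using i by simp
  also have "(\<integral>x. wgt x * (x \<bullet> a)\<^sup>2 \<partial>\<mu>) \<le> (\<integral>x. (norm a)\<^sup>2 \<partial>\<mu>)"
    by (rule integral_mono[OF i]) (auto intro: wgt_inner2)
  also have "(\<integral>x. (norm a)\<^sup>2 \<partial>\<mu>) = a \<bullet> a" by (simp add: prob_space power2_norm_eq_inner)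
  also have "(\<integral>x. wgt x * (x \<bullet> u)\<^sup>2 \<partial>\<mu>) = a \<bullet> u"
    unfolding a_def covop_inner by (simp add: power2_eq_square ac_simps)
  finally show ?thesis by (simp add: a_def power2_norm_eq_inner)
qed

lemma covop_pos:
  assumes "e \<in> span (msupport \<mu>)" "e \<noteq> 0"
  shows "covop \<mu> e \<bullet> e > 0"
proof -
  have i: "integrable \<mu> (\<lambda>x. wgt x * (x \<bullet> e)\<^sup>2)"
    using covop_inner_integrable[of e e] by (simp add: power2_eq_square ac_simps)
  have eq: "covop \<mu> e \<bullet> e = (\<integral>x. wgt x * (x \<bullet> e)\<^sup>2 \<partial>\<mu>)"
    unfolding covop_inner by (simp add: power2_eq_square ac_simps)
  have "(\<integral>x. wgt x * (x \<bullet> e)\<^sup>2 \<partial>\<mu>) \<noteq> 0"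
  proof
    assume "(\<integral>x. wgt x * (x \<bullet> e)\<^sup>2 \<partial>\<mu>) = 0"
    then have "\<forall>y\<in>msupport \<mu>. wgt y * (y \<bullet> e)\<^sup>2 = 0"
      by (subst (asm) integral_zero_iff_msupport[OF s _ _ i])
        (auto intro!: continuous_intros continuous_wgt mult_nonneg_nonneg less_imp_le[OF wgt_pos])
    then have "\<And>y. y \<in> msupport \<mu> \<Longrightarrow> orthogonal e y" 
      by (auto simp: orthogonal_def inner_commute) (metis less_irrefl wgt_pos)
    then have "orthogonal e e" using orthogonal_to_span assms(1) by blast
    then show False using assms(2) by (simp add: orthogonal_def)
  qed
  moreover have "(\<integral>x. wgt x * (x \<bullet> e)\<^sup>2 \<partial>\<mu>) \<ge> 0"
    by (intro Bochner_Integration.integral_nonneg mult_nonneg_nonneg less_imp_le[OF wgt_pos]) simp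
  ultimately show ?thesis unfolding eq by linarith
qed

text \<open>Positivity on the compact unit sphere of the span. The constant depends on the measure,
  which is harmless: only convergence of the iteration, not a rate, is used afterwards.\<close>

lemma covop_coercive: "\<exists>c>0. \<forall>e\<in>span (msupport \<mu>). covop \<mu> e \<bullet> e \<ge> c * (norm e)\<^sup>2"
proof -
  define C where "C = sphere 0 1 \<inter> span (msupport \<mu>)"
  have C: "compact C" unfolding C_def by (intro compact_Int_closed compact_sphere closed_span)
  have cont: "continuous_on C (\<lambda>e. covop \<mu> e \<bullet> e)"
    by (intro continuous_intros linear_continuous_on linear_conv_bounded_linear[THEN iffD1] linear_covop)
  show ?thesis
  proof (cases "C = {}")
    case True
    have "e = 0" if "e \<in> span (msupport \<mu>)" for e
    proof (rule ccontr)
      assume "e \<noteq> 0" then have "e /\<^sub>R norm e \<in> C" using that by (auto simp: C_def span_scale)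
      with True show False by simp
    qed
    then have "covop \<mu> e \<bullet> e \<ge> 1 * (norm e)\<^sup>2" if "e \<in> span (msupport \<mu>)" for e
      using that by (metis inner_zero_right norm_zero mult_zero_right order_refl zero_power2)
    then show ?thesis by (intro exI[of _ 1]) auto
  next
    case False
    obtain m where m: "m \<in> C" "\<And>e. e \<in> C \<Longrightarrow> covop \<mu> m \<bullet> m \<le> covop \<mu> e \<bullet> e"
      using continuous_attains_inf[OF C False cont] by blast
    have m0: "covop \<mu> m \<bullet> m > 0" using m(1) by (intro covop_pos) (auto simp: C_def)
    have "covop \<mu> m \<bullet> m * (norm e)\<^sup>2 \<le> covop \<mu> e \<bullet> e" if e: "e \<in> span (msupport \<mu>)" for e
    proof (cases "e = 0")
      case True then show ?thesis by simp
    next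
      case False
      then have "e /\<^sub>R norm e \<in> C" using e by (auto simp: C_def span_scale)
      from m(2)[OF this] have "covop \<mu> m \<bullet> m \<le> (covop \<mu> e \<bullet> e) / (norm e)\<^sup>2"
        by (simp add: linear_cmul[OF linear_covop] power2_eq_square divide_inverse ac_simps)
      then show ?thesis using False by (simp add: field_simps)
    qed
    then show ?thesis using m0 by blast
  qed
qed

text \<open>Gradient descent for the normal equations; on the span of the support it is a contraction.\<close>

lemma covit_converges:
  assumes z: "z \<in> span (msupport \<mu>)" and b: "b = covop \<mu> z"
  shows "covit \<mu> b \<longlonglongrightarrow> z"
proof -
  obtain c where c: "c > 0" "\<And>e. e \<in> span (msupport \<mu>) \<Longrightarrow> covop \<mu> e \<bullet> e \<ge> c * (norm e)\<^sup>2"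
    using covop_coercive by blast
  \<comment> \<open>The error e is mapped to e - C e, and |e - C e|^2 = |e|^2 - 2 C e . e + |C e|^2
    \<le> (1 - c') |e|^2; capping at 1 keeps this factor nonnegative.\<close>
  define c' where "c' = min c 1"
  have c': "0 < c'" "c' \<le> 1" "c' \<le> c" using c by (auto simp: c'_def)
  have sp: "z - covit \<mu> b n \<in> span (msupport \<mu>)" for n
  proof (induction n)
    case (Suc n)
    have "z - covit \<mu> b (Suc n) = (z - covit \<mu> b n) - (b - covop \<mu> (covit \<mu> b n))" by simp
    then show ?case using Suc covop_in_span by (metis b span_diff)
  qed (use z in simp)
  have step: "(norm (z - covit \<mu> b (Suc n)))\<^sup>2 \<le> (1 - c') * (norm (z - covit \<mu> b n))\<^sup>2" for n
  proof -
    define e where "e = z - covit \<mu> b n"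
    have e: "z - covit \<mu> b (Suc n) = e - covop \<mu> e"
      by (simp add: e_def b linear_diff[OF linear_covop])
    have "(norm (e - covop \<mu> e))\<^sup>2 = (norm e)\<^sup>2 - 2 * (covop \<mu> e \<bullet> e) + (norm (covop \<mu> e))\<^sup>2"
      by (simp add: power2_norm_eq_inner inner_diff_left inner_diff_right inner_commute algebra_simps)
    also have "\<dots> \<le> (norm e)\<^sup>2 - covop \<mu> e \<bullet> e" using covop_norm_le[of e] by simp
    also have "\<dots> \<le> (norm e)\<^sup>2 - c * (norm e)\<^sup>2" using c(2)[OF sp[of n]] by (simp add: e_def)
    also have "\<dots> \<le> (1 - c') * (norm e)\<^sup>2"
      using mult_right_mono[OF c'(3), of "(norm e)\<^sup>2"] by (simp add: algebra_simps)
    finally show ?thesis by (simp only: e) (simp add: e_def)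
  qed
  have bound: "(norm (z - covit \<mu> b n))\<^sup>2 \<le> (1 - c') ^ n * (norm z)\<^sup>2" for n
  proof (induction n)
    case (Suc n)
    have "(1 - c') * (norm (z - covit \<mu> b n))\<^sup>2 \<le> (1 - c') * ((1 - c') ^ n * (norm z)\<^sup>2)"
      using Suc c' by (intro mult_left_mono) auto
    with step[of n] show ?case by simp
  qed simp
  have "(\<lambda>n. (1 - c') ^ n * (norm z)\<^sup>2) \<longlonglongrightarrow> 0"
    by (intro tendsto_mult_left_zero LIMSEQ_power_zero) (use c' in auto)
  then have "(\<lambda>n. (norm (z - covit \<mu> b n))\<^sup>2) \<longlonglongrightarrow> 0"
    by (rule tendsto_sandwich[OF _ _ tendsto_const, rotated 2]) (auto simp: bound)
  from tendsto_real_sqrt[OF this] have "(\<lambda>n. norm (z - covit \<mu> b n)) \<longlonglongrightarrow> 0" by simp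
  then have "(\<lambda>n. z - covit \<mu> b n) \<longlonglongrightarrow> 0" by (rule tendsto_norm_zero_cancel)
  then have "(\<lambda>n. z - (z - covit \<mu> b n)) \<longlonglongrightarrow> z - 0" by (intro tendsto_intros)
  then show ?thesis by simp
qed

text \<open>Expansion of the weighted integral of (x . v - 1)^2, which is zero exactly when the
  integrand vanishes on the support. The moment equation involves only quantities that are
  measurable in a kernel.\<close>

lemma unit_functional_on_msupport_iff:
  "(\<forall>y\<in>msupport \<mu>. v \<bullet> y = 1) \<longleftrightarrow> v \<bullet> covop \<mu> v - 2 * (v \<bullet> cmean \<mu>) + cmass \<mu> = 0"
proof -
  have i1: "integrable \<mu> (\<lambda>x. wgt x * (x \<bullet> v) * (x \<bullet> v))" by (rule covop_inner_integrable)
  have i2: "integrable \<mu> (\<lambda>x. wgt x * (x \<bullet> v))"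
    using integrable_inner_left[OF cmean_integrable, of v] by simp
  have eq: "wgt x * (x \<bullet> v - 1)\<^sup>2 = wgt x * (x \<bullet> v) * (x \<bullet> v) - 2 * (wgt x * (x \<bullet> v)) + wgt x" for x
    by (simp add: power2_eq_square algebra_simps)
  have i: "integrable \<mu> (\<lambda>x. wgt x * (x \<bullet> v - 1)\<^sup>2)" unfolding eq using i1 i2 cmass_integrable by auto
  have "(\<integral>x. wgt x * (x \<bullet> v - 1)\<^sup>2 \<partial>\<mu>) = v \<bullet> covop \<mu> v - 2 * (v \<bullet> cmean \<mu>) + cmass \<mu>"
    unfolding eq using i1 i2 cmass_integrable integral_inner_left[OF cmean_integrable, of v]
    by (simp add: covop_inner inner_commute[of v] cmass_def) (simp add: cmean_def)
  moreover have "(\<integral>x. wgt x * (x \<bullet> v - 1)\<^sup>2 \<partial>\<mu>) = 0 \<longleftrightarrow> (\<forall>y\<in>msupport \<mu>. wgt y * (y \<bullet> v - 1)\<^sup>2 = 0)"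
    by (rule integral_zero_iff_msupport[OF s _ _ i])
      (auto intro!: continuous_intros continuous_wgt mult_nonneg_nonneg less_imp_le[OF wgt_pos])
  moreover have "wgt y * (y \<bullet> v - 1)\<^sup>2 = 0 \<longleftrightarrow> v \<bullet> y = 1" for y
    using wgt_pos[of y] by (auto simp: inner_commute)
  ultimately show ?thesis by simp
qed

text \<open>As x . v = 1 almost surely, \<open>cmean\<close> equals \<open>covop\<close> applied to
  v, so v is recovered from data that do not mention it.\<close>

lemma covit_cmean_converges:
  assumes v: "v \<in> span (msupport \<mu>)" "\<And>y. y \<in> msupport \<mu> \<Longrightarrow> v \<bullet> y = 1"
  shows "covit \<mu> (cmean \<mu>) \<longlonglongrightarrow> v"
proof (rule covit_converges[OF v(1)])
  have "AE x in \<mu>. wgt x *\<^sub>R x = (wgt x * (x \<bullet> v)) *\<^sub>R x"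
    using AE_msupport[OF s] by eventually_elim (simp add: v(2) inner_commute[of _ v])
  then show "cmean \<mu> = covop \<mu> v"
    unfolding cmean_def covop_def by (intro integral_cong_AE) auto
qed

end

text \<open>The point a of the hull nearest to 0 is nonzero and orthogonal to all differences y - a,
  so a / (a . a) serves.\<close>

lemma unit_functional_off_affine_hull:
  fixes S :: "'d::euclidean_space set"
  assumes "0 \<notin> affine hull S"
  shows "\<exists>v\<in>span S. \<forall>y\<in>S. v \<bullet> y = 1"
proof (cases "S = {}")
  case True then show ?thesis using span_zero by auto
next
  case False
  define H where "H = affine hull S"
  have H: "closed H" "convex H" "H \<noteq> {}" using False by (auto simp: H_def closed_affine_hull affine_imp_convex)
  define a where "a = closest_point H 0"
  have a: "a \<in> H" unfolding a_def by (rule closest_point_in_set[OF H(1,3)])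
  have "a \<bullet> y = a \<bullet> a" if y: "y \<in> S" for y
  proof -
    have yH: "y \<in> H" using y by (simp add: H_def hull_inc)
    \<comment> \<open>The reflection of \<open>y\<close> in \<open>a\<close> also lies in the affine
      hull, so the closest-point inequality holds in both directions and becomes an
      equality.\<close>
    have "2 *\<^sub>R a + (-1) *\<^sub>R y \<in> H" 
      using mem_affine[of H a y 2 "-1"] a yH by (simp add: H_def affine_affine_hull)
    from closest_point_dot[OF H(2,1) this, of 0] closest_point_dot[OF H(2,1) yH, of 0]
    show ?thesis by (simp add: a_def[symmetric] inner_diff_right algebra_simps inner_add_right)
  qed
  moreover have "a \<noteq> 0" using a assms by (auto simp: H_def)
  moreover have "a \<in> span S" using a affine_hull_subset_span[of S] by (auto simp: H_def)
  ultimately show ?thesis by (intro bexI[of _ "a /\<^sub>R (a \<bullet> a)"]) (auto simp: span_scale)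
qed

lemma is_rcd_kernel:
  assumes sub: "subalgebra M G" and K: "is_rcd M G X K"
  shows "K \<in> measurable G (subprob_algebra borel)"
  using K sub by (intro measurable_subprob_algebra) (auto simp: is_rcd_def subalgebra_def intro: prob_space_imp_subprob_space)

context
  fixes M G :: "'a measure" and X :: "'a \<Rightarrow> 'd::euclidean_space" and K
  assumes M: "prob_space M" and sub: "subalgebra M G" and K: "is_rcd M G X K"
begin

lemma kernel_space: "\<omega> \<in> space G \<Longrightarrow> prob_space (K \<omega>)" "\<omega> \<in> space G \<Longrightarrow> sets (K \<omega>) = sets borel"
  using K sub by (auto simp: is_rcd_def subalgebra_def)

lemma kernel_meas[measurable]: "K \<in> measurable G (subprob_algebra borel)"
  using is_rcd_kernel[OF sub K] .

text \<open>Linearity reduces a variable argument to the finitely many basis vectors, for which the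
  value is a plain kernel integral.\<close>

lemma covop_kernel_measurable:
  assumes [measurable]: "u \<in> borel_measurable G"
  shows "(\<lambda>\<omega>. covop (K \<omega>) (u \<omega>)) \<in> borel_measurable G"
proof -
  have b[measurable]: "(\<lambda>\<omega>. covop (K \<omega>) b) \<in> borel_measurable G" for b
    unfolding covop_def by (rule measurable_compose[OF kernel_meas integral_measurable_subprob_algebra]) simp
  have "(\<lambda>\<omega>. \<Sum>b\<in>Basis. (u \<omega> \<bullet> b) *\<^sub>R covop (K \<omega>) b) \<in> borel_measurable G" by measurable
  then show ?thesis
  proof (rule measurable_cong[THEN iffD1, rotated])
    fix \<omega> assume w: "\<omega> \<in> space G"
    note L = linear_covop[OF kernel_space[OF w]]
    have "covop (K \<omega>) (u \<omega>) = covop (K \<omega>) (\<Sum>b\<in>Basis. (u \<omega> \<bullet> b) *\<^sub>R b)" by (simp add: euclidean_representation)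
    then show "(\<Sum>b\<in>Basis. (u \<omega> \<bullet> b) *\<^sub>R covop (K \<omega>) b) = covop (K \<omega>) (u \<omega>)"
      by (simp add: linear_sum[OF L] linear_cmul[OF L])
  qed
qed

lemma cmean_kernel_measurable[measurable]: "(\<lambda>\<omega>. cmean (K \<omega>)) \<in> borel_measurable G"
  unfolding cmean_def by (rule measurable_compose[OF kernel_meas integral_measurable_subprob_algebra]) simp

lemma cmass_kernel_measurable[measurable]: "(\<lambda>\<omega>. cmass (K \<omega>)) \<in> borel_measurable G"
  unfolding cmass_def by (rule measurable_compose[OF kernel_meas integral_measurable_subprob_algebra]) simp

lemma lim_covit_kernel_measurable:
  assumes [measurable]: "b \<in> borel_measurable G"
  shows "(\<lambda>\<omega>. lim (covit (K \<omega>) (b \<omega>))) \<in> borel_measurable G"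
proof -
  have "(\<lambda>\<omega>. covit (K \<omega>) (b \<omega>) n) \<in> borel_measurable G" for n
    by (induction n) (auto intro!: borel_measurable_add borel_measurable_diff covop_kernel_measurable)
  then show ?thesis by (rule borel_measurable_lim_metric)
qed

text \<open>\<open>covop\<close> kills the component orthogonal to the span, so the iteration with
  the measurable right-hand side \<open>covop (K \<omega>) (\<phi> \<omega>)\<close> converges to
  the orthogonal projection of \<phi>.\<close>

lemma kernel_projection:
  assumes \<phi>[measurable]: "\<phi> \<in> borel_measurable G"
  shows "\<exists>\<psi>\<in>borel_measurable G. \<forall>\<omega>\<in>space M. \<psi> \<omega> \<in> span (msupport (K \<omega>)) \<and>
      (\<forall>y\<in>span (msupport (K \<omega>)). (\<phi> \<omega> - \<psi> \<omega>) \<bullet> y = 0)"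
proof (intro bexI[of _ "\<lambda>\<omega>. lim (covit (K \<omega>) (covop (K \<omega>) (\<phi> \<omega>)))"] ballI)
  fix \<omega> assume "\<omega> \<in> space M"
  then have w: "\<omega> \<in> space G" using sub by (simp add: subalgebra_def)
  note ks = kernel_space[OF w]
  obtain y z where yz: "y \<in> span (msupport (K \<omega>))" "\<And>w. w \<in> span (msupport (K \<omega>)) \<Longrightarrow> orthogonal z w" "\<phi> \<omega> = y + z"
    using orthogonal_subspace_decomp_exists by blast
  have "covop (K \<omega>) z = 0" using yz(2) by (intro covop_orthogonal[OF ks]) (auto simp: orthogonal_def)
  then have "covop (K \<omega>) (\<phi> \<omega>) = covop (K \<omega>) y" by (simp add: yz(3) linear_add[OF linear_covop[OF ks]])
  from limI[OF covit_converges[OF ks yz(1) this]]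
  show "lim (covit (K \<omega>) (covop (K \<omega>) (\<phi> \<omega>))) \<in> span (msupport (K \<omega>)) \<and>
      (\<forall>y\<in>span (msupport (K \<omega>)). (\<phi> \<omega> - lim (covit (K \<omega>) (covop (K \<omega>) (\<phi> \<omega>)))) \<bullet> y = 0)"
    using yz by (auto simp: orthogonal_def)
qed (intro lim_covit_kernel_measurable covop_kernel_measurable \<phi>)

text \<open>Supplies, in measurable form, a direction that gains exactly 1 wherever the affine hull
  misses 0; this becomes the arbitrage in \<open>AE_zero_Dset\<close>.\<close>

lemma kernel_arbitrage:
  "\<exists>v\<in>borel_measurable G. \<exists>B\<in>sets G. (\<forall>\<omega>\<in>B. \<forall>y\<in>msupport (K \<omega>). v \<omega> \<bullet> y = 1) \<and>
      (\<forall>\<omega>\<in>space M. 0 \<notin> affine hull (msupport (K \<omega>)) \<longrightarrow> \<omega> \<in> B)"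
proof -
  define v where "v = (\<lambda>\<omega>. lim (covit (K \<omega>) (cmean (K \<omega>))))"
  have v[measurable]: "v \<in> borel_measurable G"
    unfolding v_def by (rule lim_covit_kernel_measurable) measurable
  note [measurable] = covop_kernel_measurable[OF v]
  \<comment> \<open>\<open>lim\<close> is an arbitrary value where the iteration diverges, so
    \<open>B\<close> tests the candidate \<open>v\<close> by the measurable moment equation.\<close>
  define B where "B = {\<omega>\<in>space G. v \<omega> \<bullet> covop (K \<omega>) (v \<omega>) - 2 * (v \<omega> \<bullet> cmean (K \<omega>)) + cmass (K \<omega>) = 0}"
  have "B \<in> sets G" unfolding B_def by measurable
  moreover have "\<forall>y\<in>msupport (K \<omega>). v \<omega> \<bullet> y = 1" if "\<omega> \<in> B" for \<omega>
    using that unit_functional_on_msupport_iff[OF kernel_space] by (auto simp: B_def)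
  moreover have "\<omega> \<in> B" if "\<omega> \<in> space M" and n0: "0 \<notin> affine hull (msupport (K \<omega>))" for \<omega>
  proof -
    have w: "\<omega> \<in> space G" using that(1) sub by (simp add: subalgebra_def)
    obtain u where u: "u \<in> span (msupport (K \<omega>))" "\<And>y. y \<in> msupport (K \<omega>) \<Longrightarrow> u \<bullet> y = 1"
      using unit_functional_off_affine_hull[OF n0] by blast
    have "v \<omega> = u" unfolding v_def by (rule limI[OF covit_cmean_converges[OF kernel_space[OF w] u]])
    then show ?thesis using unit_functional_on_msupport_iff[OF kernel_space[OF w], of u] u(2) w by (simp add: B_def)
  qed
  ultimately show ?thesis using v by blast
qed

end

section \<open>Strategies, wealth and conditional spans on the filtered space\<close>

locale filtered_prob_space =
  fixes M :: "'a measure" and Fl :: "nat \<Rightarrow> 'a measure" and T :: nat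
  assumes fps: "filtered_ps M Fl T"

sublocale filtered_prob_space \<subseteq> prob_space M
  using fps by (simp add: filtered_ps_def)

context filtered_prob_space
begin

lemma subalg: "t \<le> T \<Longrightarrow> subalgebra M (Fl t)"
  using fps by (simp add: filtered_ps_def)

lemma fmsub: "t \<le> T \<Longrightarrow> finite_measure_subalgebra M (Fl t)"
  by (intro finite_measure_subalgebra.intro finite_measure_subalgebra_axioms.intro subalg) unfold_locales

lemma meas_M: "t \<le> T \<Longrightarrow> f \<in> borel_measurable (Fl t) \<Longrightarrow> f \<in> borel_measurable M"
  using measurable_from_subalg[OF subalg] .

lemma meas_mono:
  assumes "s \<le> t" "t \<le> T" "f \<in> borel_measurable (Fl s)"
  shows "f \<in> borel_measurable (Fl t)"
proof (rule measurable_from_subalg[OF _ assms(3)])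
  show "subalgebra (Fl t) (Fl s)"
    using fps assms(1,2) subalg[of s] subalg[of t] by (auto simp: filtered_ps_def subalgebra_def)
qed

lemma incr_meas:
  assumes "adapted Fl T S" "t \<in> {1..T}"
  shows "incr S t \<in> borel_measurable (Fl t)"
proof -
  have "S t \<in> borel_measurable (Fl t)" using assms by (simp add: adapted_def)
  moreover have "S (t - 1) \<in> borel_measurable (Fl t)"
    by (rule meas_mono[of "t - 1"]) (use assms in \<open>auto simp: adapted_def\<close>)
  ultimately have "(\<lambda>\<omega>. S t \<omega> - S (t - 1) \<omega>) \<in> borel_measurable (Fl t)" by measurable
  then show ?thesis by (simp add: incr_def[abs_def])
qed

lemma wealth_meas:
  assumes "adapted Fl T S" "\<phi> \<in> strategies Fl T" "t \<le> T"
  shows "wealth S t w \<phi> \<in> borel_measurable (Fl t)"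
proof -
  have "(\<lambda>\<omega>. \<phi> s \<omega> \<bullet> incr S s \<omega>) \<in> borel_measurable (Fl t)" if s: "s \<in> {1..t}" for s
  proof (rule borel_measurable_inner)
    show "\<phi> s \<in> borel_measurable (Fl t)"
      using assms(2,3) s by (intro meas_mono[of "s - 1" t]) (auto simp: strategies_def)
    show "incr S s \<in> borel_measurable (Fl t)"
      using assms(3) s by (intro meas_mono[of s t] incr_meas[OF assms(1)]) auto
  qed
  then have "(\<lambda>\<omega>. w + (\<Sum>s\<in>{1..t}. \<phi> s \<omega> \<bullet> incr S s \<omega>)) \<in> borel_measurable (Fl t)"
    by (rule borel_measurable_add[OF borel_measurable_const borel_measurable_sum])
  then show ?thesis by (simp add: wealth_def[abs_def])
qed

lemma wealth_step:
  assumes "t \<in> {1..T}"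
  shows "wealth S t w \<phi> \<omega> = wealth S (t - 1) w \<phi> \<omega> + \<phi> t \<omega> \<bullet> incr S t \<omega>"
  using assms by (cases t) (auto simp: wealth_def)

context
  fixes S :: "nat \<Rightarrow> 'a \<Rightarrow> 'd::euclidean_space" and t
  assumes ad: "adapted Fl T S" and t: "t \<in> {1..T}"
begin

lemma rcd_incr: "is_rcd M (Fl (t - 1)) (incr S t) (rcd M (Fl (t - 1)) (incr S t))"
  using t by (intro is_rcd_rcd prob_space_axioms subalg meas_M[OF _ incr_meas[OF ad t]]) auto

lemma AE_incr_Dset: "AE \<omega> in M. incr S t \<omega> \<in> Dset M Fl S t \<omega>"
proof -
  have "AE \<omega> in M. incr S t \<omega> \<in> msupport (rcd M (Fl (t - 1)) (incr S t) \<omega>)"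
    using t by (intro AE_rcd_msupport[OF prob_space_axioms subalg _ rcd_incr] meas_M[OF _ incr_meas[OF ad t]]) auto
  then show ?thesis by eventually_elim (simp add: Dset_def hull_inc)
qed

text \<open>Trading \<open>v\<close> on \<open>B\<close> at the single date t earns exactly the
  indicator of \<open>B\<close>, so no arbitrage forces \<open>B\<close> to be null. Consequently
  the affine hull is almost surely a linear subspace.\<close>

lemma AE_zero_Dset:
  assumes NA: "NA M Fl T S"
  shows "AE \<omega> in M. 0 \<in> Dset M Fl S t \<omega>"
proof -
  let ?K = "rcd M (Fl (t - 1)) (incr S t)"
  have sub: "subalgebra M (Fl (t - 1))" using t by (intro subalg) auto
  obtain v B where v[measurable]: "v \<in> borel_measurable (Fl (t - 1))" and B[measurable]: "B \<in> sets (Fl (t - 1))"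
    and v1: "\<And>\<omega> y. \<omega> \<in> B \<Longrightarrow> y \<in> msupport (?K \<omega>) \<Longrightarrow> v \<omega> \<bullet> y = 1"
    and B0: "\<And>\<omega>. \<omega> \<in> space M \<Longrightarrow> 0 \<notin> affine hull (msupport (?K \<omega>)) \<Longrightarrow> \<omega> \<in> B"
    using kernel_arbitrage[OF prob_space_axioms sub rcd_incr] by blast
  define \<phi> where "\<phi> s \<omega> = (if s = t then indicator B \<omega> *\<^sub>R v \<omega> else 0)" for s \<omega>
  have \<phi>: "\<phi> \<in> strategies Fl T" unfolding strategies_def
  proof (intro CollectI ballI)
    fix s assume "s \<in> {1..T}"
    show "\<phi> s \<in> borel_measurable (Fl (s - 1))" unfolding \<phi>_def using v B by (cases "s = t") (simp_all del: One_nat_def)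
  qed
  have w: "wealth S T 0 \<phi> \<omega> = indicator B \<omega> * (v \<omega> \<bullet> incr S t \<omega>)" for \<omega>
  proof -
    have "(\<Sum>s\<in>{1..T}. \<phi> s \<omega> \<bullet> incr S s \<omega>) = (\<Sum>s\<in>{1..T}. if s = t then indicator B \<omega> * (v \<omega> \<bullet> incr S t \<omega>) else 0)"
      by (rule sum.cong) (auto simp: \<phi>_def)
    also have "\<dots> = indicator B \<omega> * (v \<omega> \<bullet> incr S t \<omega>)" using t by (subst sum.delta) auto
    finally show ?thesis by (simp add: wealth_def)
  qed
  have "AE \<omega> in M. incr S t \<omega> \<in> msupport (?K \<omega>)"
    using t by (intro AE_rcd_msupport[OF prob_space_axioms sub _ rcd_incr] meas_M[OF _ incr_meas[OF ad t]]) auto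
  then have w1: "AE \<omega> in M. wealth S T 0 \<phi> \<omega> = indicator B \<omega>"
    by eventually_elim (auto simp: w v1 indicator_def)
  then have "AE \<omega> in M. wealth S T 0 \<phi> \<omega> \<ge> 0" by eventually_elim simp
  then have "AE \<omega> in M. wealth S T 0 \<phi> \<omega> = 0" using NA \<phi> by (auto simp: NA_def)
  with w1 AE_space show ?thesis
  proof eventually_elim
    case (elim \<omega>)
    then have "\<omega> \<notin> B" by auto
    then show ?case using B0[OF elim(2)] unfolding Dset_def by blast
  qed
qed

text \<open>Once 0 lies in the affine hull, the hull equals the linear span of the support, to which
  \<open>kernel_projection\<close> applies.\<close>

lemma Dset_projection:
  assumes NA: "NA M Fl T S" and \<xi>: "\<xi> \<in> borel_measurable (Fl (t - 1))"
  shows "\<exists>\<xi>'\<in>borel_measurable (Fl (t - 1)). AE \<omega> in M. \<xi>' \<omega> \<in> Dset M Fl S t \<omega> \<and>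
     (\<forall>y\<in>Dset M Fl S t \<omega>. (\<xi> \<omega> - \<xi>' \<omega>) \<bullet> y = 0)"
proof -
  let ?K = "rcd M (Fl (t - 1)) (incr S t)"
  have sub: "subalgebra M (Fl (t - 1))" using t by (intro subalg) auto
  obtain \<xi>' where \<xi>': "\<xi>' \<in> borel_measurable (Fl (t - 1))" 
    "\<And>\<omega>. \<omega> \<in> space M \<Longrightarrow> \<xi>' \<omega> \<in> span (msupport (?K \<omega>)) \<and> (\<forall>y\<in>span (msupport (?K \<omega>)). (\<xi> \<omega> - \<xi>' \<omega>) \<bullet> y = 0)"
    using kernel_projection[OF prob_space_axioms sub rcd_incr \<xi>] by (elim bexE) (rule that, auto)
  have key: "\<xi>' \<omega> \<in> Dset M Fl S t \<omega> \<and> (\<forall>y\<in>Dset M Fl S t \<omega>. (\<xi> \<omega> - \<xi>' \<omega>) \<bullet> y = 0)"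
    if "0 \<in> Dset M Fl S t \<omega>" "\<omega> \<in> space M" for \<omega>
  proof -
    have "Dset M Fl S t \<omega> = span (msupport (?K \<omega>))"
      using affine_hull_span_0[of "msupport (?K \<omega>)"] that(1) by (simp add: Dset_def)
    then show ?thesis using \<xi>'(2)[OF that(2)] by simp
  qed
  show ?thesis
  proof (rule bexI)
    show "AE \<omega> in M. \<xi>' \<omega> \<in> Dset M Fl S t \<omega> \<and> (\<forall>y\<in>Dset M Fl S t \<omega>. (\<xi> \<omega> - \<xi>' \<omega>) \<bullet> y = 0)"
    proof (rule eventually_mono[OF eventually_conj])
      show "AE \<omega> in M. 0 \<in> Dset M Fl S t \<omega>" by (rule AE_zero_Dset[OF NA])
      show "AE \<omega> in M. \<omega> \<in> space M" by (rule AE_space)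
    qed (simp add: key)
    show "\<xi>' \<in> borel_measurable (Fl (t - 1))" by (rule \<xi>'(1))
  qed
qed

end

end

section \<open>Weighted a priori bounds\<close>

text \<open>Integer powers suffice to put 1/V in every L^p, since 1/V \<ge> 1. The bound V \<le> 1
  allows factors to be dropped in estimates.\<close>

definition weight :: "'a measure \<Rightarrow> ('a \<Rightarrow> real) \<Rightarrow> bool" where
  "weight M V \<longleftrightarrow> V \<in> borel_measurable M \<and> (AE \<omega> in M. 0 < V \<omega> \<and> V \<omega> \<le> 1) \<and>
     (\<forall>n::nat. integrable M (\<lambda>\<omega>. (1 / V \<omega>) ^ n))"

lemma weight_meas: "weight M V \<Longrightarrow> V \<in> borel_measurable M"
  and weight_AE: "weight M V \<Longrightarrow> AE \<omega> in M. 0 < V \<omega> \<and> V \<omega> \<le> 1"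
  and weight_int: "weight M V \<Longrightarrow> integrable M (\<lambda>\<omega>. (1 / V \<omega>) ^ n)"
  by (auto simp: weight_def)

context prob_space
begin

lemma weight_one: "weight M (\<lambda>_. 1)"
  by (simp add: weight_def)

text \<open>Moments of the product follow from a b \<le> a^2 + b^2 at the price of doubling the
  order, which is why \<open>weight\<close> asks for all orders.\<close>

lemma weight_mult:
  assumes V: "weight M V" and W: "weight M W"
  shows "weight M (\<lambda>\<omega>. V \<omega> * W \<omega>)"
  unfolding weight_def
proof (intro conjI allI)
  note [measurable] = weight_meas[OF V] weight_meas[OF W]
  show "(\<lambda>\<omega>. V \<omega> * W \<omega>) \<in> borel_measurable M" by measurable
  show "AE \<omega> in M. 0 < V \<omega> * W \<omega> \<and> V \<omega> * W \<omega> \<le> 1"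
    using weight_AE[OF V] weight_AE[OF W] by eventually_elim (simp add: mult_le_one)
  fix n :: nat
  show "integrable M (\<lambda>\<omega>. (1 / (V \<omega> * W \<omega>)) ^ n)"
  proof (rule Bochner_Integration.integrable_bound)
    show "integrable M (\<lambda>\<omega>. (1 / V \<omega>) ^ (2 * n) + (1 / W \<omega>) ^ (2 * n))"
      by (intro Bochner_Integration.integrable_add weight_int V W)
    show "AE \<omega> in M. norm ((1 / (V \<omega> * W \<omega>)) ^ n) \<le> norm ((1 / V \<omega>) ^ (2 * n) + (1 / W \<omega>) ^ (2 * n))"
      using weight_AE[OF V] weight_AE[OF W]
    proof eventually_elim
      case (elim \<omega>)
      define a b where "a = (1 / V \<omega>) ^ n" and "b = (1 / W \<omega>) ^ n"
      have ab: "a \<ge> 0" "b \<ge> 0" using elim by (auto simp: a_def b_def)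
      have "(1 / (V \<omega> * W \<omega>)) ^ n = a * b" by (simp add: a_def b_def power_divide power_mult_distrib)
      moreover have "(1 / V \<omega>) ^ (2 * n) = a\<^sup>2" "(1 / W \<omega>) ^ (2 * n) = b\<^sup>2"
        by (simp_all add: a_def b_def power_mult[symmetric] mult.commute)
      moreover have "a * b \<le> a\<^sup>2 + b\<^sup>2" using sum_squares_bound[of a b] ab mult_nonneg_nonneg[OF ab] by linarith
      ultimately show ?case using ab by simp
    qed
  qed measurable
qed

lemma weight_min_one:
  assumes f[measurable]: "f \<in> borel_measurable M" and pos: "AE \<omega> in M. 0 < f \<omega>"
    and int: "\<And>p. p > 0 \<Longrightarrow> integrable M (\<lambda>\<omega>. \<bar>1 / f \<omega>\<bar> powr p)"
  shows "weight M (\<lambda>\<omega>. min 1 (f \<omega>))"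
  unfolding weight_def
proof (intro conjI allI)
  show "(\<lambda>\<omega>. min 1 (f \<omega>)) \<in> borel_measurable M" by measurable
  show "AE \<omega> in M. 0 < min 1 (f \<omega>) \<and> min 1 (f \<omega>) \<le> 1" using pos by eventually_elim simp
  fix n :: nat
  show "integrable M (\<lambda>\<omega>. (1 / min 1 (f \<omega>)) ^ n)"
  proof (cases "n = 0")
    case True then show ?thesis by simp
  next
    case False
    show ?thesis
    proof (rule Bochner_Integration.integrable_bound)
      show "integrable M (\<lambda>\<omega>. 1 + \<bar>1 / f \<omega>\<bar> powr (real n))" using False by (intro Bochner_Integration.integrable_add int) auto
      show "AE \<omega> in M. norm ((1 / min 1 (f \<omega>)) ^ n) \<le> norm (1 + \<bar>1 / f \<omega>\<bar> powr real n)"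
        using pos by eventually_elim (auto simp: powr_realpow min_def)
    qed measurable
  qed
qed

lemma weight_inverse_one_plus:
  assumes g[measurable]: "g \<in> borel_measurable M" and pos: "\<And>\<omega>. 0 \<le> g \<omega>"
    and int: "\<And>p. p > 0 \<Longrightarrow> integrable M (\<lambda>\<omega>. \<bar>g \<omega>\<bar> powr p)"
  shows "weight M (\<lambda>\<omega>. 1 / (1 + g \<omega>))"
  unfolding weight_def
proof (intro conjI allI)
  show "(\<lambda>\<omega>. 1 / (1 + g \<omega>)) \<in> borel_measurable M" by measurable
  show "AE \<omega> in M. 0 < 1 / (1 + g \<omega>) \<and> 1 / (1 + g \<omega>) \<le> 1"
    using pos by (intro AE_I2) (simp add: add_pos_nonneg)
  fix n :: nat
  show "integrable M (\<lambda>\<omega>. (1 / (1 / (1 + g \<omega>))) ^ n)"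
  proof (cases "n = 0")
    case True then show ?thesis by simp
  next
    case False
    show ?thesis
    proof (rule Bochner_Integration.integrable_bound)
      show "integrable M (\<lambda>\<omega>. 2 ^ n * (1 + \<bar>g \<omega>\<bar> powr (real n)))" using False
        by (intro integrable_mult_right Bochner_Integration.integrable_add int) auto
      have "(1 / (1 / (1 + g \<omega>))) ^ n \<le> 2 ^ n * (1 + \<bar>g \<omega>\<bar> powr real n)" for \<omega>
      proof -
        have "(1 + g \<omega>) ^ n \<le> (2 * max 1 (g \<omega>)) ^ n" using pos[of \<omega>] by (intro power_mono) auto
        also have "\<dots> = 2 ^ n * (max 1 (g \<omega>)) ^ n" by (simp add: power_mult_distrib)
        also have "\<dots> \<le> 2 ^ n * (1 + \<bar>g \<omega>\<bar> powr real n)" using pos[of \<omega>] False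
          by (intro mult_left_mono) (auto simp: max_def powr_realpow')
        finally show ?thesis by simp
      qed
      then show "AE \<omega> in M. norm ((1 / (1 / (1 + g \<omega>))) ^ n) \<le> norm (2 ^ n * (1 + \<bar>g \<omega>\<bar> powr real n))"
        using pos by (intro AE_I2) (simp add: abs_of_nonneg)
    qed measurable
  qed
qed

end

text \<open>The choice q = R/k would give the bound at once. Only rational q are available, because
  almost sure inequalities hold jointly for countably many q; continuity in q bridges the
  gap.\<close>

lemma rational_quadratic_bound:
  fixes e R k :: real
  assumes k: "0 < k" and R: "0 < R" and q: "\<And>q. q \<in> \<rat> \<Longrightarrow> 0 < q \<Longrightarrow> 2 * k \<le> q * e + R / q"
  shows "k\<^sup>2 / R \<le> e"
proof -
  have rk: "R / k > 0" using k R by simp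
  have "2 * k \<le> (R / k) * e + R / (R / k)"
  proof (rule ccontr)
    assume "\<not> ?thesis"
    then have lt: "(R / k) * e + R / (R / k) < 2 * k" by simp
    have "((\<lambda>q. q * e + R / q) \<longlongrightarrow> (R / k) * e + R / (R / k)) (at (R/k))"
      using rk by (intro tendsto_intros) auto
    from order_tendstoD(2)[OF this lt]
    obtain b where b: "b > 0" "\<And>x. x \<noteq> R / k \<Longrightarrow> dist x (R/k) < b \<Longrightarrow> x * e + R / x < 2 * k"
      by (auto simp: eventually_at)
    obtain q where q': "q \<in> \<rat>" "R / k < q" "q < R / k + b" using Rats_dense_in_real[of "R/k" "R/k+b"] b(1) by auto
    then have "q * e + R / q < 2 * k" by (intro b(2)) (auto simp: dist_real_def)
    moreover have "2 * k \<le> q * e + R / q" using q' rk by (intro q) auto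
    ultimately show False by simp
  qed
  then have "k \<le> R / k * e" using k R by simp
  then show ?thesis using k R by (simp add: field_simps power2_eq_square)
qed

text \<open>A conditional Cauchy-Schwarz inequality: a weight cannot make an event of conditional
  probability at least \<open>k\<close> negligible, and the lower bound does not depend on the event.\<close>

lemma (in finite_measure_subalgebra) cond_weight_lower:
  assumes Z: "weight M Z" and k: "weight M k" and A[measurable]: "A \<in> sets M"
    and kA: "AE w in M. k w \<le> real_cond_exp M F (indicator A) w"
  shows "AE w in M. (k w)\<^sup>2 / real_cond_exp M F (\<lambda>w. 1 / Z w) w \<le> real_cond_exp M F (\<lambda>w. Z w * indicator A w) w"
proof -
  note [measurable] = weight_meas[OF Z]
  have iZ: "integrable M (\<lambda>w. 1 / Z w)" using weight_int[OF Z, of 1] by simp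
  have iA: "integrable M (indicator A :: _ \<Rightarrow> real)" by (simp add: emeasure_eq_measure)
  have iZA: "integrable M (\<lambda>w. Z w * indicator A w)"
  proof (rule integrable_const_bound[where B=1])
    show "AE w in M. norm (Z w * indicator A w) \<le> 1"
      using weight_AE[OF Z] by eventually_elim (simp add: indicator_def)
  qed measurable
  \<comment> \<open>On \<open>A\<close> this is 2 \<le> q Z + 1/(q Z), off \<open>A\<close> it is
    positivity. For fixed q both sides can be conditioned by linearity; optimising over q afterwards
    recovers the product inequality pointwise.\<close>
  have q: "AE w in M. q > 0 \<longrightarrow> 2 * real_cond_exp M F (indicator A) w \<le>
      q * real_cond_exp M F (\<lambda>w. Z w * indicator A w) w + real_cond_exp M F (\<lambda>w. 1 / Z w) w / q" for q :: real
  proof (cases "q > 0")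
    case True
    have "AE w in M. real_cond_exp M F (\<lambda>w. 2 * indicator A w) w \<le>
        real_cond_exp M F (\<lambda>w. q * (Z w * indicator A w) + 1 / Z w / q) w"
    proof (rule real_cond_exp_mono)
      show "AE w in M. 2 * indicator A w \<le> q * (Z w * indicator A w) + 1 / Z w / q"
        using weight_AE[OF Z]
      proof eventually_elim
        case (elim w)
        define y where "y = q * Z w"
        have y: "y > 0" using elim True by (simp add: y_def)
        have "0 \<le> (y - 1)\<^sup>2 / y" using y by simp
        then have "2 \<le> y + 1 / y" using y by (simp add: power2_eq_square field_simps)
        then show ?case using y True elim by (auto simp: indicator_def y_def field_simps)
      qed
      show "integrable M (\<lambda>w. q * (Z w * indicator A w) + 1 / Z w / q)"
        by (intro Bochner_Integration.integrable_add integrable_mult_right integrable_divide iZ iZA)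
    qed (use iA in auto)
    moreover have "AE w in M. real_cond_exp M F (\<lambda>w. 2 * indicator A w) w = 2 * real_cond_exp M F (indicator A) w"
      by (rule real_cond_exp_cmult[OF iA])
    moreover have "AE w in M. real_cond_exp M F (\<lambda>w. q * (Z w * indicator A w) + 1 / Z w / q) w
        = real_cond_exp M F (\<lambda>w. q * (Z w * indicator A w)) w + real_cond_exp M F (\<lambda>w. 1 / Z w / q) w"
      by (intro real_cond_exp_add integrable_mult_right integrable_divide iZ iZA)
    moreover have "AE w in M. real_cond_exp M F (\<lambda>w. q * (Z w * indicator A w)) w = q * real_cond_exp M F (\<lambda>w. Z w * indicator A w) w"
      by (rule real_cond_exp_cmult[OF iZA])
    moreover have "AE w in M. real_cond_exp M F (\<lambda>w. 1 / Z w / q) w = real_cond_exp M F (\<lambda>w. 1 / Z w) w / q"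
      by (rule real_cond_exp_cdiv[OF iZ])
    ultimately show ?thesis by eventually_elim simp
  qed simp
  have q': "AE w in M. \<forall>q\<in>\<rat>. q > 0 \<longrightarrow> 2 * real_cond_exp M F (indicator A) w \<le>
      q * real_cond_exp M F (\<lambda>w. Z w * indicator A w) w + real_cond_exp M F (\<lambda>w. 1 / Z w) w / q"
    by (intro AE_ball_countable' countable_rat q)
  have "AE w in M. 1 / Z w \<ge> 1" using weight_AE[OF Z] by eventually_elim simp
  then have R: "AE w in M. real_cond_exp M F (\<lambda>w. 1 / Z w) w \<ge> 1"
    by (rule real_cond_exp_ge_c[OF iZ])
  show ?thesis using q' R kA weight_AE[OF k]
  proof eventually_elim
    case (elim w)
    show ?case by (rule rational_quadratic_bound) (use elim in force)+
  qed
qed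

text \<open>The inverse is E[1/Z | F] / k^2, and conditional Jensen for x^n bounds the moments of
  the numerator. Weights are thus stable under the backward step.\<close>

lemma (in finite_measure_subalgebra) weight_cond:
  assumes P: "prob_space M" and Z: "weight M Z" and k: "weight M k"
  shows "weight M (\<lambda>w. (k w)\<^sup>2 / real_cond_exp M F (\<lambda>w. 1 / Z w) w)"
proof -
  let ?R = "real_cond_exp M F (\<lambda>w. 1 / Z w)"
  note [measurable] = weight_meas[OF Z] weight_meas[OF k]
  have iZ: "integrable M (\<lambda>w. 1 / Z w)" using weight_int[OF Z, of 1] by simp
  have "AE w in M. 1 / Z w \<ge> 1" using weight_AE[OF Z] by eventually_elim simp
  then have R: "AE w in M. ?R w \<ge> 1" by (rule real_cond_exp_ge_c[OF iZ])
  have Rm: "integrable M (\<lambda>w. (?R w) ^ n)" for n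
  proof (rule integrable_convex_cond_exp[OF iZ, where I="{0<..}" and q="\<lambda>x. x ^ n"])
    show "AE x in M. 1 / Z x \<in> {0<..}" using weight_AE[OF Z] by eventually_elim simp
    show "convex_on {0<..} (\<lambda>x::real. x ^ n)"
    proof (cases "even n")
      case True show ?thesis by (rule convex_on_subset[OF convex_power_even[OF True]]) auto
    next
      case False show ?thesis by (rule convex_on_subset[OF convex_power_odd[OF False]]) auto
    qed
    show "integrable M (\<lambda>x. (1 / Z x) ^ n)" by (rule weight_int[OF Z])
  qed (auto simp: emeasure_eq_measure)
  have "weight M (\<lambda>w. 1 / ?R w)"
    unfolding weight_def using R Rm by (auto elim!: eventually_mono)
  from prob_space.weight_mult[OF P prob_space.weight_mult[OF P k k] this]
  show ?thesis by (simp add: power2_eq_square)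
qed

section \<open>Backward and forward induction in a single market\<close>

locale losing_market = filtered_prob_space M Fl T for M :: "'a measure" and Fl T +
  fixes S :: "nat \<Rightarrow> 'a \<Rightarrow> 'd::euclidean_space" and \<beta> k :: "nat \<Rightarrow> 'a \<Rightarrow> real" and w0 :: real
  assumes ad: "adapted Fl T S"
    and \<beta>_meas: "t \<in> {1..T} \<Longrightarrow> \<beta> t \<in> borel_measurable (Fl (t - 1))"
    and \<beta>_weight: "t \<in> {1..T} \<Longrightarrow> weight M (\<beta> t)"
    and k_meas: "t \<in> {1..T} \<Longrightarrow> k t \<in> borel_measurable (Fl (t - 1))"
    and k_weight: "t \<in> {1..T} \<Longrightarrow> weight M (k t)"
    and incr_weight: "t \<in> {1..T} \<Longrightarrow> weight M (\<lambda>x. 1 / (1 + norm (incr S t x)))"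
begin

definition loss :: "(nat \<Rightarrow> 'a \<Rightarrow> 'd) \<Rightarrow> nat \<Rightarrow> 'a set" where
  "loss \<phi> t = {x\<in>space M. \<phi> t x \<bullet> incr S t x \<le> - \<beta> t x * norm (\<phi> t x)}"

text \<open>The losing condition is imposed on the strategy itself, which separates the estimates
  from the geometry of \<open>Dset\<close>; projected strategies satisfy it by
  \<open>losing_market_exists\<close>.\<close>

definition good :: "(nat \<Rightarrow> 'a \<Rightarrow> 'd) \<Rightarrow> bool" where
  "good \<phi> \<longleftrightarrow> \<phi> \<in> strategies Fl T \<and>
     (\<forall>t\<in>{1..T}. AE x in M. k t x \<le> real_cond_exp M (Fl (t - 1)) (indicator (loss \<phi> t)) x)"

abbreviation W :: "(nat \<Rightarrow> 'a \<Rightarrow> 'd) \<Rightarrow> nat \<Rightarrow> 'a \<Rightarrow> real" where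
  "W \<phi> t \<equiv> wealth S t w0 \<phi>"

text \<open>Indexed by the number of steps back from T, which makes the backward recursion
  primitive. Each step is the lower bound supplied by \<open>cond_weight_lower\<close>.\<close>

primrec zz :: "nat \<Rightarrow> 'a \<Rightarrow> real" where
  "zz 0 = (\<lambda>_. 1)"
| "zz (Suc j) = (\<lambda>x. (k (T - j) x)\<^sup>2 / real_cond_exp M (Fl (T - j - 1)) (\<lambda>x. 1 / zz j x) x)"

definition Z :: "nat \<Rightarrow> 'a \<Rightarrow> real" where "Z t = zz (T - t)"

lemma Z_last: "Z T = (\<lambda>_. 1)"
  by (simp add: Z_def)

lemma Z_step: "t \<in> {1..T} \<Longrightarrow> Z (t - 1) = (\<lambda>x. (k t x)\<^sup>2 / real_cond_exp M (Fl (t - 1)) (\<lambda>x. 1 / Z t x) x)"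
  using Suc_diff_le[of t T] by (auto simp: Z_def)

lemma Z_weight: "t \<le> T \<Longrightarrow> weight M (Z t)"
proof (induction "T - t" arbitrary: t)
  case 0 then have "t = T" by simp
  then show ?case by (simp add: Z_last weight_one)
next
  case (Suc n)
  have t: "Suc t \<in> {1..T}" using Suc by auto
  have "weight M (Z (Suc t))" using Suc by (intro Suc(1)) auto
  from finite_measure_subalgebra.weight_cond[OF fmsub prob_space_axioms this k_weight[OF t], of t]
  show ?case using Suc(3) Z_step[OF t] by simp
qed

lemma strat_meas: "\<phi> \<in> strategies Fl T \<Longrightarrow> t \<in> {1..T} \<Longrightarrow> \<phi> t \<in> borel_measurable (Fl (t - 1))"
  by (simp add: strategies_def)

lemma W_meas: "good \<phi> \<Longrightarrow> t \<le> T \<Longrightarrow> W \<phi> t \<in> borel_measurable (Fl t)"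
  by (rule wealth_meas[OF ad]) (auto simp: good_def)

lemma W_meas_M: "good \<phi> \<Longrightarrow> t \<le> T \<Longrightarrow> W \<phi> t \<in> borel_measurable M"
  by (rule meas_M[OF _ W_meas])

text \<open>Negative part that the wealth at t would have if the position lost at the guaranteed
  rate \<open>\<beta> t\<close>. Unlike the actual negative part it is known at t - 1 and can be
  pulled out of the conditional expectation.\<close>

definition Y :: "(nat \<Rightarrow> 'a \<Rightarrow> 'd) \<Rightarrow> nat \<Rightarrow> 'a \<Rightarrow> real" where
  "Y \<phi> t x = max 0 (\<beta> t x * norm (\<phi> t x) - W \<phi> (t - 1) x)"

lemma Y_meas:
  assumes g: "good \<phi>" and t: "t \<in> {1..T}"
  shows "Y \<phi> t \<in> borel_measurable (Fl (t - 1))"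
proof -
  have [measurable]: "W \<phi> (t - 1) \<in> borel_measurable (Fl (t - 1))" "\<phi> t \<in> borel_measurable (Fl (t - 1))"
     "\<beta> t \<in> borel_measurable (Fl (t - 1))"
    using W_meas[OF g, of "t - 1"] strat_meas[of \<phi> t] \<beta>_meas[OF t] g t by (auto simp: good_def)
  show ?thesis unfolding Y_def[abs_def] by measurable
qed

text \<open>On the loss event \<open>Y\<close> is at most the negative part of the wealth at t.
  Conditioning then replaces \<open>Z t\<close> restricted to that event by a quantity that is at
  least \<open>Z (t - 1)\<close>.\<close>

lemma loss_step:
  assumes g: "good \<phi>" and t: "t \<in> {1..T}"
    and int: "integrable M (\<lambda>x. Z t x * max 0 (- W \<phi> t x))"
  shows "integrable M (\<lambda>x. Z (t - 1) x * Y \<phi> t x)" (is ?th1)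
    and "(\<integral>x. Z (t - 1) x * Y \<phi> t x \<partial>M) \<le> (\<integral>x. Z t x * max 0 (- W \<phi> t x) \<partial>M)" (is ?th2)
proof -
  let ?F = "Fl (t - 1)" and ?A = "loss \<phi> t"
  have tT: "t \<le> T" "t - 1 \<le> T" using t by auto
  interpret fs: finite_measure_subalgebra M ?F by (rule fmsub[OF tT(2)])
  note Zw = Z_weight[OF tT(1)] and Zw' = Z_weight[OF tT(2)]
  have YF[measurable]: "Y \<phi> t \<in> borel_measurable ?F" by (rule Y_meas[OF g t])
  have [measurable]: "Y \<phi> t \<in> borel_measurable M" by (rule meas_M[OF tT(2) YF])
  have [measurable]: "Z t \<in> borel_measurable M" "Z (t - 1) \<in> borel_measurable M"
    using weight_meas[OF Zw] weight_meas[OF Zw'] by auto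
  have [measurable]: "\<phi> t \<in> borel_measurable M" "\<beta> t \<in> borel_measurable M" "incr S t \<in> borel_measurable M"
    using meas_M[OF tT(2) strat_meas[of \<phi> t]] meas_M[OF tT(2) \<beta>_meas[OF t]] meas_M[OF tT(1) incr_meas[OF ad t]] g t
    by (auto simp: good_def)
  have A[measurable]: "?A \<in> sets M" unfolding loss_def by measurable
  let ?e = "real_cond_exp M ?F (\<lambda>x. Z t x * indicator ?A x)"
  have kA: "AE x in M. k t x \<le> real_cond_exp M ?F (indicator ?A) x" using g t by (auto simp: good_def)
  have e: "AE x in M. Z (t - 1) x \<le> ?e x"
    using fs.cond_weight_lower[OF Zw k_weight[OF t] A kA] unfolding Z_step[OF t] .
  have Y0: "0 \<le> Y \<phi> t x" for x by (simp add: Y_def)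
  have le: "AE x in M. Y \<phi> t x * (Z t x * indicator ?A x) \<le> Z t x * max 0 (- W \<phi> t x)"
    using weight_AE[OF Zw]
  proof eventually_elim
    case (elim x)
    show ?case
    proof (cases "x \<in> ?A")
      case True
      then have "W \<phi> t x \<le> W \<phi> (t - 1) x - \<beta> t x * norm (\<phi> t x)"
        using wealth_step[OF t, of S w0 \<phi> x] by (simp add: loss_def)
      then have "Y \<phi> t x \<le> max 0 (- W \<phi> t x)" by (auto simp: Y_def)
      then show ?thesis using True elim by (simp add: mult.commute mult_left_mono)
    qed (use elim in auto)
  qed
  have nn: "AE x in M. 0 \<le> Y \<phi> t x * (Z t x * indicator ?A x)"
    using weight_AE[OF Zw] by eventually_elim (simp add: Y0)
  have i1: "integrable M (\<lambda>x. Y \<phi> t x * (Z t x * indicator ?A x))"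
  proof (rule Bochner_Integration.integrable_bound[OF int])
    show "AE x in M. norm (Y \<phi> t x * (Z t x * indicator ?A x)) \<le> norm (Z t x * max 0 (- W \<phi> t x))"
      using le nn by eventually_elim simp
  qed measurable
  note ce = fs.real_cond_exp_intg[OF i1 YF]
  have ce1: "integrable M (\<lambda>x. Y \<phi> t x * ?e x)" by (rule ce) measurable
  have ce2: "(\<integral>x. Y \<phi> t x * ?e x \<partial>M) = (\<integral>x. Y \<phi> t x * (Z t x * indicator ?A x) \<partial>M)" by (rule ce) measurable
  have le2: "AE x in M. Z (t - 1) x * Y \<phi> t x \<le> Y \<phi> t x * ?e x"
    using e by eventually_elim (simp add: Y0 mult.commute mult_left_mono)
  have nn2: "AE x in M. 0 \<le> Z (t - 1) x * Y \<phi> t x"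
    using weight_AE[OF Zw'] by eventually_elim (simp add: Y0)
  show ?th1
  proof (rule Bochner_Integration.integrable_bound[OF ce1])
    show "AE x in M. norm (Z (t - 1) x * Y \<phi> t x) \<le> norm (Y \<phi> t x * ?e x)"
      using le2 nn2 by eventually_elim simp
  qed measurable
  then have "(\<integral>x. Z (t - 1) x * Y \<phi> t x \<partial>M) \<le> (\<integral>x. Y \<phi> t x * ?e x \<partial>M)"
    by (rule integral_mono_AE[OF _ ce1 le2])
  also have "\<dots> \<le> (\<integral>x. Z t x * max 0 (- W \<phi> t x) \<partial>M)"
    unfolding ce2 by (rule integral_mono_AE[OF i1 int le])
  finally show ?th2 .
qed

text \<open>Backward induction: \<open>Y\<close> at the next date dominates the present negative
  part, since a loss can only lower the wealth.\<close>

lemma neg_part_bound: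
  assumes g: "good \<phi>" and int: "integrable M (\<lambda>x. max 0 (- W \<phi> T x))" and t: "t \<le> T"
  shows "integrable M (\<lambda>x. Z t x * max 0 (- W \<phi> t x)) \<and>
     (\<integral>x. Z t x * max 0 (- W \<phi> t x) \<partial>M) \<le> (\<integral>x. max 0 (- W \<phi> T x) \<partial>M)"
  using t
proof (induction "T - t" arbitrary: t)
  case 0 then have "t = T" by simp
  then show ?case using int by (simp add: Z_last)
next
  case (Suc n)
  have t: "Suc t \<in> {1..T}" using Suc by auto
  have IH: "integrable M (\<lambda>x. Z (Suc t) x * max 0 (- W \<phi> (Suc t) x))"
     "(\<integral>x. Z (Suc t) x * max 0 (- W \<phi> (Suc t) x) \<partial>M) \<le> (\<integral>x. max 0 (- W \<phi> T x) \<partial>M)"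
    using Suc(1)[of "Suc t"] Suc(2) t by auto
  note st = loss_step[OF g t IH(1), simplified]
  have [measurable]: "Z t \<in> borel_measurable M" "W \<phi> t \<in> borel_measurable M"
    using weight_meas[OF Z_weight[OF Suc(3)]] W_meas_M[OF g Suc(3)] by auto
  have le: "AE x in M. Z t x * max 0 (- W \<phi> t x) \<le> Z t x * Y \<phi> (Suc t) x"
    using weight_AE[OF Z_weight[OF Suc(3)]] weight_AE[OF \<beta>_weight[OF t]]
  proof eventually_elim
    case (elim x)
    have "0 \<le> \<beta> (Suc t) x * norm (\<phi> (Suc t) x)" using elim by simp
    then have "max 0 (- W \<phi> t x) \<le> Y \<phi> (Suc t) x" by (auto simp: Y_def)
    then show ?case using elim by (intro mult_left_mono) auto
  qed
  have nn: "AE x in M. 0 \<le> Z t x * max 0 (- W \<phi> t x)"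
    using weight_AE[OF Z_weight[OF Suc(3)]] by eventually_elim simp
  have i: "integrable M (\<lambda>x. Z t x * max 0 (- W \<phi> t x))"
  proof (rule Bochner_Integration.integrable_bound[OF st(1)])
    show "AE x in M. norm (Z t x * max 0 (- W \<phi> t x)) \<le> norm (Z t x * Y \<phi> (Suc t) x)"
      using le nn by eventually_elim simp
  qed measurable
  have "(\<integral>x. Z t x * max 0 (- W \<phi> t x) \<partial>M) \<le> (\<integral>x. Z t x * Y \<phi> (Suc t) x \<partial>M)"
    by (rule integral_mono_AE[OF i st(1) le])
  with i st(2) IH(2) show ?case by linarith
qed

lemma Y_bound:
  assumes g: "good \<phi>" and int: "integrable M (\<lambda>x. max 0 (- W \<phi> T x))" and t: "t \<in> {1..T}"
  shows "integrable M (\<lambda>x. Z (t - 1) x * Y \<phi> t x)"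
     "(\<integral>x. Z (t - 1) x * Y \<phi> t x \<partial>M) \<le> (\<integral>x. max 0 (- W \<phi> T x) \<partial>M)"
proof -
  have n: "integrable M (\<lambda>x. Z t x * max 0 (- W \<phi> t x))"
    "(\<integral>x. Z t x * max 0 (- W \<phi> t x) \<partial>M) \<le> (\<integral>x. max 0 (- W \<phi> T x) \<partial>M)"
    using neg_part_bound[OF g int, of t] t by auto
  show "integrable M (\<lambda>x. Z (t - 1) x * Y \<phi> t x)" by (rule loss_step[OF g t n(1)])
  show "(\<integral>x. Z (t - 1) x * Y \<phi> t x \<partial>M) \<le> (\<integral>x. max 0 (- W \<phi> T x) \<partial>M)"
    using loss_step(2)[OF g t n(1)] n(2) by linarith
qed

lemma norm_strategy_le:
  assumes "0 < \<beta> t x"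
  shows "\<beta> t x * norm (\<phi> t x) \<le> Y \<phi> t x + max 0 (W \<phi> (t - 1) x)"
  by (auto simp: Y_def)

text \<open>\<open>V\<close> and \<open>B\<close> are fixed before the strategy. The scale is 1 +
  E[W_T^-] because that expectation is itself bounded only later, through the utility.\<close>

definition dominated :: "('a \<Rightarrow> real) \<Rightarrow> ((nat \<Rightarrow> 'a \<Rightarrow> 'd) \<Rightarrow> 'a \<Rightarrow> real) \<Rightarrow> real \<Rightarrow> bool" where
  "dominated V f B \<longleftrightarrow> (\<forall>\<phi>. good \<phi> \<longrightarrow> integrable M (\<lambda>x. max 0 (- W \<phi> T x)) \<longrightarrow>
     integrable M (\<lambda>x. V x * f \<phi> x) \<and> (\<integral>x. V x * f \<phi> x \<partial>M) \<le> B * (1 + (\<integral>x. max 0 (- W \<phi> T x) \<partial>M)))"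

text \<open>Common step of all weighted bounds: a pointwise estimate by an already dominated
  quantity plus the weighted \<open>Y\<close>. The additional 1 in the constant is the contribution
  of \<open>Y_bound\<close>.\<close>

lemma dominated_by:
  assumes V: "weight M V" "dominated V f B" and t: "t \<in> {1..T}" and c: "0 \<le> c"
    and V': "V' \<in> borel_measurable M"
    and h: "\<And>\<phi>. good \<phi> \<Longrightarrow> h \<phi> \<in> borel_measurable M"
    and le: "\<And>\<phi>. good \<phi> \<Longrightarrow> AE x in M. 0 \<le> V' x * h \<phi> x \<and> V' x * h \<phi> x \<le> c * (V x * f \<phi> x) + Z (t - 1) x * Y \<phi> t x"
  shows "dominated V' h (c * B + 1)"
  unfolding dominated_def
proof (intro allI impI)
  fix \<phi> assume g: "good \<phi>" and int: "integrable M (\<lambda>x. max 0 (- W \<phi> T x))"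
  let ?x = "\<integral>x. max 0 (- W \<phi> T x) \<partial>M"
  note [measurable] = V' h[OF g]
  have iV: "integrable M (\<lambda>x. V x * f \<phi> x)" and bV: "(\<integral>x. V x * f \<phi> x \<partial>M) \<le> B * (1 + ?x)"
    using V(2) g int by (auto simp: dominated_def)
  note yb = Y_bound[OF g int t]
  have iR: "integrable M (\<lambda>x. c * (V x * f \<phi> x) + Z (t - 1) x * Y \<phi> t x)"
    by (intro Bochner_Integration.integrable_add integrable_mult_right iV yb(1))
  have i: "integrable M (\<lambda>x. V' x * h \<phi> x)"
  proof (rule Bochner_Integration.integrable_bound[OF iR])
    show "AE x in M. norm (V' x * h \<phi> x) \<le> norm (c * (V x * f \<phi> x) + Z (t - 1) x * Y \<phi> t x)"
      using le[OF g] by eventually_elim simp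
  qed measurable
  have "(\<integral>x. V' x * h \<phi> x \<partial>M) \<le> (\<integral>x. c * (V x * f \<phi> x) + Z (t - 1) x * Y \<phi> t x \<partial>M)"
    by (rule integral_mono_AE[OF i iR]) (use le[OF g] in \<open>eventually_elim, simp\<close>)
  also have "\<dots> = c * (\<integral>x. V x * f \<phi> x \<partial>M) + (\<integral>x. Z (t - 1) x * Y \<phi> t x \<partial>M)"
    using iV yb(1) by simp
  also have "\<dots> \<le> c * (B * (1 + ?x)) + ?x" using mult_left_mono[OF bV c] yb(2) by linarith
  also have "\<dots> \<le> (c * B + 1) * (1 + ?x)" by (simp add: algebra_simps)
  finally show "integrable M (\<lambda>x. V' x * h \<phi> x) \<and> (\<integral>x. V' x * h \<phi> x \<partial>M) \<le> (c * B + 1) * (1 + ?x)"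
    using i by simp
qed

text \<open>Forward induction: the gain at t is at most |\<phi>| |\<Delta>S|, and
  \<open>\<beta> t\<close> times |\<phi>| is at most \<open>Y\<close> plus the previous positive
  part.\<close>

lemma pos_part_bound:
  "t \<le> T \<Longrightarrow> \<exists>V B. weight M V \<and> dominated V (\<lambda>\<phi> x. max 0 (W \<phi> t x)) B"
proof (induction t)
  case 0
  have "dominated (\<lambda>_. 1) (\<lambda>\<phi> x. max 0 (W \<phi> 0 x)) (max 0 w0)"
    unfolding dominated_def
  proof (intro allI impI conjI)
    fix \<phi>
    have "0 \<le> (\<integral>x. max 0 (- W \<phi> T x) \<partial>M)" by (rule Bochner_Integration.integral_nonneg) simp
    then have "max 0 w0 * 1 \<le> max 0 w0 * (1 + (\<integral>x. max 0 (- W \<phi> T x) \<partial>M))" by (intro mult_left_mono) auto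
    then show "(\<integral>x. 1 * max 0 (W \<phi> 0 x) \<partial>M) \<le> max 0 w0 * (1 + (\<integral>x. max 0 (- W \<phi> T x) \<partial>M))"
      by (simp add: wealth_def prob_space)
  qed (simp add: wealth_def)
  then show ?case using weight_one by blast
next
  case (Suc s)
  define t where "t = Suc s"
  have t: "t \<in> {1..T}" and t1: "t - 1 = s" using Suc by (auto simp: t_def)
  obtain V B where V: "weight M V" "dominated V (\<lambda>\<phi> x. max 0 (W \<phi> s x)) B" using Suc by auto
  note Zw = Z_weight[of s]
  have sT: "s \<le> T" using Suc by simp
  \<comment> \<open>One factor per source: \<open>V\<close> for the previous wealth,
    \<open>Z s\<close> for \<open>Y\<close>, \<open>\<beta> t\<close> to turn |\<phi>| into a
    controlled quantity, and the last factor to absorb the size of the increment.\<close>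
  let ?V = "\<lambda>x. V x * Z s x * (\<beta> t x * (1 / (1 + norm (incr S t x))))"
  have w: "weight M ?V" by (intro weight_mult V Z_weight sT \<beta>_weight incr_weight t)
  have "dominated ?V (\<lambda>\<phi> x. max 0 (W \<phi> t x)) (2 * B + 1)"
  proof (rule dominated_by[OF V t])
    show "?V \<in> borel_measurable M" by (rule weight_meas[OF w])
    fix \<phi> assume g: "good \<phi>"
    show "(\<lambda>x. max 0 (W \<phi> t x)) \<in> borel_measurable M" using W_meas_M[OF g, of t] t by simp
    show "AE x in M. 0 \<le> ?V x * max 0 (W \<phi> t x) \<and>
        ?V x * max 0 (W \<phi> t x) \<le> 2 * (V x * max 0 (W \<phi> s x)) + Z (t - 1) x * Y \<phi> t x"
      using weight_AE[OF w] weight_AE[OF V(1)] weight_AE[OF Zw[OF sT]] weight_AE[OF \<beta>_weight[OF t]]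
    proof eventually_elim
      case (elim x)
      let ?n = "norm (incr S t x)" and ?P = "max 0 (W \<phi> s x)" and ?y = "Y \<phi> t x" and ?b = "\<beta> t x"
      have y0: "0 \<le> ?y" by (simp add: Y_def)
      have b\<phi>: "?b * norm (\<phi> t x) \<le> ?y + ?P" using norm_strategy_le[of t x \<phi>] elim t1 by simp
      have "W \<phi> t x \<le> W \<phi> s x + norm (\<phi> t x) * ?n"
        using wealth_step[OF t, of S w0 \<phi> x] norm_cauchy_schwarz[of "\<phi> t x" "incr S t x"] t1 by simp
      also have "\<dots> \<le> ?P + norm (\<phi> t x) * ?n" by simp
      finally have "max 0 (W \<phi> t x) \<le> ?P + norm (\<phi> t x) * ?n" by simp
      then have "?b * max 0 (W \<phi> t x) \<le> ?b * (?P + norm (\<phi> t x) * ?n)" using elim by (intro mult_left_mono) auto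
      also have "\<dots> = ?b * ?P + (?b * norm (\<phi> t x)) * ?n" by (simp add: algebra_simps)
      also have "\<dots> \<le> 1 * ?P + (?y + ?P) * ?n" using elim b\<phi> by (intro add_mono mult_right_mono) auto
      also have "\<dots> \<le> (?y + 2 * ?P) * (1 + ?n)" using y0 by (simp add: algebra_simps)
      finally have "?b * (1 / (1 + ?n)) * max 0 (W \<phi> t x) \<le> ?y + 2 * ?P"
        by (simp add: divide_le_eq add_pos_nonneg)
      then have "V x * Z s x * (?b * (1 / (1 + ?n)) * max 0 (W \<phi> t x)) \<le> V x * Z s x * (?y + 2 * ?P)"
        using elim by (intro mult_left_mono) auto
      also have "\<dots> = V x * (Z s x * ?y) + Z s x * (2 * (V x * ?P))" by (simp add: algebra_simps)
      also have "\<dots> \<le> 1 * (Z s x * ?y) + 1 * (2 * (V x * ?P))"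
        using elim y0 by (intro add_mono mult_right_mono) auto
      finally show ?case using elim t1 by (simp add: mult.assoc)
    qed
  qed simp
  then show ?case using w unfolding t_def by blast
qed

text \<open>Holds because \<open>\<beta> t\<close> times |\<phi>| is at most \<open>Y\<close> plus
  the positive part of the wealth before t. These are the bounds from which convergent strategies
  are later selected.\<close>

lemma strategy_bound:
  assumes t: "t \<in> {1..T}"
  shows "\<exists>V B. weight M V \<and> dominated V (\<lambda>\<phi> x. norm (\<phi> t x)) B"
proof -
  have sT: "t - 1 \<le> T" using t by auto
  obtain V B where V: "weight M V" "dominated V (\<lambda>\<phi> x. max 0 (W \<phi> (t - 1) x)) B" using pos_part_bound[OF sT] by auto
  note Zw = Z_weight[OF sT]
  let ?V = "\<lambda>x. V x * Z (t - 1) x * \<beta> t x"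
  have w: "weight M ?V" by (intro weight_mult V Zw \<beta>_weight t)
  have "dominated ?V (\<lambda>\<phi> x. norm (\<phi> t x)) (1 * B + 1)"
  proof (rule dominated_by[OF V t])
    show "?V \<in> borel_measurable M" by (rule weight_meas[OF w])
    fix \<phi> assume g: "good \<phi>"
    have "\<phi> t \<in> borel_measurable M" using meas_M[OF sT strat_meas[of \<phi> t]] g t by (auto simp: good_def)
    then show "(\<lambda>x. norm (\<phi> t x)) \<in> borel_measurable M" by measurable
    show "AE x in M. 0 \<le> ?V x * norm (\<phi> t x) \<and>
        ?V x * norm (\<phi> t x) \<le> 1 * (V x * max 0 (W \<phi> (t - 1) x)) + Z (t - 1) x * Y \<phi> t x"
      using weight_AE[OF w] weight_AE[OF V(1)] weight_AE[OF Zw] weight_AE[OF \<beta>_weight[OF t]]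
    proof eventually_elim
      case (elim x)
      let ?P = "max 0 (W \<phi> (t - 1) x)" and ?y = "Y \<phi> t x" and ?b = "\<beta> t x"
      have y0: "0 \<le> ?y" by (simp add: Y_def)
      have b\<phi>: "?b * norm (\<phi> t x) \<le> ?y + ?P" using norm_strategy_le[of t x \<phi>] elim by simp
      then have "V x * Z (t - 1) x * (?b * norm (\<phi> t x)) \<le> V x * Z (t - 1) x * (?y + ?P)"
        using elim by (intro mult_left_mono) auto
      also have "\<dots> = V x * (Z (t - 1) x * ?y) + Z (t - 1) x * (V x * ?P)" by (simp add: algebra_simps)
      also have "\<dots> \<le> 1 * (Z (t - 1) x * ?y) + 1 * (V x * ?P)"
        using elim y0 by (intro add_mono mult_right_mono) auto
      finally show ?case using elim by (simp add: mult.assoc)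
    qed
  qed simp
  then show ?thesis using w by blast
qed

end

section \<open>Utility of terminal wealth\<close>

text \<open>The cases split where z y^(1-\<alpha>) = 1: above that threshold y^\<alpha> is at most z
  y, below it at most z^(-\<alpha>/(1-\<alpha>)). The exponent is rounded up to an integer to match
  the moments in \<open>weight\<close>.\<close>

lemma power_le_linear_plus_weight:
  fixes y z \<alpha> :: real
  assumes y: "0 \<le> y" and z: "0 < z" "z \<le> 1" and \<alpha>: "0 < \<alpha>" "\<alpha> < 1" and N: "\<alpha> / (1 - \<alpha>) \<le> real N"
  shows "y powr \<alpha> \<le> z * y + (1 / z) ^ N"
proof (cases "y \<le> (1 / z) powr (1 / (1 - \<alpha>))")
  case True
  have "y powr \<alpha> \<le> ((1 / z) powr (1 / (1 - \<alpha>))) powr \<alpha>" using True y \<alpha> by (intro powr_mono2) auto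
  also have "\<dots> = (1 / z) powr (\<alpha> / (1 - \<alpha>))" by (simp add: powr_powr)
  also have "\<dots> \<le> (1 / z) powr real N" using z N by (intro powr_mono) auto
  also have "\<dots> = (1 / z) ^ N" using z by (simp add: powr_realpow)
  finally show ?thesis using y z by (simp add: add_increasing)
next
  case False
  have a: "0 < (1 / z) powr (1 / (1 - \<alpha>))" using z by simp
  then have y0: "0 < y" using False by linarith
  have "1 / z = ((1 / z) powr (1 / (1 - \<alpha>))) powr (1 - \<alpha>)" using z \<alpha> by (simp add: powr_powr)
  also have "\<dots> \<le> y powr (1 - \<alpha>)" using False \<alpha> by (intro powr_mono2) auto
  finally have "1 \<le> z * y powr (1 - \<alpha>)" using z by (simp add: divide_le_eq mult.commute)
  then have "1 * y powr \<alpha> \<le> (z * y powr (1 - \<alpha>)) * y powr \<alpha>" by (intro mult_right_mono) auto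
  also have "\<dots> = z * y" using y0 by (simp add: mult.assoc powr_add[symmetric])
  finally show ?thesis using z by (simp add: add_increasing2)
qed

text \<open>Linear growth at \<open>-\<infinity>\<close> and sublinear growth at \<open>+\<infinity>\<close>, the latter phrased relative to a weight \<open>V\<close>.\<close>

definition weighted_growth :: "(real \<Rightarrow> real) \<Rightarrow> real \<Rightarrow> nat \<Rightarrow> bool" where
  "weighted_growth U \<kappa> N \<longleftrightarrow> (\<forall>\<epsilon>>0. \<exists>D\<ge>0. \<forall>V x. 0 < V \<longrightarrow> V \<le> 1 \<longrightarrow>
     U x \<le> \<epsilon> * (V * max 0 x) + D * (1 / V) ^ N - \<kappa> * max 0 (- x))"

lemma utility_weighted_growth:
  assumes mono: "mono U" and conc: "concave_on UNIV U" and nc: "U a \<noteq> U b"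
    and C: "C > 0" and \<alpha>: "0 \<le> \<alpha>" "\<alpha> < 1" and gr: "\<And>x. x \<ge> 0 \<Longrightarrow> U x \<le> C * (rpow x \<alpha> + 1)"
  shows "\<exists>\<kappa>>0. \<exists>N. weighted_growth U \<kappa> N"
proof -
  define a' b' where "a' = min a b" and "b' = max a b"
  have ab: "a' < b'" "U a' < U b'"
    using nc monoD[OF mono, of a b] monoD[OF mono, of b a] by (auto simp: a'_def b'_def min_def max_def less_le split: if_splits)
  define \<kappa> where "\<kappa> = (U b' - U a') / (b' - a')"
  have \<kappa>: "\<kappa> > 0" using ab by (simp add: \<kappa>_def)
  \<comment> \<open>A concave function lies below the extension of a chord beyond its endpoints, and
    nonconstancy supplies a chord of positive slope \<open>\<kappa>\<close>.\<close>
  have neg: "U x \<le> U a' + \<kappa> * (x - a')" if x: "x < a'" for x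
  proof -
    define u where "u = (b' - a') / (b' - x)"
    have bx: "b' - x > 0" using x ab by simp
    have u: "0 \<le> u" "u \<le> 1" using x ab bx by (auto simp: u_def divide_le_eq)
    have "u * x + (1 - u) * b' = b' - u * (b' - x)" by (simp add: algebra_simps)
    also have "\<dots> = a'" using bx by (simp add: u_def)
    finally have eq: "u * x + (1 - u) * b' = a'" .
    have "u * U x + (1 - u) * U b' \<le> U (u * x + (1 - u) * b')"
      using conc u concave_onD[OF conc, of "1 - u" x b'] by simp
    then have "u * U x \<le> U a' - (1 - u) * U b'" unfolding eq by simp
    then have "u * U x \<le> u * U a' - (1 - u) * (U b' - U a')" by (simp add: algebra_simps)
    moreover have "(1 - u) * (U b' - U a') = (u * \<kappa>) * (a' - x)"
    proof -
      have "1 - u = (a' - x) / (b' - x)" using bx by (simp add: u_def diff_divide_eq_iff divide_diff_eq_iff)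
      moreover have "u * \<kappa> = (U b' - U a') / (b' - x)" using ab by (simp add: u_def \<kappa>_def)
      ultimately show ?thesis by simp
    qed
    ultimately have "u * U x \<le> u * (U a' + \<kappa> * (x - a'))" by (simp add: algebra_simps)
    moreover have "u > 0" using bx ab by (simp add: u_def)
    ultimately show ?thesis by simp
  qed
  \<comment> \<open>Raising the exponent to at least 1/2 provides the positivity required by
    \<open>power_le_linear_plus_weight\<close>; the summand 1 in \<open>rp\<close> covers
    \<open>rpow\<close> at exponent 0 and arguments below 1.\<close>
  define \<alpha>' where "\<alpha>' = max \<alpha> (1/2)"
  have \<alpha>': "0 < \<alpha>'" "\<alpha>' < 1" "\<alpha> \<le> \<alpha>'" using \<alpha> by (auto simp: \<alpha>'_def)
  have rp: "rpow x \<alpha> \<le> 1 + x powr \<alpha>'" if x: "x \<ge> 0" for x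
  proof (cases "x \<le> 1")
    case True
    have "rpow x \<alpha> \<le> 1" using True x \<alpha> by (auto simp: rpow_def powr_le1)
    then show ?thesis by (simp add: add_increasing2)
  next
    case False
    have "rpow x \<alpha> \<le> 1 \<or> rpow x \<alpha> \<le> x powr \<alpha>'" using False \<alpha>' by (auto simp: rpow_def intro: powr_mono)
    then show ?thesis by (auto simp: add_increasing add_increasing2)
  qed
  define c0 where "c0 = 2 * C + \<bar>U 0\<bar> + \<bar>U a'\<bar> + \<kappa> * \<bar>a'\<bar>"
  have c0: "c0 \<ge> 0" using C \<kappa> by (simp add: c0_def)
  have bnd: "U x \<le> c0 + C * (max 0 x) powr \<alpha>' - \<kappa> * max 0 (- x)" for x
  proof (cases "x \<ge> 0")
    case True
    have "U x \<le> C * (1 + x powr \<alpha>' + 1)" using gr[OF True] mult_left_mono[OF rp[OF True], of C] C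
      by (simp add: algebra_simps)
    also have "\<dots> \<le> c0 + C * x powr \<alpha>'" using \<kappa> by (simp add: c0_def algebra_simps)
    finally show ?thesis using True by simp
  next
    case False
    have "U x \<le> c0 + \<kappa> * x"
    proof (cases "x < a'")
      case True
      have "- (\<kappa> * a') \<le> \<kappa> * \<bar>a'\<bar>" using \<kappa> by (simp add: abs_if)
      then show ?thesis using neg[OF True] C unfolding c0_def by (simp add: algebra_simps)
    next
      case xa: False
      have "U x \<le> U 0" using False monoD[OF mono, of x 0] by simp
      moreover have "0 \<le> \<kappa> * \<bar>a'\<bar> + \<kappa> * x" using xa False \<kappa> by (simp flip: distrib_left)
      ultimately show ?thesis using C unfolding c0_def by linarith
    qed
    then show ?thesis using False by simp
  qed
  obtain N :: nat where N: "\<alpha>' / (1 - \<alpha>') \<le> real N" using real_arch_simple by blast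
  have "weighted_growth U \<kappa> N" unfolding weighted_growth_def
  proof (intro allI impI)
    fix \<epsilon> :: real assume \<epsilon>: "\<epsilon> > 0"
    \<comment> \<open>Young's inequality is applied with the smaller weight
      \<open>\<delta> * V\<close>: the linear coefficient becomes C \<delta> \<le> \<epsilon>, and
      the factor (1/\<delta>)^N moves into \<open>D\<close>.\<close>
    define \<delta> where "\<delta> = min 1 (\<epsilon> / C)"
    have \<delta>: "0 < \<delta>" "\<delta> \<le> 1" "C * \<delta> \<le> \<epsilon>"
      using \<epsilon> C by (auto simp: \<delta>_def min_def field_simps)
    define D where "D = c0 + C * (1 / \<delta>) ^ N"
    have "U x \<le> \<epsilon> * (V * max 0 x) + D * (1 / V) ^ N - \<kappa> * max 0 (- x)" if V: "0 < V" "V \<le> 1" for V x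
    proof -
      have "(max 0 x) powr \<alpha>' \<le> (\<delta> * V) * max 0 x + (1 / (\<delta> * V)) ^ N"
        using V \<delta> by (intro power_le_linear_plus_weight[OF _ _ _ \<alpha>'(1,2) N]) (auto simp: mult_le_one)
      then have "C * (max 0 x) powr \<alpha>' \<le> C * ((\<delta> * V) * max 0 x + (1 / (\<delta> * V)) ^ N)"
        using C by (intro mult_left_mono) auto
      also have "\<dots> = (C * \<delta>) * (V * max 0 x) + C * (1 / \<delta>) ^ N * (1 / V) ^ N"
        by (simp add: power_divide power_mult_distrib algebra_simps)
      also have "\<dots> \<le> \<epsilon> * (V * max 0 x) + C * (1 / \<delta>) ^ N * (1 / V) ^ N"
        using V \<delta> by (intro add_right_mono mult_right_mono) auto
      finally have 1: "C * (max 0 x) powr \<alpha>' \<le> \<epsilon> * (V * max 0 x) + C * (1 / \<delta>) ^ N * (1 / V) ^ N" .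
      have "1 \<le> (1 / V) ^ N" using V by (intro one_le_power) simp
      then have "c0 * 1 \<le> c0 * (1 / V) ^ N" using c0 by (intro mult_left_mono)
      with 1 bnd[of x] show ?thesis by (simp add: D_def distrib_right)
    qed
    moreover have "D \<ge> 0" using c0 C \<delta> by (simp add: D_def)
    ultimately show "\<exists>D\<ge>0. \<forall>V x. 0 < V \<longrightarrow> V \<le> 1 \<longrightarrow>
       U x \<le> \<epsilon> * (V * max 0 x) + D * (1 / V) ^ N - \<kappa> * max 0 (- x)" by blast
  qed
  with \<kappa> show ?thesis by blast
qed

lemma ext_expect_integrable:
  assumes "integrable M X"
  shows "ext_expect M X = ereal (\<integral>\<omega>. X \<omega> \<partial>M)"
proof -
  have m: "ennreal (max 0 x) = ennreal x" for x by (metis ennreal_neg le_cases max.absorb1 max.absorb2 order_refl)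
  obtain r q where rq: "0 \<le> r" "0 \<le> q" "(\<integral>\<^sup>+\<omega>. ennreal (X \<omega>) \<partial>M) = ennreal r" "(\<integral>\<^sup>+\<omega>. ennreal (- X \<omega>) \<partial>M) = ennreal q"
     "(\<integral>\<omega>. X \<omega> \<partial>M) = r - q"
    using integrableE[OF assms] by blast
  then show ?thesis by (simp add: ext_expect_def Let_def m)
qed

lemma ext_expect_neg_part:
  assumes "ext_expect M X \<noteq> -\<infinity>" and [measurable]: "X \<in> borel_measurable M"
  shows "integrable M (\<lambda>\<omega>. max 0 (- X \<omega>))"
proof -
  have "(\<integral>\<^sup>+\<omega>. ennreal (max 0 (- X \<omega>)) \<partial>M) \<noteq> \<infinity>"
    using assms(1) by (auto simp: ext_expect_def Let_def split: if_splits)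
  then show ?thesis by (intro integrableI_nonneg) (auto simp: top.not_eq_extremum)
qed

lemma ext_expect_cong_AE:
  assumes "AE \<omega> in M. X \<omega> = Y \<omega>"
  shows "ext_expect M X = ext_expect M Y"
proof -
  have "(\<integral>\<^sup>+\<omega>. ennreal (max 0 (X \<omega>)) \<partial>M) = (\<integral>\<^sup>+\<omega>. ennreal (max 0 (Y \<omega>)) \<partial>M)"
    "(\<integral>\<^sup>+\<omega>. ennreal (max 0 (- X \<omega>)) \<partial>M) = (\<integral>\<^sup>+\<omega>. ennreal (max 0 (- Y \<omega>)) \<partial>M)"
    using assms by (auto intro!: nn_integral_cong_AE elim!: eventually_mono)
  then show ?thesis by (simp add: ext_expect_def)
qed

context prob_space
begin

text \<open>The growth bound at \<epsilon> = 1 dominates the positive part of the utility by the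
  weighted wealth and a moment of 1/V.\<close>

lemma integrable_utility:
  assumes V: "weight M V" and G: "weighted_growth U \<kappa> N" and \<kappa>: "\<kappa> > 0" and U[measurable]: "U \<in> borel_measurable borel"
    and X[measurable]: "X \<in> borel_measurable M"
    and iV: "integrable M (\<lambda>\<omega>. V \<omega> * max 0 (X \<omega>))" and iU: "integrable M (\<lambda>\<omega>. max 0 (- U (X \<omega>)))"
  shows "integrable M (\<lambda>\<omega>. U (X \<omega>))"
proof -
  obtain D where D: "\<And>V x. 0 < V \<Longrightarrow> V \<le> 1 \<Longrightarrow> U x \<le> 1 * (V * max 0 x) + D * (1 / V) ^ N - \<kappa> * max 0 (- x)"
    using G[unfolded weighted_growth_def, rule_format, of 1] by auto
  show ?thesis
  proof (rule Bochner_Integration.integrable_bound)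
    show "integrable M (\<lambda>\<omega>. max 0 (- U (X \<omega>)) + (\<bar>V \<omega> * max 0 (X \<omega>)\<bar> + \<bar>D * (1 / V \<omega>) ^ N\<bar>))"
      using iU iV weight_int[OF V, of N]
      by (intro Bochner_Integration.integrable_add integrable_abs integrable_mult_right)
    show "AE \<omega> in M. norm (U (X \<omega>)) \<le> norm (max 0 (- U (X \<omega>)) + (\<bar>V \<omega> * max 0 (X \<omega>)\<bar> + \<bar>D * (1 / V \<omega>) ^ N\<bar>))"
      using weight_AE[OF V]
    proof eventually_elim
      case (elim \<omega>)
      have "0 \<le> \<kappa> * max 0 (- X \<omega>)" using \<kappa> by simp
      then have "U (X \<omega>) \<le> \<bar>V \<omega> * max 0 (X \<omega>)\<bar> + \<bar>D * (1 / V \<omega>) ^ N\<bar>" using D[of "V \<omega>" "X \<omega>"] elim by linarith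
      then show ?case by (simp add: max_def)
    qed
  qed measurable
qed

text \<open>Where X \<le> 0 the growth bound with weight 1 reads \<kappa> X^- \<le> D - U(X). No
  control of the positive part enters, so this can precede the a priori bounds, which presuppose
  it.\<close>

lemma integrable_neg_wealth:
  assumes G: "weighted_growth U \<kappa> N" and \<kappa>: "\<kappa> > 0" and X[measurable]: "X \<in> borel_measurable M"
    and iU: "integrable M (\<lambda>\<omega>. max 0 (- U (X \<omega>)))"
  shows "integrable M (\<lambda>\<omega>. max 0 (- X \<omega>))"
proof -
  obtain D where D0: "0 \<le> D" and D: "\<And>V x. 0 < V \<Longrightarrow> V \<le> 1 \<Longrightarrow> U x \<le> 1 * (V * max 0 x) + D * (1 / V) ^ N - \<kappa> * max 0 (- x)"
    using G[unfolded weighted_growth_def, rule_format, of 1] by auto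
  show ?thesis
  proof (rule Bochner_Integration.integrable_bound)
    show "integrable M (\<lambda>\<omega>. (D + max 0 (- U (X \<omega>))) / \<kappa>)"
      using iU by (intro integrable_divide Bochner_Integration.integrable_add) auto
    show "AE \<omega> in M. norm (max 0 (- X \<omega>)) \<le> norm ((D + max 0 (- U (X \<omega>))) / \<kappa>)"
    proof (rule AE_I2)
      fix \<omega>
      have "\<kappa> * max 0 (- X \<omega>) \<le> D + max 0 (- U (X \<omega>))"
      proof (cases "X \<omega> \<le> 0")
        case True then show ?thesis using D[of 1 "X \<omega>"] by simp
      next
        case False then show ?thesis using D0 by simp
      qed
      then have "max 0 (- X \<omega>) \<le> (D + max 0 (- U (X \<omega>))) / \<kappa>"
        by (subst pos_le_divide_eq[OF \<kappa>]) (simp only: mult.commute)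
      then have "\<bar>max 0 (- X \<omega>)\<bar> \<le> (D + max 0 (- U (X \<omega>))) / \<kappa>" by (subst abs_of_nonneg) auto
      then show "norm (max 0 (- X \<omega>)) \<le> norm ((D + max 0 (- U (X \<omega>))) / \<kappa>)"
        unfolding real_norm_def using abs_ge_self order_trans by blast
    qed
  qed measurable
qed

text \<open>Reversed Fatou without a common integrable majorant: the weighted positive parts are
  only bounded in L^1, so \<epsilon> times them is added before Fatou. This costs at most \<epsilon>
  b, and \<epsilon> tends to 0 at the end.\<close>

lemma utility_upper_semicontinuous:
  assumes V: "weight M V" and G: "weighted_growth U \<kappa> N" and \<kappa>: "\<kappa> > 0"
    and U: "continuous_on UNIV U"
    and Xn[measurable]: "\<And>n. X n \<in> borel_measurable M" and Y[measurable]: "Y \<in> borel_measurable M"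
    and lim: "AE \<omega> in M. (\<lambda>n. X n \<omega>) \<longlonglongrightarrow> Y \<omega>"
    and iV: "\<And>n. integrable M (\<lambda>\<omega>. V \<omega> * max 0 (X n \<omega>))" and b: "\<And>n. (\<integral>\<omega>. V \<omega> * max 0 (X n \<omega>) \<partial>M) \<le> b"
    and iU: "\<And>n. integrable M (\<lambda>\<omega>. U (X n \<omega>))" and c: "\<And>n. c n \<le> (\<integral>\<omega>. U (X n \<omega>) \<partial>M)" and clim: "c \<longlonglongrightarrow> c'"
  shows "integrable M (\<lambda>\<omega>. U (Y \<omega>)) \<and> c' \<le> (\<integral>\<omega>. U (Y \<omega>) \<partial>M)"
proof -
  have Um[measurable]: "U \<in> borel_measurable borel" by (rule borel_measurable_continuous_onI[OF U])
  note [measurable] = weight_meas[OF V]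
  have Ulim: "AE \<omega> in M. (\<lambda>n. U (X n \<omega>)) \<longlonglongrightarrow> U (Y \<omega>)"
    using lim by eventually_elim (rule continuous_on_tendsto_compose[OF U], auto)
  have Plim: "AE \<omega> in M. (\<lambda>n. V \<omega> * max 0 (X n \<omega>)) \<longlonglongrightarrow> V \<omega> * max 0 (Y \<omega>)"
    using lim by eventually_elim (intro tendsto_intros)
  have VY: "integrable M (\<lambda>\<omega>. V \<omega> * max 0 (Y \<omega>))"
  proof (rule integrableI_nonneg)
    show "AE \<omega> in M. 0 \<le> V \<omega> * max 0 (Y \<omega>)" using weight_AE[OF V] by eventually_elim simp
    have "(\<integral>\<^sup>+\<omega>. ennreal (V \<omega> * max 0 (Y \<omega>)) \<partial>M) = (\<integral>\<^sup>+\<omega>. liminf (\<lambda>n. ennreal (V \<omega> * max 0 (X n \<omega>))) \<partial>M)"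
      by (intro nn_integral_cong_AE, use Plim in eventually_elim)
        (rule lim_imp_Liminf[symmetric], simp, erule tendsto_ennrealI)
    also have "\<dots> \<le> liminf (\<lambda>n. \<integral>\<^sup>+\<omega>. ennreal (V \<omega> * max 0 (X n \<omega>)) \<partial>M)" by (rule nn_integral_liminf) measurable
    also have "\<dots> \<le> liminf (\<lambda>n. ennreal b)"
    proof (intro Liminf_mono always_eventually allI)
      fix n
      have "AE \<omega> in M. 0 \<le> V \<omega> * max 0 (X n \<omega>)" using weight_AE[OF V] by eventually_elim simp
      from nn_integral_eq_integral[OF iV this] show "(\<integral>\<^sup>+\<omega>. ennreal (V \<omega> * max 0 (X n \<omega>)) \<partial>M) \<le> ennreal b"
        using b by (simp add: ennreal_leI)
    qed
    also have "\<dots> < \<infinity>" by (simp add: Liminf_const)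
    finally show "(\<integral>\<^sup>+\<omega>. ennreal (V \<omega> * max 0 (Y \<omega>)) \<partial>M) < \<infinity>" .
  qed measurable
  have VY0: "0 \<le> (\<integral>\<omega>. V \<omega> * max 0 (Y \<omega>) \<partial>M)"
    by (rule integral_nonneg_AE) (use weight_AE[OF V] in \<open>eventually_elim, simp\<close>)
  have main: "integrable M (\<lambda>\<omega>. U (Y \<omega>)) \<and> c' - \<epsilon> * b \<le> (\<integral>\<omega>. U (Y \<omega>) \<partial>M)" if \<epsilon>: "\<epsilon> > 0" for \<epsilon>
  proof -
    obtain D where D: "\<And>V x. 0 < V \<Longrightarrow> V \<le> 1 \<Longrightarrow> U x \<le> \<epsilon> * (V * max 0 x) + D * (1 / V) ^ N - \<kappa> * max 0 (- x)"
      using G[unfolded weighted_growth_def, rule_format, OF \<epsilon>] by auto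
    define E where "E = (\<integral>\<omega>. D * (1 / V \<omega>) ^ N \<partial>M)"
    have iE: "integrable M (\<lambda>\<omega>. D * (1 / V \<omega>) ^ N)" by (intro integrable_mult_right weight_int V)
    define H where "H x \<omega> = \<epsilon> * (V \<omega> * max 0 x) + D * (1 / V \<omega>) ^ N - U x" for x \<omega>
    have H0: "AE \<omega> in M. \<forall>x. 0 \<le> H x \<omega>"
      using weight_AE[OF V]
    proof eventually_elim
      case (elim \<omega>)
      show ?case
      proof
        fix x
        have "0 \<le> \<kappa> * max 0 (- x)" using \<kappa> by simp
        then show "0 \<le> H x \<omega>" using D[of "V \<omega>" x] elim by (simp add: H_def)
      qed
    qed
    have Hm[measurable]: "(\<lambda>\<omega>. H (X n \<omega>) \<omega>) \<in> borel_measurable M" "(\<lambda>\<omega>. H (Y \<omega>) \<omega>) \<in> borel_measurable M" for n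
      unfolding H_def by measurable
    have Hlim: "AE \<omega> in M. (\<lambda>n. H (X n \<omega>) \<omega>) \<longlonglongrightarrow> H (Y \<omega>) \<omega>"
      using Ulim lim unfolding H_def by eventually_elim (intro tendsto_intros)
    have iHn: "integrable M (\<lambda>\<omega>. H (X n \<omega>) \<omega>)" for n
      unfolding H_def by (intro Bochner_Integration.integrable_diff Bochner_Integration.integrable_add integrable_mult_right iV iU iE)
    have Hn: "(\<integral>\<omega>. H (X n \<omega>) \<omega> \<partial>M) \<le> \<epsilon> * b + E - c n" for n
    proof -
      have "(\<integral>\<omega>. H (X n \<omega>) \<omega> \<partial>M) = \<epsilon> * (\<integral>\<omega>. V \<omega> * max 0 (X n \<omega>) \<partial>M) + E - (\<integral>\<omega>. U (X n \<omega>) \<partial>M)"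
        unfolding H_def E_def using iV iU iE by simp
      then show ?thesis using c[of n] mult_left_mono[OF b[of n], of \<epsilon>] \<epsilon> by linarith
    qed
    have "(\<integral>\<^sup>+\<omega>. ennreal (H (Y \<omega>) \<omega>) \<partial>M) = (\<integral>\<^sup>+\<omega>. liminf (\<lambda>n. ennreal (H (X n \<omega>) \<omega>)) \<partial>M)"
      by (intro nn_integral_cong_AE, use Hlim in eventually_elim)
        (rule lim_imp_Liminf[symmetric], simp, erule tendsto_ennrealI)
    also have "\<dots> \<le> liminf (\<lambda>n. \<integral>\<^sup>+\<omega>. ennreal (H (X n \<omega>) \<omega>) \<partial>M)" by (rule nn_integral_liminf) measurable
    also have "\<dots> \<le> liminf (\<lambda>n. ennreal (\<epsilon> * b + E - c n))"
    proof (intro Liminf_mono always_eventually allI)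
      fix n
      have "AE \<omega> in M. 0 \<le> H (X n \<omega>) \<omega>" using H0 by eventually_elim simp
      from nn_integral_eq_integral[OF iHn this] show "(\<integral>\<^sup>+\<omega>. ennreal (H (X n \<omega>) \<omega>) \<partial>M) \<le> ennreal (\<epsilon> * b + E - c n)"
        using Hn[of n] by (simp add: ennreal_leI)
    qed
    also have "\<dots> = ennreal (\<epsilon> * b + E - c')"
      by (intro lim_imp_Liminf tendsto_ennrealI tendsto_intros clim) simp
    finally have le: "(\<integral>\<^sup>+\<omega>. ennreal (H (Y \<omega>) \<omega>) \<partial>M) \<le> ennreal (\<epsilon> * b + E - c')" .
    have HY0: "AE \<omega> in M. 0 \<le> H (Y \<omega>) \<omega>" using H0 by eventually_elim simp
    have iH: "integrable M (\<lambda>\<omega>. H (Y \<omega>) \<omega>)"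
      by (rule integrableI_nonneg[OF _ HY0]) (use le in \<open>auto intro: le_less_trans\<close>)
    \<comment> \<open>\<open>ennreal\<close> truncates negative reals to 0, so the sign of the limit
      is settled before the estimate is read in the reals.\<close>
    have pos: "0 \<le> \<epsilon> * b + E - c'"
    proof (rule LIMSEQ_le_const)
      show "(\<lambda>n. \<epsilon> * b + E - c n) \<longlonglongrightarrow> \<epsilon> * b + E - c'" by (intro tendsto_intros clim)
      have "0 \<le> \<epsilon> * b + E - c n" for n
      proof -
        have "0 \<le> (\<integral>\<omega>. H (X n \<omega>) \<omega> \<partial>M)" by (rule integral_nonneg_AE) (use H0 in \<open>eventually_elim, simp\<close>)
        with Hn[of n] show ?thesis by linarith
      qed
      then show "\<exists>N. \<forall>n\<ge>N. 0 \<le> \<epsilon> * b + E - c n" by blast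
    qed
    have "ennreal (\<integral>\<omega>. H (Y \<omega>) \<omega> \<partial>M) \<le> ennreal (\<epsilon> * b + E - c')"
      using le nn_integral_eq_integral[OF iH HY0] by simp
    then have Hle: "(\<integral>\<omega>. H (Y \<omega>) \<omega> \<partial>M) \<le> \<epsilon> * b + E - c'" using pos by (simp add: ennreal_le_iff)
    have eq: "U (Y \<omega>) = \<epsilon> * (V \<omega> * max 0 (Y \<omega>)) + D * (1 / V \<omega>) ^ N - H (Y \<omega>) \<omega>" for \<omega> by (simp add: H_def)
    have i: "integrable M (\<lambda>\<omega>. U (Y \<omega>))"
      unfolding eq by (intro Bochner_Integration.integrable_diff Bochner_Integration.integrable_add integrable_mult_right VY iE iH)
    have "(\<integral>\<omega>. U (Y \<omega>) \<partial>M) = \<epsilon> * (\<integral>\<omega>. V \<omega> * max 0 (Y \<omega>) \<partial>M) + E - (\<integral>\<omega>. H (Y \<omega>) \<omega> \<partial>M)"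
      unfolding eq E_def using VY iE iH by simp
    then have "c' - \<epsilon> * b \<le> (\<integral>\<omega>. U (Y \<omega>) \<partial>M)" using Hle mult_nonneg_nonneg[OF less_imp_le[OF \<epsilon>] VY0] by linarith
    with i show ?thesis by simp
  qed
  have "c' \<le> (\<integral>\<omega>. U (Y \<omega>) \<partial>M)"
  proof (rule field_le_epsilon)
    fix e :: real assume e: "e > 0"
    have "e / (\<bar>b\<bar> + 1) * b \<le> e"
    proof -
      have "e / (\<bar>b\<bar> + 1) * b \<le> e / (\<bar>b\<bar> + 1) * (\<bar>b\<bar> + 1)" using e by (intro mult_left_mono) auto
      then show ?thesis by simp
    qed
    moreover have "e / (\<bar>b\<bar> + 1) > 0" using e by simp
    ultimately show "c' \<le> (\<integral>\<omega>. U (Y \<omega>) \<partial>M) + e" using main[of "e / (\<bar>b\<bar> + 1)"] by linarith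
  qed
  with main[of 1] show ?thesis by simp
qed

end

context losing_market
begin

text \<open>Caps expected utility and, read backwards, bounds the expected terminal loss by any
  lower bound on expected utility.\<close>

lemma utility_apriori:
  assumes G: "weighted_growth U \<kappa> N" and \<kappa>: "\<kappa> > 0" and U[measurable]: "U \<in> borel_measurable borel"
  shows "\<exists>R. \<forall>\<phi>. good \<phi> \<longrightarrow> ext_expect M (\<lambda>w. U (W \<phi> T w)) \<noteq> -\<infinity> \<longrightarrow>
     integrable M (\<lambda>w. max 0 (- W \<phi> T w)) \<and> integrable M (\<lambda>w. U (W \<phi> T w)) \<and>
     (\<integral>w. U (W \<phi> T w) \<partial>M) \<le> R - \<kappa> / 2 * (\<integral>w. max 0 (- W \<phi> T w) \<partial>M)"
proof -
  obtain V B where V: "weight M V" and dom: "dominated V (\<lambda>\<phi> w. max 0 (W \<phi> T w)) B"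
    using pos_part_bound[of T] by auto
  \<comment> \<open>Makes \<epsilon> B \<le> \<kappa>/2: the positive part, itself bounded through
    the expected loss, consumes at most half of the linear penalty on losses.\<close>
  define \<epsilon> where "\<epsilon> = \<kappa> / (2 * (\<bar>B\<bar> + 1))"
  have \<epsilon>: "\<epsilon> > 0" using \<kappa> by (simp add: \<epsilon>_def)
  have \<epsilon>B: "\<epsilon> * B \<le> \<kappa> / 2"
  proof -
    have "\<epsilon> * B \<le> \<epsilon> * (\<bar>B\<bar> + 1)" using \<epsilon> by (intro mult_left_mono) auto
    also have "\<dots> = \<kappa> / 2" unfolding \<epsilon>_def by (simp add: field_simps)
    finally show ?thesis .
  qed
  obtain D where D: "\<And>V x. 0 < V \<Longrightarrow> V \<le> 1 \<Longrightarrow> U x \<le> \<epsilon> * (V * max 0 x) + D * (1 / V) ^ N - \<kappa> * max 0 (- x)"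
    using G[unfolded weighted_growth_def, rule_format, OF \<epsilon>] by auto
  define E where "E = (\<integral>w. D * (1 / V w) ^ N \<partial>M)"
  have iE: "integrable M (\<lambda>w. D * (1 / V w) ^ N)" by (intro integrable_mult_right weight_int V)
  show ?thesis
  proof (intro exI[of _ "\<kappa> / 2 + E"] allI impI)
    fix \<phi> assume g: "good \<phi>" and e: "ext_expect M (\<lambda>w. U (W \<phi> T w)) \<noteq> -\<infinity>"
    have [measurable]: "W \<phi> T \<in> borel_measurable M" by (rule W_meas_M[OF g]) simp
    have nU: "integrable M (\<lambda>w. max 0 (- U (W \<phi> T w)))" by (rule ext_expect_neg_part[OF e]) measurable
    have nW: "integrable M (\<lambda>w. max 0 (- W \<phi> T w))" by (rule integrable_neg_wealth[OF G \<kappa> _ nU]) measurable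
    let ?x = "\<integral>w. max 0 (- W \<phi> T w) \<partial>M"
    have x0: "0 \<le> ?x" by (rule Bochner_Integration.integral_nonneg) simp
    have iV: "integrable M (\<lambda>w. V w * max 0 (W \<phi> T w))" "(\<integral>w. V w * max 0 (W \<phi> T w) \<partial>M) \<le> B * (1 + ?x)"
      using dom g nW by (auto simp: dominated_def)
    have iU: "integrable M (\<lambda>w. U (W \<phi> T w))" by (rule integrable_utility[OF V G \<kappa> U _ iV(1) nU]) measurable
    have iR: "integrable M (\<lambda>w. \<epsilon> * (V w * max 0 (W \<phi> T w)) + D * (1 / V w) ^ N - \<kappa> * max 0 (- W \<phi> T w))"
      by (intro Bochner_Integration.integrable_diff Bochner_Integration.integrable_add integrable_mult_right iV iE nW)
    have "(\<integral>w. U (W \<phi> T w) \<partial>M) \<le> (\<integral>w. \<epsilon> * (V w * max 0 (W \<phi> T w)) + D * (1 / V w) ^ N - \<kappa> * max 0 (- W \<phi> T w) \<partial>M)"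
      by (rule integral_mono_AE[OF iU iR]) (use weight_AE[OF V] in \<open>eventually_elim, simp add: D\<close>)
    also have "\<dots> = \<epsilon> * (\<integral>w. V w * max 0 (W \<phi> T w) \<partial>M) + E - \<kappa> * ?x"
      unfolding E_def using iV(1) iE nW by simp
    also have "\<dots> \<le> \<epsilon> * (B * (1 + ?x)) + E - \<kappa> * ?x" using mult_left_mono[OF iV(2), of \<epsilon>] \<epsilon> by simp
    also have "\<dots> = (\<epsilon> * B) * (1 + ?x) + E - \<kappa> * ?x" by simp
    also have "\<dots> \<le> \<kappa> / 2 * (1 + ?x) + E - \<kappa> * ?x" using mult_right_mono[OF \<epsilon>B, of "1 + ?x"] x0 by linarith
    also have "\<dots> = \<kappa> / 2 + E - \<kappa> / 2 * ?x" by (simp add: algebra_simps)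
    finally show "integrable M (\<lambda>w. max 0 (- W \<phi> T w)) \<and> integrable M (\<lambda>w. U (W \<phi> T w)) \<and>
      (\<integral>w. U (W \<phi> T w) \<partial>M) \<le> \<kappa> / 2 + E - \<kappa> / 2 * ?x" using nW iU by blast
  qed
qed

end

section \<open>Almost sure convergence of near-minimisers\<close>

text \<open>Euclidean length of the vector (1, a). Unlike the norm it is strictly convex, yet it
  grows linearly, so first-moment bounds make it integrable; a squared norm would ask for second
  moments.\<close>

definition bnorm :: "'d::euclidean_space \<Rightarrow> real" where
  "bnorm a = sqrt (1 + (norm a)\<^sup>2)"

lemma bnorm_ge_1: "1 \<le> bnorm a" and bnorm_le: "bnorm a \<le> 1 + norm a" and bnorm_sq: "(bnorm a)\<^sup>2 = 1 + (norm a)\<^sup>2"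
proof -
  show "1 \<le> bnorm a" by (simp add: bnorm_def)
  have "1 + (norm a)\<^sup>2 \<le> (1 + norm a)\<^sup>2" by (simp add: power2_eq_square algebra_simps)
  then show "bnorm a \<le> 1 + norm a" unfolding bnorm_def by (intro real_le_lsqrt) auto
  show "(bnorm a)\<^sup>2 = 1 + (norm a)\<^sup>2" by (simp add: bnorm_def add_nonneg_nonneg)
qed

lemma bnorm_measurable[measurable]: "bnorm \<in> borel_measurable borel"
  unfolding bnorm_def by measurable

definition mgap :: "'d::euclidean_space \<Rightarrow> 'd \<Rightarrow> real" where
  "mgap a b = (bnorm a + bnorm b) / 2 - bnorm ((1/2) *\<^sub>R (a + b))"

text \<open>Strict convexity of \<open>bnorm\<close>, quantitatively: a small midpoint gap forces the points together.\<close>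

lemma mgap_bounds:
  fixes a b :: "'d::euclidean_space"
  shows mgap_nonneg: "0 \<le> mgap a b"
    and mgap_norm: "(norm (a - b))\<^sup>2 \<le> mgap a b * (bnorm a + bnorm b) ^ 3"
proof -
  \<comment> \<open>\<open>p\<close> and \<open>q\<close> are the lengths of (1, a) and (1, b),
    \<open>d\<close> their inner product and \<open>s\<close> the length of their sum; the midpoint
    gap is half the defect in the triangle inequality.\<close>
  define p q s d where "p = bnorm a" and "q = bnorm b" and "s = 2 * bnorm ((1/2) *\<^sub>R (a + b))" and "d = 1 + a \<bullet> b"
  have p: "1 \<le> p" "p\<^sup>2 = 1 + a \<bullet> a" and q: "1 \<le> q" "q\<^sup>2 = 1 + b \<bullet> b" and s0: "s \<ge> 0"
    using bnorm_ge_1[of a] bnorm_ge_1[of b] bnorm_ge_1[of "(1/2) *\<^sub>R (a + b)"]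
    by (auto simp: p_def q_def s_def bnorm_sq power2_norm_eq_inner)
  have s: "s\<^sup>2 = p\<^sup>2 + q\<^sup>2 + 2 * d"
    unfolding s_def power_mult_distrib bnorm_sq p q d_def power2_norm_eq_inner
    by (simp add: inner_add_left inner_add_right inner_commute algebra_simps)
  have cs: "(a \<bullet> b)\<^sup>2 \<le> (a \<bullet> a) * (b \<bullet> b)" by (rule Cauchy_Schwarz_ineq)
  \<comment> \<open>The right-hand side is the Gram determinant of (1, a) and (1, b); it exceeds |a
    - b|^2 by the Gram determinant of a and b.\<close>
  have gram: "(norm (a - b))\<^sup>2 \<le> (p * q)\<^sup>2 - d\<^sup>2"
  proof -
    have "(p * q)\<^sup>2 - d\<^sup>2 = a \<bullet> a + b \<bullet> b - 2 * (a \<bullet> b) + ((a \<bullet> a) * (b \<bullet> b) - (a \<bullet> b)\<^sup>2)"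
      unfolding power_mult_distrib p q d_def by (simp add: power2_eq_square algebra_simps)
    moreover have "(norm (a - b))\<^sup>2 = a \<bullet> a + b \<bullet> b - 2 * (a \<bullet> b)"
      by (simp add: power2_norm_eq_inner inner_diff_left inner_diff_right inner_commute)
    ultimately show ?thesis using cs by simp
  qed
  have pq: "0 < p * q" using p q by simp
  have "d\<^sup>2 \<le> (p * q)\<^sup>2" using gram zero_le_power2[of "norm (a - b)"] by linarith
  then have dpq: "d \<le> p * q" by (rule power2_le_imp_le) (use pq in simp)
  have "s\<^sup>2 \<le> (p + q)\<^sup>2" using dpq by (simp add: s power2_sum)
  then have spq: "s \<le> p + q" by (rule power2_le_imp_le) (use p q in simp)
  have g: "mgap a b = (p + q - s) / 2" by (simp add: mgap_def p_def q_def s_def diff_divide_distrib)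
  show g0: "0 \<le> mgap a b" using spq by (simp add: g)
  have "2 * (p * q - d) = (p + q - s) * (p + q + s)"
    using s by (simp add: power2_eq_square algebra_simps)
  also have "\<dots> \<le> (p + q - s) * (2 * (p + q))" using spq by (intro mult_left_mono) auto
  finally have 1: "p * q - d \<le> 2 * mgap a b * (p + q)" by (simp add: g algebra_simps)
  have "(norm (a - b))\<^sup>2 \<le> (p * q - d) * (p * q + d)" using gram by (simp add: power2_eq_square algebra_simps)
  also have "\<dots> \<le> (p * q - d) * (2 * (p * q))" using dpq by (intro mult_left_mono) auto
  also have "\<dots> \<le> (2 * mgap a b * (p + q)) * (2 * (p * q))" using 1 pq by (intro mult_right_mono) auto
  also have "\<dots> = mgap a b * (p + q) * (4 * p * q)" by simp
  also have "\<dots> \<le> mgap a b * (p + q) * (p + q)\<^sup>2"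
  proof (rule mult_left_mono)
    show "4 * p * q \<le> (p + q)\<^sup>2" using zero_le_power2[of "p - q"] by (simp add: power2_eq_square algebra_simps)
    show "0 \<le> mgap a b * (p + q)" using g0 p q by simp
  qed
  also have "\<dots> = mgap a b * (p + q) ^ 3" by (simp add: power2_eq_square power3_eq_cube)
  finally show "(norm (a - b))\<^sup>2 \<le> mgap a b * (bnorm a + bnorm b) ^ 3" by (simp add: p_def q_def)
qed

text \<open>\<open>mgap_norm\<close> rewritten as r^4 \<le> (g/\<delta>^3) (\<delta> s)^3, so r
  cannot exceed both factors' bases. The sum separates the gap g, whose integral will be small, from
  the sizes s, whose integrals are merely bounded, and needs first moments only.\<close>

lemma sqrt_norm_le_mgap:
  assumes \<delta>: "0 < \<delta>"
  shows "sqrt (norm (a - b)) \<le> mgap a b / \<delta> ^ 3 + \<delta> * (bnorm a + bnorm b)"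
proof (rule ccontr)
  assume n: "\<not> ?thesis"
  define r g s where "r = sqrt (norm (a - b))" and "g = mgap a b" and "s = bnorm a + bnorm b"
  have g: "0 \<le> g" using mgap_nonneg by (simp add: g_def)
  have s: "0 < s" using bnorm_ge_1[of a] bnorm_ge_1[of b] by (simp add: s_def)
  have lt: "g / \<delta> ^ 3 + \<delta> * s < r" using n by (simp add: r_def g_def s_def)
  have g1: "0 \<le> g / \<delta> ^ 3" "0 < \<delta> * s" using g s \<delta> by simp_all
  have r: "g / \<delta> ^ 3 < r" "\<delta> * s < r" using lt g1 by linarith+
  have "r ^ 4 = (r\<^sup>2)\<^sup>2" by simp
  also have "\<dots> = (norm (a - b))\<^sup>2" by (simp add: r_def)
  also have "\<dots> \<le> g * s ^ 3" using mgap_norm[of a b] by (simp add: g_def s_def)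
  also have "\<dots> = (g / \<delta> ^ 3) * (\<delta> * s) ^ 3" using \<delta> by (simp add: power_mult_distrib)
  also have "\<dots> \<le> (g / \<delta> ^ 3) * r ^ 3" using r g1 by (intro mult_left_mono power_mono) auto
  also have "\<dots> < r * r ^ 3" using r g1 by (intro mult_strict_right_mono) auto
  also have "\<dots> = r ^ 4" by (simp add: power_numeral_reduce)
  finally show False by simp
qed

definition mid :: "(nat \<Rightarrow> 'a \<Rightarrow> 'd::euclidean_space) \<Rightarrow> (nat \<Rightarrow> 'a \<Rightarrow> 'd) \<Rightarrow> nat \<Rightarrow> 'a \<Rightarrow> 'd" where
  "mid \<phi> \<psi> t \<omega> = (1/2) *\<^sub>R (\<phi> t \<omega> + \<psi> t \<omega>)"

text \<open>A Komlos-type selection: almost minimisers of a strictly convex functional over decreasing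
  midpoint-convex sets form a Cauchy sequence.\<close>

lemma (in prob_space) midpoint_convex_selection:
  fixes C :: "nat \<Rightarrow> (nat \<Rightarrow> 'a \<Rightarrow> 'd::euclidean_space) set"
  assumes I: "finite I"
    and ne: "\<And>n. C n \<noteq> {}" and dec: "\<And>n m. n \<le> m \<Longrightarrow> C m \<subseteq> C n"
    and conv: "\<And>n \<phi> \<psi>. \<phi> \<in> C n \<Longrightarrow> \<psi> \<in> C n \<Longrightarrow> mid \<phi> \<psi> \<in> C n"
    and V: "\<And>t. t \<in> I \<Longrightarrow> weight M (V t)"
    and meas: "\<And>\<phi> t. \<phi> \<in> C 0 \<Longrightarrow> t \<in> I \<Longrightarrow> \<phi> t \<in> borel_measurable M"
    and int: "\<And>\<phi> t. \<phi> \<in> C 0 \<Longrightarrow> t \<in> I \<Longrightarrow> integrable M (\<lambda>x. V t x * norm (\<phi> t x))"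
    and bd: "\<And>\<phi> t. \<phi> \<in> C 0 \<Longrightarrow> t \<in> I \<Longrightarrow> (\<integral>x. V t x * norm (\<phi> t x) \<partial>M) \<le> b t"
  shows "\<exists>\<psi>. (\<forall>n. \<psi> n \<in> C n) \<and> (\<forall>t\<in>I. AE x in M. Cauchy (\<lambda>n. \<psi> n t x))"
proof -
  define F where "F \<phi> = (\<Sum>t\<in>I. \<integral>x. V t x * bnorm (\<phi> t x) \<partial>M)" for \<phi> :: "nat \<Rightarrow> 'a \<Rightarrow> 'd"
  have C0: "\<phi> \<in> C n \<Longrightarrow> \<phi> \<in> C 0" for \<phi> n using dec[of 0 n] by auto
  have iV: "integrable M (V t)" if "t \<in> I" for t
  proof (rule integrable_const_bound[where B=1])
    show "AE x in M. norm (V t x) \<le> 1" using weight_AE[OF V[OF that]] by eventually_elim simp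
  qed (rule weight_meas[OF V[OF that]])
  have ib: "integrable M (\<lambda>x. V t x * bnorm (\<phi> t x))" if p: "\<phi> \<in> C 0" and t: "t \<in> I" for \<phi> t
  proof (rule Bochner_Integration.integrable_bound)
    show "integrable M (\<lambda>x. V t x + V t x * norm (\<phi> t x))" by (intro Bochner_Integration.integrable_add iV int p t)
    show "AE x in M. norm (V t x * bnorm (\<phi> t x)) \<le> norm (V t x + V t x * norm (\<phi> t x))"
      using weight_AE[OF V[OF t]]
    proof eventually_elim
      case (elim x)
      have "V t x * bnorm (\<phi> t x) \<le> V t x * (1 + norm (\<phi> t x))" using elim bnorm_le by (intro mult_left_mono) auto
      moreover have "0 \<le> V t x * bnorm (\<phi> t x)" using elim bnorm_ge_1[of "\<phi> t x"] by simp
      ultimately show ?case by (simp add: distrib_left)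
    qed
    note [measurable] = meas[OF p t] weight_meas[OF V[OF t]]
    show "(\<lambda>x. V t x * bnorm (\<phi> t x)) \<in> borel_measurable M" by measurable
  qed
  have bb: "(\<integral>x. V t x * bnorm (\<phi> t x) \<partial>M) \<le> 1 + b t" if p: "\<phi> \<in> C 0" and t: "t \<in> I" for \<phi> t
  proof -
    have "(\<integral>x. V t x * bnorm (\<phi> t x) \<partial>M) \<le> (\<integral>x. 1 + V t x * norm (\<phi> t x) \<partial>M)"
    proof (rule integral_mono_AE[OF ib[OF p t]])
      show "integrable M (\<lambda>x. 1 + V t x * norm (\<phi> t x))" by (intro Bochner_Integration.integrable_add int p t) simp
      show "AE x in M. V t x * bnorm (\<phi> t x) \<le> 1 + V t x * norm (\<phi> t x)"
        using weight_AE[OF V[OF t]]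
      proof eventually_elim
        case (elim x)
        have "V t x * bnorm (\<phi> t x) \<le> V t x * (1 + norm (\<phi> t x))" using elim bnorm_le by (intro mult_left_mono) auto
        then show ?case using elim by (simp add: distrib_left)
      qed
    qed
    also have "\<dots> = 1 + (\<integral>x. V t x * norm (\<phi> t x) \<partial>M)" using int[OF p t] by (simp add: prob_space)
    finally show ?thesis using bd[OF p t] by simp
  qed
  have b0: "0 \<le> (\<integral>x. V t x * bnorm (\<phi> t x) \<partial>M)" if t: "t \<in> I" for \<phi> :: "nat \<Rightarrow> 'a \<Rightarrow> 'd" and t
  proof (rule integral_nonneg_AE)
    show "AE x in M. 0 \<le> V t x * bnorm (\<phi> t x)"
      using weight_AE[OF V[OF t]] 
    proof eventually_elim
      case (elim x) then show ?case using bnorm_ge_1[of "\<phi> t x"] by simp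
    qed
  qed
  have F0: "0 \<le> F \<phi>" for \<phi> :: "nat \<Rightarrow> 'a \<Rightarrow> 'd" unfolding F_def by (rule sum_nonneg) (rule b0)
  have F1: "F \<phi> \<le> (\<Sum>t\<in>I. 1 + b t)" if "\<phi> \<in> C 0" for \<phi> unfolding F_def by (rule sum_mono) (rule bb[OF that])
  \<comment> \<open>The sets decrease, so the infima increase; the uniform bound on \<open>F\<close>
    over \<open>C 0\<close> makes them converge.\<close>
  define m where "m n = Inf (F ` C n)" for n
  have bdd: "bdd_below (F ` C n)" for n by (rule bdd_belowI2[where m=0]) (rule F0)
  have mle: "m n \<le> F \<phi>" if "\<phi> \<in> C n" for n \<phi> unfolding m_def by (rule cINF_lower[OF bdd that])
  have "incseq m" unfolding incseq_def m_def using ne dec bdd by (auto intro!: cINF_superset_mono)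
  moreover have "bdd_above (range m)"
  proof (rule bdd_aboveI2)
    fix n obtain \<phi> where "\<phi> \<in> C n" using ne by blast
    then show "m n \<le> (\<Sum>t\<in>I. 1 + b t)" using mle F1 C0 by (meson order_trans)
  qed
  ultimately obtain L where L: "m \<longlonglongrightarrow> L" "\<And>n. m n \<le> L"
    using LIMSEQ_incseq_SUP[of m] cSUP_upper[of _ UNIV m] by blast
  have "\<exists>\<phi>\<in>C n. F \<phi> < m n + 1 / Suc n" for n
    using cINF_less_iff[OF ne bdd, of n "m n + 1 / Suc n"] by (simp add: m_def del: of_nat_Suc)
  then obtain \<theta> where \<theta>: "\<And>n. \<theta> n \<in> C n" "\<And>n. F (\<theta> n) < m n + 1 / Suc n" by metis
  have \<theta>0: "\<theta> n \<in> C 0" for n using \<theta>(1) C0 by blast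
  \<comment> \<open>For n \<le> k, the average of the two near-minimal values minus
    \<open>m n\<close> is at most (m k - m n)/2 + 1/(n+1), and \<open>m k\<close> is at most
    \<open>L\<close>.\<close>
  define \<eta> where "\<eta> n = (L - m n) / 2 + 1 / Suc n" for n
  have \<eta>: "\<eta> \<longlonglongrightarrow> 0"
  proof -
    have "(\<lambda>n. (L - m n) / 2 + 1 / Suc n) \<longlonglongrightarrow> (L - L) / 2 + 0"
      by (intro tendsto_intros L(1) LIMSEQ_inverse_real_of_nat[unfolded inverse_eq_divide]) simp
    then show ?thesis by (simp add: \<eta>_def[abs_def])
  qed
  have gi: "integrable M (\<lambda>x. V t x * mgap (\<phi> t x) (\<psi> t x))"
    and ge: "(\<integral>x. V t x * mgap (\<phi> t x) (\<psi> t x) \<partial>M) = ((\<integral>x. V t x * bnorm (\<phi> t x) \<partial>M) + (\<integral>x. V t x * bnorm (\<psi> t x) \<partial>M)) / 2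
        - (\<integral>x. V t x * bnorm (mid \<phi> \<psi> t x) \<partial>M)"
    if p: "\<phi> \<in> C 0" "\<psi> \<in> C 0" and t: "t \<in> I" for \<phi> \<psi> t
  proof -
    have eq: "V t x * mgap (\<phi> t x) (\<psi> t x) = (V t x * bnorm (\<phi> t x) + V t x * bnorm (\<psi> t x)) / 2 - V t x * bnorm (mid \<phi> \<psi> t x)" for x
      by (simp add: mgap_def mid_def algebra_simps)
    note i = ib[OF p(1) t] ib[OF p(2) t] ib[OF conv[OF p] t]
    show "integrable M (\<lambda>x. V t x * mgap (\<phi> t x) (\<psi> t x))" unfolding eq
      by (intro Bochner_Integration.integrable_diff integrable_divide Bochner_Integration.integrable_add i)
    show "(\<integral>x. V t x * mgap (\<phi> t x) (\<psi> t x) \<partial>M) = ((\<integral>x. V t x * bnorm (\<phi> t x) \<partial>M) + (\<integral>x. V t x * bnorm (\<psi> t x) \<partial>M)) / 2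
        - (\<integral>x. V t x * bnorm (mid \<phi> \<psi> t x) \<partial>M)"
      unfolding eq using i by simp
  qed
  have g0: "0 \<le> (\<integral>x. V t x * mgap (\<phi> t x) (\<psi> t x) \<partial>M)" if t: "t \<in> I" for \<phi> \<psi> :: "nat \<Rightarrow> 'a \<Rightarrow> 'd" and t
    by (rule integral_nonneg_AE) (use weight_AE[OF V[OF t]] in \<open>eventually_elim, simp add: mgap_nonneg\<close>)
  have gap: "(\<integral>x. V t x * mgap (\<theta> n t x) (\<theta> k t x) \<partial>M) \<le> \<eta> n" if nk: "n \<le> k" and t: "t \<in> I" for n k t
  proof -
    have "(\<integral>x. V t x * mgap (\<theta> n t x) (\<theta> k t x) \<partial>M) \<le> (\<Sum>t\<in>I. \<integral>x. V t x * mgap (\<theta> n t x) (\<theta> k t x) \<partial>M)"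
      by (rule member_le_sum[OF t _ I]) (use g0 in auto)
    also have "\<dots> = (F (\<theta> n) + F (\<theta> k)) / 2 - F (mid (\<theta> n) (\<theta> k))"
      unfolding F_def by (simp add: ge[OF \<theta>0 \<theta>0] sum_subtractf sum_divide_distrib[symmetric] sum.distrib)
    \<comment> \<open>Both strategies lie in \<open>C n\<close> because n \<le> k, hence so does
      their midpoint, whose functional value is at least \<open>m n\<close>.\<close>
    also have "\<dots> \<le> (F (\<theta> n) + F (\<theta> k)) / 2 - m n"
      using mle[OF conv[OF \<theta>(1)[of n], of "\<theta> k"]] \<theta>(1)[of k] dec[OF nk] by auto
    also have "\<dots> \<le> \<eta> n"
    proof -
      have "1 / real (Suc k) \<le> 1 / real (Suc n)" using nk by (intro divide_left_mono) auto
      then show ?thesis using \<theta>(2)[of n] \<theta>(2)[of k] L(2)[of k] unfolding \<eta>_def by argo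
    qed
    finally show ?thesis .
  qed
  have sm: "\<And>t n k. t \<in> I \<Longrightarrow> (\<lambda>x. V t x * sqrt (norm (\<theta> n t x - \<theta> k t x))) \<in> borel_measurable M"
  proof -
    fix t n k assume t: "t \<in> I"
    note [measurable] = meas[OF \<theta>0 t] weight_meas[OF V[OF t]]
    show "(\<lambda>x. V t x * sqrt (norm (\<theta> n t x - \<theta> k t x))) \<in> borel_measurable M" by measurable
  qed
  have est: "(\<integral>\<^sup>+x. ennreal (V t x * sqrt (norm (\<theta> n t x - \<theta> k t x))) \<partial>M) \<le> ennreal (\<eta> n / \<delta> ^ 3 + \<delta> * (2 * (1 + b t)))"
    if \<delta>: "\<delta> > 0" and nk: "n \<le> k" and t: "t \<in> I" for n k t \<delta>
  proof -
    let ?R = "\<lambda>x. V t x * mgap (\<theta> n t x) (\<theta> k t x) / \<delta> ^ 3 + \<delta> * (V t x * bnorm (\<theta> n t x) + V t x * bnorm (\<theta> k t x))"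
    have iR: "integrable M ?R"
      by (intro Bochner_Integration.integrable_add integrable_divide integrable_mult_right gi ib \<theta>0 t)
    have le: "AE x in M. 0 \<le> V t x * sqrt (norm (\<theta> n t x - \<theta> k t x)) \<and> V t x * sqrt (norm (\<theta> n t x - \<theta> k t x)) \<le> ?R x"
      using weight_AE[OF V[OF t]]
    proof eventually_elim
      case (elim x)
      have "V t x * sqrt (norm (\<theta> n t x - \<theta> k t x)) \<le> V t x * (mgap (\<theta> n t x) (\<theta> k t x) / \<delta> ^ 3 + \<delta> * (bnorm (\<theta> n t x) + bnorm (\<theta> k t x)))"
        using elim by (intro mult_left_mono sqrt_norm_le_mgap[OF \<delta>]) auto
      then show ?case using elim by (simp add: algebra_simps)
    qed
    have "(\<integral>\<^sup>+x. ennreal (V t x * sqrt (norm (\<theta> n t x - \<theta> k t x))) \<partial>M) \<le> (\<integral>\<^sup>+x. ennreal (?R x) \<partial>M)"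
      by (rule nn_integral_mono_AE) (use le in \<open>eventually_elim, simp add: ennreal_leI\<close>)
    also have "\<dots> = ennreal (\<integral>x. ?R x \<partial>M)"
      by (rule nn_integral_eq_integral[OF iR]) (use le in \<open>eventually_elim, linarith\<close>)
    also have "(\<integral>x. ?R x \<partial>M) = (\<integral>x. V t x * mgap (\<theta> n t x) (\<theta> k t x) \<partial>M) / \<delta> ^ 3
         + \<delta> * ((\<integral>x. V t x * bnorm (\<theta> n t x) \<partial>M) + (\<integral>x. V t x * bnorm (\<theta> k t x) \<partial>M))"
      using gi[OF \<theta>0 \<theta>0 t] ib[OF \<theta>0 t] by simp
    also have "ennreal \<dots> \<le> ennreal (\<eta> n / \<delta> ^ 3 + \<delta> * (2 * (1 + b t)))"
      using gap[OF nk t] bb[OF \<theta>0 t, of n] bb[OF \<theta>0 t, of k] \<delta>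
      by (intro ennreal_leI add_mono divide_right_mono mult_left_mono) auto
    finally show ?thesis .
  qed
  have cauchy: "\<exists>N. \<forall>n\<ge>N. \<forall>k\<ge>n. (\<integral>\<^sup>+x. ennreal (V t x * sqrt (norm (\<theta> n t x - \<theta> k t x))) \<partial>M) \<le> ennreal \<epsilon>"
    if \<epsilon>: "\<epsilon> > 0" and t: "t \<in> I" for \<epsilon> t
  proof -
    \<comment> \<open>First \<delta> makes the bounded size term at most \<epsilon>/2; only then is
      n taken so large that \<open>\<eta> n / \<delta> ^ 3\<close> is small.\<close>
    define \<delta> where "\<delta> = \<epsilon> / (4 * (1 + \<bar>b t\<bar>))"
    have \<delta>: "\<delta> > 0" using \<epsilon> by (simp add: \<delta>_def)
    have "\<delta> * (2 * (1 + b t)) \<le> \<delta> * (2 * (1 + \<bar>b t\<bar>))" using \<delta> by (intro mult_left_mono) auto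
    also have "\<dots> = \<epsilon> / 2" unfolding \<delta>_def by (simp add: field_simps)
    finally have 1: "\<delta> * (2 * (1 + b t)) \<le> \<epsilon> / 2" .
    have "\<epsilon> / 2 * \<delta> ^ 3 > 0" using \<epsilon> \<delta> by simp
    from order_tendstoD(2)[OF \<eta> this] obtain N where N: "\<And>n. n \<ge> N \<Longrightarrow> \<eta> n < \<epsilon> / 2 * \<delta> ^ 3"
      by (auto simp: eventually_sequentially)
    have "(\<integral>\<^sup>+x. ennreal (V t x * sqrt (norm (\<theta> n t x - \<theta> k t x))) \<partial>M) \<le> ennreal \<epsilon>" if "n \<ge> N" "k \<ge> n" for n k
    proof -
      have "\<eta> n / \<delta> ^ 3 \<le> \<epsilon> / 2" using N[OF that(1)] \<delta> by (simp add: pos_divide_le_eq)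
      then have "ennreal (\<eta> n / \<delta> ^ 3 + \<delta> * (2 * (1 + b t))) \<le> ennreal \<epsilon>" using 1 by (intro ennreal_leI) linarith
      with est[OF \<delta> that(2) t] show ?thesis by (rule order_trans)
    qed
    then show ?thesis by blast
  qed
  have "\<exists>N. \<forall>t\<in>I. \<forall>n\<ge>N. \<forall>k\<ge>n. (\<integral>\<^sup>+x. ennreal (V t x * sqrt (norm (\<theta> n t x - \<theta> k t x))) \<partial>M) \<le> ennreal \<epsilon>"
    if \<epsilon>: "\<epsilon> > 0" for \<epsilon>
  proof -
    obtain N where N: "\<And>t. t \<in> I \<Longrightarrow> \<forall>n\<ge>N t. \<forall>k\<ge>n. (\<integral>\<^sup>+x. ennreal (V t x * sqrt (norm (\<theta> n t x - \<theta> k t x))) \<partial>M) \<le> ennreal \<epsilon>"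
      using cauchy[OF \<epsilon>] by metis
    have "N t \<le> (\<Sum>t\<in>I. N t)" if "t \<in> I" for t by (rule member_le_sum[OF that _ I]) simp
    then show ?thesis using N by (intro exI[of _ "\<Sum>t\<in>I. N t"]) (meson order_trans)
  qed
  then have "\<forall>j. \<exists>N. \<forall>t\<in>I. \<forall>n\<ge>N. \<forall>k\<ge>n. (\<integral>\<^sup>+x. ennreal (V t x * sqrt (norm (\<theta> n t x - \<theta> k t x))) \<partial>M) \<le> ennreal ((1/2)^j)"
    by simp
  then obtain N where N: "\<And>j t n k. t \<in> I \<Longrightarrow> n \<ge> N j \<Longrightarrow> k \<ge> n \<Longrightarrow> (\<integral>\<^sup>+x. ennreal (V t x * sqrt (norm (\<theta> n t x - \<theta> k t x))) \<partial>M) \<le> ennreal ((1/2)^j)"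
    by metis
  \<comment> \<open>At least \<open>N j\<close> for the rate, nondecreasing for comparing
    neighbours, and at least j so that the j-th selected strategy still lies in
    \<open>C j\<close>.\<close>
  define r where "r j = j + (\<Sum>i\<le>j. N i)" for j
  have rN: "N j \<le> r j" for j unfolding r_def by (rule trans_le_add2) (rule member_le_sum, auto)
  have rj: "j \<le> r j" for j by (simp add: r_def)
  have rS: "r j \<le> r (Suc j)" for j by (simp add: r_def)
  have conv: "AE x in M. Cauchy (\<lambda>n. \<theta> (r n) t x)" if t: "t \<in> I" for t
  proof -
    define f where "f j x = V t x * sqrt (norm (\<theta> (r j) t x - \<theta> (r (Suc j)) t x))" for j x
    have fm[measurable]: "f j \<in> borel_measurable M" for j unfolding f_def using sm[OF t] .
    have "(\<integral>\<^sup>+x. (\<Sum>j. ennreal (f j x)) \<partial>M) = (\<Sum>j. \<integral>\<^sup>+x. ennreal (f j x) \<partial>M)"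
      by (rule nn_integral_suminf) measurable
    also have "\<dots> \<le> (\<Sum>j. ennreal ((1/2)^j))"
      by (rule suminf_le) (auto simp: f_def intro!: N[OF t rN rS] summableI)
    also have "\<dots> < \<infinity>"
      by (subst suminf_ennreal2) (auto simp: summable_geometric)
    finally have "(\<integral>\<^sup>+x. (\<Sum>j. ennreal (f j x)) \<partial>M) \<noteq> \<infinity>" by simp
    then have "AE x in M. (\<Sum>j. ennreal (f j x)) \<noteq> \<infinity>" by (intro nn_integral_PInf_AE) measurable
    with weight_AE[OF V[OF t]] show ?thesis
    proof eventually_elim
      case (elim x)
      let ?d = "\<lambda>j. norm (\<theta> (r (Suc j)) t x - \<theta> (r j) t x)"
      have "summable (\<lambda>j. f j x)"
        by (rule summable_suminf_not_top) (use elim in \<open>auto simp: f_def\<close>)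
      then have "summable (\<lambda>j. 1 / V t x * f j x)" by (rule summable_mult)
      then have s: "summable (\<lambda>j. sqrt (?d j))" using elim by (simp add: f_def norm_minus_commute)
      then have "(\<lambda>j. sqrt (?d j)) \<longlonglongrightarrow> 0" by (rule summable_LIMSEQ_zero)
      from order_tendstoD(2)[OF this, of 1] obtain J where J: "\<And>j. j \<ge> J \<Longrightarrow> sqrt (?d j) < 1"
        by (auto simp: eventually_sequentially)
      \<comment> \<open>Once the root is below 1 the distance is at most its root, so summability
        passes from the roots to the distances.\<close>
      have "summable ?d"
      proof (rule summable_comparison_test'[OF s, of J])
        fix j assume "j \<ge> J"
        from J[OF this] have "sqrt (?d j) \<le> 1" by simp
        then have "sqrt (?d j) * sqrt (?d j) \<le> 1 * sqrt (?d j)" by (intro mult_right_mono) auto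
        then show "norm (?d j) \<le> sqrt (?d j)" by simp
      qed
      then have "summable (\<lambda>j. \<theta> (r (Suc j)) t x - \<theta> (r j) t x)" by (rule summable_norm_cancel)
      then have "convergent (\<lambda>n. \<Sum>j<n. \<theta> (r (Suc j)) t x - \<theta> (r j) t x)" by (simp add: summable_iff_convergent)
      then have "convergent (\<lambda>n. (\<theta> (r n) t x - \<theta> (r 0) t x) + \<theta> (r 0) t x)"
        unfolding sum_lessThan_telescope[of "\<lambda>j. \<theta> (r j) t x"] by (intro convergent_add convergent_const)
      then show ?case by (simp add: Cauchy_convergent_iff)
    qed
  qed
  show ?thesis using \<theta>(1) dec[OF rj] conv by (intro exI[of _ "\<lambda>n. \<theta> (r n)"]) blast
qed

section \<open>Existence of an optimal strategy\<close>

definition Dvalued :: "'a measure \<Rightarrow> (nat \<Rightarrow> 'a measure) \<Rightarrow> nat \<Rightarrow> (nat \<Rightarrow> 'a \<Rightarrow> 'd::euclidean_space) \<Rightarrow> (nat \<Rightarrow> 'a \<Rightarrow> 'd) \<Rightarrow> bool" where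
  "Dvalued M Fl T S \<phi> \<longleftrightarrow> \<phi> \<in> strategies Fl T \<and> (\<forall>t\<in>{1..T}. AE \<omega> in M. \<phi> t \<omega> \<in> Dset M Fl S t \<omega>)"

text \<open>Literally the body of assumption \<open>iii\<close> for one market and one date, so that
  unfolding converts one into the other.\<close>

definition loss_bound :: "'a measure \<Rightarrow> (nat \<Rightarrow> 'a measure) \<Rightarrow> nat \<Rightarrow> (nat \<Rightarrow> 'a \<Rightarrow> 'd::euclidean_space) \<Rightarrow> nat
    \<Rightarrow> ('a \<Rightarrow> real) \<Rightarrow> ('a \<Rightarrow> real) \<Rightarrow> bool" where
  "loss_bound M Fl T S t \<beta> \<kappa> \<longleftrightarrow>
        \<beta> \<in> borel_measurable (Fl (t - 1)) \<and> \<kappa> \<in> borel_measurable (Fl (t - 1)) \<and>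
        (AE \<omega> in M. \<beta> \<omega> > 0) \<and> (AE \<omega> in M. \<kappa> \<omega> > 0) \<and>
        (\<forall>\<xi>. \<xi> \<in> borel_measurable (Fl (t - 1)) \<and> (AE \<omega> in M. \<xi> \<omega> \<in> Dset M Fl S t \<omega>) \<longrightarrow>
           (AE \<omega> in M. Dset M Fl S t \<omega> \<noteq> {0} \<longrightarrow>
              real_cond_exp M (Fl (t - 1))
                (indicator {\<omega>'\<in>space M. \<xi> \<omega>' \<bullet> incr S t \<omega>' \<le> - \<beta> \<omega>' * norm (\<xi> \<omega>')}) \<omega>
              \<ge> \<kappa> \<omega>)) \<and>
        (\<lambda>\<omega>. 1 / \<beta> \<omega>) \<in> Wclass M Fl T \<and> (\<lambda>\<omega>. 1 / \<kappa> \<omega>) \<in> Wclass M Fl T \<and>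
        (\<lambda>\<omega>. norm (incr S t \<omega>)) \<in> Wclass M Fl T"

context filtered_prob_space
begin

text \<open>Capping \<beta> at 1 only enlarges the loss event, and capping \<kappa> only weakens the
  bound. Where \<open>Dset\<close> is {0} the assumption is silent, but there \<phi> vanishes, and
  {\<phi> = 0} is an event known at t - 1 and contained in the loss event.\<close>

lemma losing_market_exists:
  fixes S :: "nat \<Rightarrow> 'a \<Rightarrow> 'd::euclidean_space"
  assumes ad: "adapted Fl T S" and q: "\<forall>t\<in>{1..T}. \<exists>\<beta> \<kappa>. loss_bound M Fl T S t \<beta> \<kappa>"
  shows "\<exists>\<beta> k. losing_market M Fl T S \<beta> k \<and> (\<forall>\<phi>. Dvalued M Fl T S \<phi> \<longrightarrow> losing_market.good M Fl T S \<beta> k \<phi>)"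
proof -
  obtain \<beta> where "\<forall>t\<in>{1..T}. \<exists>\<kappa>. loss_bound M Fl T S t (\<beta> t) \<kappa>" using bchoice[OF q] by (elim exE)
  from bchoice[OF this] obtain \<kappa> where lb: "\<forall>t\<in>{1..T}. loss_bound M Fl T S t (\<beta> t) (\<kappa> t)" by (elim exE)
  have bk: "\<beta> t \<in> borel_measurable (Fl (t - 1))" "\<kappa> t \<in> borel_measurable (Fl (t - 1))"
        "AE \<omega> in M. \<beta> t \<omega> > 0" "AE \<omega> in M. \<kappa> t \<omega> > 0"
        "\<And>p. p > 0 \<Longrightarrow> integrable M (\<lambda>\<omega>. \<bar>1 / \<beta> t \<omega>\<bar> powr p)" "\<And>p. p > 0 \<Longrightarrow> integrable M (\<lambda>\<omega>. \<bar>1 / \<kappa> t \<omega>\<bar> powr p)"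
        "\<And>p. p > 0 \<Longrightarrow> integrable M (\<lambda>\<omega>. \<bar>norm (incr S t \<omega>)\<bar> powr p)" if "t \<in> {1..T}" for t
    using bspec[OF lb that] unfolding loss_bound_def Wclass_def by auto
  have bk_loss: "AE \<omega> in M. Dset M Fl S t \<omega> \<noteq> {0} \<longrightarrow> \<kappa> t \<omega> \<le> real_cond_exp M (Fl (t - 1))
        (indicator {\<omega>'\<in>space M. \<xi> \<omega>' \<bullet> incr S t \<omega>' \<le> - \<beta> t \<omega>' * norm (\<xi> \<omega>')}) \<omega>"
    if "t \<in> {1..T}" "\<xi> \<in> borel_measurable (Fl (t - 1))" "AE \<omega> in M. \<xi> \<omega> \<in> Dset M Fl S t \<omega>" for t \<xi>
    using bspec[OF lb that(1)] that(2,3) unfolding loss_bound_def by blast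
  define b where "b t \<omega> = min 1 (\<beta> t \<omega>)" for t \<omega>
  define k where "k t \<omega> = min 1 (\<kappa> t \<omega>)" for t \<omega>
  have LM: "losing_market M Fl T S b k"
  proof (unfold_locales)
    fix t assume t: "t \<in> {1..T}"
    have t1: "t - 1 \<le> T" "t \<le> T" using t by auto
    note [measurable] = bk(1,2)[OF t]
    show "b t \<in> borel_measurable (Fl (t - 1))" "k t \<in> borel_measurable (Fl (t - 1))"
      unfolding b_def[abs_def] k_def[abs_def] by measurable
    show "weight M (b t)" unfolding b_def[abs_def]
      by (rule weight_min_one[OF meas_M[OF t1(1) bk(1)[OF t]] bk(3)[OF t] bk(5)[OF t]])
    show "weight M (k t)" unfolding k_def[abs_def]
      by (rule weight_min_one[OF meas_M[OF t1(1) bk(2)[OF t]] bk(4)[OF t] bk(6)[OF t]])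
    have "(\<lambda>\<omega>. norm (incr S t \<omega>)) \<in> borel_measurable M"
      by (rule measurable_compose[OF meas_M[OF t1(2) incr_meas[OF ad t]] borel_measurable_norm])
    then show "weight M (\<lambda>\<omega>. 1 / (1 + norm (incr S t \<omega>)))"
      by (rule weight_inverse_one_plus[OF _ norm_ge_zero bk(7)[OF t]])
  qed (rule ad)
  then interpret L: losing_market M Fl T S b k 0 .
  have "L.good \<phi>" if D: "Dvalued M Fl T S \<phi>" for \<phi>
    unfolding L.good_def
  proof (intro conjI ballI)
    show \<phi>: "\<phi> \<in> strategies Fl T" using D by (simp add: Dvalued_def)
    fix t assume t: "t \<in> {1..T}"
    have t1: "t - 1 \<le> T" "t \<le> T" using t by auto
    let ?F = "Fl (t - 1)"
    interpret fs: finite_measure_subalgebra M ?F by (rule fmsub[OF t1(1)])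
    let ?A = "{\<omega>'\<in>space M. \<phi> t \<omega>' \<bullet> incr S t \<omega>' \<le> - \<beta> t \<omega>' * norm (\<phi> t \<omega>')}"
    have pm: "\<phi> t \<in> borel_measurable ?F" using \<phi> t by (simp add: strategies_def)
    have [measurable]: "\<phi> t \<in> borel_measurable M" "incr S t \<in> borel_measurable M" "\<beta> t \<in> borel_measurable M" "b t \<in> borel_measurable M"
      by (rule meas_M[OF t1(1) pm] meas_M[OF t1(2) incr_meas[OF ad t]] meas_M[OF t1(1) bk(1)[OF t]]
        meas_M[OF t1(1) L.\<beta>_meas[OF t]])+
    have A[measurable]: "?A \<in> sets M" by measurable
    have B[measurable]: "L.loss \<phi> t \<in> sets M" unfolding L.loss_def by measurable
    define Z0 where "Z0 = {\<omega>\<in>space M. \<phi> t \<omega> = 0}"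
    have spF: "space M = space ?F" using subalg[OF t1(1)] by (simp add: subalgebra_def)
    have "\<phi> t -` {0} \<inter> space ?F \<in> sets ?F" by (rule measurable_sets[OF pm]) simp
    moreover have "\<phi> t -` {0} \<inter> space ?F = Z0" unfolding Z0_def spF by blast
    ultimately have OF: "Z0 \<in> sets ?F" by simp

    have OM[measurable]: "Z0 \<in> sets M" using OF subalg[OF t1(1)] by (auto simp: subalgebra_def)
    have 1: "AE \<omega> in M. Dset M Fl S t \<omega> \<noteq> {0} \<longrightarrow> \<kappa> t \<omega> \<le> real_cond_exp M ?F (indicator ?A) \<omega>"
      by (rule bk_loss[OF t pm]) (use D t in \<open>simp add: Dvalued_def\<close>)
    have 2: "AE \<omega> in M. real_cond_exp M ?F (indicator ?A) \<omega> \<le> real_cond_exp M ?F (indicator (L.loss \<phi> t)) \<omega>"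
    proof (rule fs.real_cond_exp_mono)
      have "- \<beta> t \<omega> * norm (\<phi> t \<omega>) \<le> - b t \<omega> * norm (\<phi> t \<omega>)" for \<omega>
        by (intro mult_right_mono) (auto simp: b_def)
      then have "?A \<subseteq> L.loss \<phi> t" unfolding L.loss_def using order_trans by blast
      then show "AE \<omega> in M. indicat_real ?A \<omega> \<le> indicator (L.loss \<phi> t) \<omega>"
        by (intro AE_I2) (auto simp: indicator_def)
    qed (auto simp: emeasure_eq_measure)
    have 3: "AE \<omega> in M. real_cond_exp M ?F (indicator Z0) \<omega> \<le> real_cond_exp M ?F (indicator (L.loss \<phi> t)) \<omega>"
    proof (rule fs.real_cond_exp_mono)
      have "Z0 \<subseteq> L.loss \<phi> t" by (auto simp: L.loss_def Z0_def)
      then show "AE \<omega> in M. indicat_real Z0 \<omega> \<le> indicator (L.loss \<phi> t) \<omega>"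
        by (intro AE_I2) (auto simp: indicator_def)
    qed (auto simp: emeasure_eq_measure)
    have 4: "AE \<omega> in M. real_cond_exp M ?F (indicator Z0) \<omega> = indicator Z0 \<omega>"
      by (rule fs.real_cond_exp_F_meas) (use OF in \<open>auto simp: emeasure_eq_measure\<close>)
    have 5: "AE \<omega> in M. \<phi> t \<omega> \<in> Dset M Fl S t \<omega>" using D t by (simp add: Dvalued_def)
    show "AE \<omega> in M. k t \<omega> \<le> real_cond_exp M ?F (indicator (L.loss \<phi> t)) \<omega>"
      using 1 2 3 4 5 AE_space
    proof eventually_elim
      case (elim \<omega>)
      show ?case
      proof (cases "Dset M Fl S t \<omega> = {0}")
        case True
        then have "\<omega> \<in> Z0" using elim by (simp add: Z0_def)
        then show ?thesis using elim by (simp add: k_def)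
      next
        case False
        then show ?thesis using elim by (auto simp: k_def)
      qed
    qed
  qed
  with LM show ?thesis by blast
qed

definition controlled where
  "controlled U w0 S c R V b Vs bs \<phi> \<longleftrightarrow>
     integrable M (\<lambda>\<omega>. U (wealth S T w0 \<phi> \<omega>)) \<and> c \<le> (\<integral>\<omega>. U (wealth S T w0 \<phi> \<omega>) \<partial>M) \<and>
     (\<integral>\<omega>. U (wealth S T w0 \<phi> \<omega>) \<partial>M) \<le> R \<and>
     integrable M (\<lambda>\<omega>. V \<omega> * max 0 (wealth S T w0 \<phi> \<omega>)) \<and> (\<integral>\<omega>. V \<omega> * max 0 (wealth S T w0 \<phi> \<omega>) \<partial>M) \<le> b \<and>
     (\<forall>t\<in>{1..T}. integrable M (\<lambda>\<omega>. Vs t \<omega> * norm (\<phi> t \<omega>)) \<and> (\<integral>\<omega>. Vs t \<omega> * norm (\<phi> t \<omega>) \<partial>M) \<le> bs t)"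

text \<open>\<open>R\<close> is chosen before c, so that c = R can be used to cap all expected
  utilities. A lower bound c on expected utility confines the expected terminal loss, which makes
  the relative bounds of \<open>dominated\<close> absolute.\<close>

lemma market_estimates:
  fixes S :: "nat \<Rightarrow> 'a \<Rightarrow> 'd::euclidean_space"
  assumes ad: "adapted Fl T S" and q: "\<forall>t\<in>{1..T}. \<exists>\<beta> \<kappa>. loss_bound M Fl T S t \<beta> \<kappa>"
    and G: "weighted_growth U \<kappa> N" and \<kappa>: "\<kappa> > 0" and U: "U \<in> borel_measurable borel"
  shows "\<exists>R. \<forall>c. \<exists>V b Vs bs. weight M V \<and> (\<forall>t\<in>{1..T}. weight M (Vs t)) \<and>
     (\<forall>\<phi>. Dvalued M Fl T S \<phi> \<longrightarrow> ereal c \<le> ext_expect M (\<lambda>\<omega>. U (wealth S T w0 \<phi> \<omega>)) \<longrightarrow>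
       controlled U w0 S c R V b Vs bs \<phi>)"
proof -
  obtain \<beta> k where LM: "losing_market M Fl T S \<beta> k" and good: "\<And>\<phi>. Dvalued M Fl T S \<phi> \<Longrightarrow> losing_market.good M Fl T S \<beta> k \<phi>"
    using losing_market_exists[OF ad q] by blast
  interpret L: losing_market M Fl T S \<beta> k w0 by (rule LM)
  obtain R where R: "\<And>\<phi>. L.good \<phi> \<Longrightarrow> ext_expect M (\<lambda>\<omega>. U (wealth S T w0 \<phi> \<omega>)) \<noteq> -\<infinity> \<Longrightarrow>
     integrable M (\<lambda>\<omega>. max 0 (- wealth S T w0 \<phi> \<omega>)) \<and> integrable M (\<lambda>\<omega>. U (wealth S T w0 \<phi> \<omega>)) \<and>
     (\<integral>\<omega>. U (wealth S T w0 \<phi> \<omega>) \<partial>M) \<le> R - \<kappa> / 2 * (\<integral>\<omega>. max 0 (- wealth S T w0 \<phi> \<omega>) \<partial>M)"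
    using L.utility_apriori[OF G \<kappa> U] by blast
  obtain V B where V: "weight M V" "L.dominated V (\<lambda>\<phi> \<omega>. max 0 (wealth S T w0 \<phi> \<omega>)) B"
    using L.pos_part_bound[of T] by blast
  have "\<forall>t\<in>{1..T}. \<exists>V B. weight M V \<and> L.dominated V (\<lambda>\<phi> \<omega>. norm (\<phi> t \<omega>)) B"
    using L.strategy_bound by blast
  then obtain Vs Bs where Vs: "\<And>t. t \<in> {1..T} \<Longrightarrow> weight M (Vs t) \<and> L.dominated (Vs t) (\<lambda>\<phi> \<omega>. norm (\<phi> t \<omega>)) (Bs t)"
    by metis
  show ?thesis
  proof (intro exI[of _ R] allI)
    fix c
    \<comment> \<open>Solves c \<le> R - (\<kappa>/2) x for the expected loss x, which is therefore
      at most \<open>y\<close> whenever expected utility is at least c.\<close>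
    define y where "y = 2 * (R - c) / \<kappa>"
    have ctl: "controlled U w0 S c R V (\<bar>B\<bar> * (1 + y)) Vs (\<lambda>t. \<bar>Bs t\<bar> * (1 + y)) \<phi>"
      if D: "Dvalued M Fl T S \<phi>" and e: "ereal c \<le> ext_expect M (\<lambda>\<omega>. U (wealth S T w0 \<phi> \<omega>))" for \<phi>
    proof -
      note g = good[OF D]
      have "ext_expect M (\<lambda>\<omega>. U (wealth S T w0 \<phi> \<omega>)) \<noteq> -\<infinity>" using e by auto
      note R' = R[OF g this]
      define x where "x = (\<integral>\<omega>. max 0 (- wealth S T w0 \<phi> \<omega>) \<partial>M)"
      have x0: "0 \<le> x" unfolding x_def by (rule Bochner_Integration.integral_nonneg) simp
      have i: "integrable M (\<lambda>\<omega>. max 0 (- wealth S T w0 \<phi> \<omega>))" "integrable M (\<lambda>\<omega>. U (wealth S T w0 \<phi> \<omega>))"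
        "(\<integral>\<omega>. U (wealth S T w0 \<phi> \<omega>) \<partial>M) \<le> R - \<kappa> / 2 * x" using R' by (auto simp: x_def)
      have c: "c \<le> (\<integral>\<omega>. U (wealth S T w0 \<phi> \<omega>) \<partial>M)" using e by (simp add: ext_expect_integrable[OF i(2)])
      have xy: "x \<le> y" using i(3) c \<kappa> by (simp add: y_def field_simps)
      have up: "z \<le> \<bar>A\<bar> * (1 + y)" if "z \<le> A * (1 + x)" for z A :: real
      proof -
        have "A * (1 + x) \<le> \<bar>A\<bar> * (1 + x)" using x0 by (intro mult_right_mono) auto
        also have "\<dots> \<le> \<bar>A\<bar> * (1 + y)" using xy by (intro mult_left_mono) auto
        finally show ?thesis using that by linarith
      qed
      have 1: "integrable M (\<lambda>\<omega>. V \<omega> * max 0 (wealth S T w0 \<phi> \<omega>))" "(\<integral>\<omega>. V \<omega> * max 0 (wealth S T w0 \<phi> \<omega>) \<partial>M) \<le> B * (1 + x)"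
        using V(2) g i(1) by (auto simp: L.dominated_def x_def)
      have 2: "integrable M (\<lambda>\<omega>. Vs t \<omega> * norm (\<phi> t \<omega>))" "(\<integral>\<omega>. Vs t \<omega> * norm (\<phi> t \<omega>) \<partial>M) \<le> Bs t * (1 + x)" if t: "t \<in> {1..T}" for t
        using Vs[OF t] g i(1) by (auto simp: L.dominated_def x_def)
      have R0: "(\<integral>\<omega>. U (wealth S T w0 \<phi> \<omega>) \<partial>M) \<le> R" using i(3) mult_nonneg_nonneg[of "\<kappa>/2" x] \<kappa> x0 by linarith
      show ?thesis unfolding controlled_def
        by (intro conjI ballI i(2) c R0 1(1) up[OF 1(2)] 2(1) up[OF 2(2)])
    qed
    show "\<exists>V b Vs bs. weight M V \<and> (\<forall>t\<in>{1..T}. weight M (Vs t)) \<and>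
     (\<forall>\<phi>. Dvalued M Fl T S \<phi> \<longrightarrow> ereal c \<le> ext_expect M (\<lambda>\<omega>. U (wealth S T w0 \<phi> \<omega>)) \<longrightarrow>
       controlled U w0 S c R V b Vs bs \<phi>)"
      by (intro exI[of _ V] exI[of _ "\<bar>B\<bar> * (1 + y)"] exI[of _ Vs] exI[of _ "\<lambda>t. \<bar>Bs t\<bar> * (1 + y)"]
        conjI ballI allI impI V(1) ctl Vs[THEN conjunct1])
  qed
qed

text \<open>The part removed is orthogonal to the span of \<open>S0\<close>, and maximality of
  \<open>S0\<close> puts the increments of every market into that span. One projection thus serves
  all markets at once.\<close>

lemma Dvalued_projection:
  fixes SS :: "(nat \<Rightarrow> 'a \<Rightarrow> 'd::euclidean_space) set"
  assumes SS: "SS = S_star M Fl T SS" and ad: "\<And>S. S \<in> SS \<Longrightarrow> adapted Fl T S" and S0: "S0 \<in> SS"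
    and \<phi>: "\<phi> \<in> strategies Fl T"
  shows "\<exists>\<psi>. Dvalued M Fl T S0 \<psi> \<and> (\<forall>S\<in>SS. AE \<omega> in M. wealth S T w \<psi> \<omega> = wealth S T w \<phi> \<omega>)"
proof -
  have NA: "NA M Fl T S0" using S0 SS by (auto simp: S_star_def)
  have sub: "AE \<omega> in M. Dset M Fl S t \<omega> \<subseteq> Dset M Fl S0 t \<omega>" if "S \<in> SS" "t \<in> {1..T}" for S t
    using S0 SS that unfolding S_star_def by blast
  have "\<forall>t\<in>{1..T}. \<exists>\<xi>. \<xi> \<in> borel_measurable (Fl (t - 1)) \<and> (AE \<omega> in M. \<xi> \<omega> \<in> Dset M Fl S0 t \<omega> \<and>
     (\<forall>y\<in>Dset M Fl S0 t \<omega>. (\<phi> t \<omega> - \<xi> \<omega>) \<bullet> y = 0))"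
  proof
    fix t assume t: "t \<in> {1..T}"
    have "\<phi> t \<in> borel_measurable (Fl (t - 1))" using \<phi> t by (simp add: strategies_def)
    from Dset_projection[OF ad[OF S0] t NA this]
    show "\<exists>\<xi>. \<xi> \<in> borel_measurable (Fl (t - 1)) \<and> (AE \<omega> in M. \<xi> \<omega> \<in> Dset M Fl S0 t \<omega> \<and>
     (\<forall>y\<in>Dset M Fl S0 t \<omega>. (\<phi> t \<omega> - \<xi> \<omega>) \<bullet> y = 0))" unfolding Bex_def .
  qed
  from bchoice[OF this] obtain \<psi> where \<psi>: "\<forall>t\<in>{1..T}. \<psi> t \<in> borel_measurable (Fl (t - 1)) \<and> (AE \<omega> in M. \<psi> t \<omega> \<in> Dset M Fl S0 t \<omega> \<and>
     (\<forall>y\<in>Dset M Fl S0 t \<omega>. (\<phi> t \<omega> - \<psi> t \<omega>) \<bullet> y = 0))" by (elim exE)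
  have D: "Dvalued M Fl T S0 \<psi>" unfolding Dvalued_def strategies_def
  proof (intro conjI ballI CollectI)
    fix t assume t: "t \<in> {1..T}"
    show "\<psi> t \<in> borel_measurable (Fl (t - 1))" using \<psi> t by blast
    have "AE \<omega> in M. \<psi> t \<omega> \<in> Dset M Fl S0 t \<omega> \<and> (\<forall>y\<in>Dset M Fl S0 t \<omega>. (\<phi> t \<omega> - \<psi> t \<omega>) \<bullet> y = 0)"
      using \<psi> t by blast
    then show "AE \<omega> in M. \<psi> t \<omega> \<in> Dset M Fl S0 t \<omega>" by eventually_elim (rule conjunct1)
  qed
  have "AE \<omega> in M. wealth S T w \<psi> \<omega> = wealth S T w \<phi> \<omega>" if S: "S \<in> SS" for S
  proof -
    have "AE \<omega> in M. \<psi> t \<omega> \<bullet> incr S t \<omega> = \<phi> t \<omega> \<bullet> incr S t \<omega>" if t: "t \<in> {1..T}" for t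
    proof -
      have "AE \<omega> in M. \<psi> t \<omega> \<in> Dset M Fl S0 t \<omega> \<and> (\<forall>y\<in>Dset M Fl S0 t \<omega>. (\<phi> t \<omega> - \<psi> t \<omega>) \<bullet> y = 0)"
        using \<psi> t by blast
      with sub[OF S t] AE_incr_Dset[OF ad[OF S] t] show ?thesis
      proof eventually_elim
        case (elim \<omega>)
        then have "(\<phi> t \<omega> - \<psi> t \<omega>) \<bullet> incr S t \<omega> = 0" by blast
        then show ?case by (simp add: inner_diff_left)
      qed
    qed
    then have "AE \<omega> in M. \<forall>t\<in>{1..T}. \<psi> t \<omega> \<bullet> incr S t \<omega> = \<phi> t \<omega> \<bullet> incr S t \<omega>"
      by (intro AE_finite_allI) auto
    then show ?thesis by eventually_elim (simp add: wealth_def)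
  qed
  with D show ?thesis by blast
qed

text \<open>As \<open>SS\<close> is its own \<open>S_star\<close>, S is maximal too, which gives the
  inclusion of spans opposite to the one used for projecting.\<close>

lemma Dvalued_transfer:
  assumes SS: "SS = S_star M Fl T SS" and S: "S0 \<in> SS" "S \<in> SS" and D: "Dvalued M Fl T S0 \<phi>"
  shows "Dvalued M Fl T S \<phi>"
  unfolding Dvalued_def
proof (intro conjI ballI)
  show "\<phi> \<in> strategies Fl T" using D by (simp add: Dvalued_def)
  fix t assume t: "t \<in> {1..T}"
  have "AE \<omega> in M. Dset M Fl S0 t \<omega> \<subseteq> Dset M Fl S t \<omega>" using S SS t unfolding S_star_def by blast
  moreover have "AE \<omega> in M. \<phi> t \<omega> \<in> Dset M Fl S0 t \<omega>" using D t by (simp add: Dvalued_def)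
  ultimately show "AE \<omega> in M. \<phi> t \<omega> \<in> Dset M Fl S t \<omega>" by eventually_elim (rule subsetD)
qed

lemma Dvalued_mid:
  assumes "Dvalued M Fl T S \<phi>" "Dvalued M Fl T S \<psi>"
  shows "Dvalued M Fl T S (mid \<phi> \<psi>)"
  unfolding Dvalued_def strategies_def
proof (intro conjI ballI CollectI)
  fix t assume t: "t \<in> {1..T}"
  have [measurable]: "\<phi> t \<in> borel_measurable (Fl (t - 1))" "\<psi> t \<in> borel_measurable (Fl (t - 1))"
    using assms t by (auto simp: Dvalued_def strategies_def)
  show "mid \<phi> \<psi> t \<in> borel_measurable (Fl (t - 1))" unfolding mid_def[abs_def] by measurable
  have "AE \<omega> in M. \<phi> t \<omega> \<in> Dset M Fl S t \<omega>" "AE \<omega> in M. \<psi> t \<omega> \<in> Dset M Fl S t \<omega>" using assms t by (auto simp: Dvalued_def)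
  then show "AE \<omega> in M. mid \<phi> \<psi> t \<omega> \<in> Dset M Fl S t \<omega>"
  proof eventually_elim
    case (elim \<omega>)
    have "(1/2) *\<^sub>R \<phi> t \<omega> + (1/2) *\<^sub>R \<psi> t \<omega> \<in> Dset M Fl S t \<omega>"
      using elim unfolding Dset_def by (intro mem_affine) auto
    then show ?case by (simp add: mid_def scaleR_add_right)
  qed
qed

lemma wealth_mid: "wealth S T w (mid \<phi> \<psi>) \<omega> = (wealth S T w \<phi> \<omega> + wealth S T w \<psi> \<omega>) / 2"
proof -
  have "(\<Sum>s\<in>{1..T}. mid \<phi> \<psi> s \<omega> \<bullet> incr S s \<omega>) = (\<Sum>s\<in>{1..T}. (\<phi> s \<omega> \<bullet> incr S s \<omega> + \<psi> s \<omega> \<bullet> incr S s \<omega>) / 2)"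
    by (rule sum.cong) (auto simp: mid_def inner_add_left)
  then show ?thesis by (simp add: wealth_def sum_divide_distrib[symmetric] sum.distrib field_simps)
qed

end

theorem theorem3p5:
  fixes M :: "'a measure" and Fl :: "nat \<Rightarrow> 'a measure" and T :: nat
    and SS :: "(nat \<Rightarrow> 'a \<Rightarrow> 'd::euclidean_space) set"
    and U :: "real \<Rightarrow> real" and w0 :: real
  assumes fps: "filtered_ps M Fl T" and T_pos: "T \<ge> 1"
    and SS_ne: "SS \<noteq> {}" and SS_adapted: "\<forall>S\<in>SS. adapted Fl T S"
    and U_mono: "mono U" and U_concave: "concave_on UNIV U" and U_usc: "usc U"
    and i: "SS = S_star M Fl T SS"
    and ii: "\<exists>C>0. \<exists>\<alpha>. 0 \<le> \<alpha> \<and> \<alpha> < 1 \<and> (\<forall>x\<ge>0. U x \<le> C * (rpow x \<alpha> + 1))"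
    and iii: "\<forall>S\<in>SS. \<forall>t\<in>{1..T}. \<exists>\<beta> \<kappa>.
        \<beta> \<in> borel_measurable (Fl (t - 1)) \<and> \<kappa> \<in> borel_measurable (Fl (t - 1)) \<and>
        (AE \<omega> in M. \<beta> \<omega> > 0) \<and> (AE \<omega> in M. \<kappa> \<omega> > 0) \<and>
        (\<forall>\<xi>. \<xi> \<in> borel_measurable (Fl (t - 1)) \<and> (AE \<omega> in M. \<xi> \<omega> \<in> Dset M Fl S t \<omega>) \<longrightarrow>
           (AE \<omega> in M. Dset M Fl S t \<omega> \<noteq> {0} \<longrightarrow>
              real_cond_exp M (Fl (t - 1))
                (indicator {\<omega>'\<in>space M. \<xi> \<omega>' \<bullet> incr S t \<omega>' \<le> - \<beta> \<omega>' * norm (\<xi> \<omega>')}) \<omega>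
              \<ge> \<kappa> \<omega>)) \<and>
        (\<lambda>\<omega>. 1 / \<beta> \<omega>) \<in> Wclass M Fl T \<and> (\<lambda>\<omega>. 1 / \<kappa> \<omega>) \<in> Wclass M Fl T \<and>
        (\<lambda>\<omega>. norm (incr S t \<omega>)) \<in> Wclass M Fl T"
  shows "\<exists>\<phi>\<in>strategies Fl T.
           value_fn M Fl T SS U w0 = (INF S\<in>SS. ext_expect M (\<lambda>\<omega>. U (wealth S T w0 \<phi> \<omega>)))
         \<and> (INF S\<in>SS. ext_expect M (\<lambda>\<omega>. U (wealth S T w0 \<phi> \<omega>))) < \<infinity>"
proof -
  interpret filtered_prob_space M Fl T by (unfold_locales) (rule fps)
  let ?e = "\<lambda>S \<phi>. ext_expect M (\<lambda>\<omega>. U (wealth S T w0 \<phi> \<omega>))"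
  let ?J = "\<lambda>\<phi>. INF S\<in>SS. ?e S \<phi>"
  have zero: "(\<lambda>_ _. 0) \<in> strategies Fl T" by (simp add: strategies_def)
  have const: "ext_expect M (\<lambda>_. y) = ereal y" for y by (subst ext_expect_integrable) (auto simp: prob_space)
  have e0: "?e S (\<lambda>_ _. 0) = ereal (U w0)" for S by (simp add: wealth_def const)
  show ?thesis
  proof (cases "\<exists>a b. U a \<noteq> U b")
    \<comment> \<open>A constant utility has no linear decay at minus infinity and is settled
      separately: every strategy is optimal, and 0 is taken.\<close>
    case False
    have Uw: "U x = U w0" for x using False by blast
    have e: "ext_expect M (\<lambda>\<omega>. U (f \<omega>)) = ereal (U w0)" for f
    proof -
      have "(\<lambda>\<omega>. U (f \<omega>)) = (\<lambda>_. U w0)" using Uw by (intro ext)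
      then show ?thesis using const[of "U w0"] by simp
    qed
    have J: "?J \<phi> = ereal (U w0)" for \<phi> unfolding e using SS_ne by simp
    have "strategies Fl T \<noteq> ({} :: (nat \<Rightarrow> 'a \<Rightarrow> 'd) set)" using zero by blast
    then have "value_fn M Fl T SS U w0 = ereal (U w0)" unfolding value_fn_def J by simp
    then show ?thesis using zero by (intro bexI[of _ "\<lambda>_ _. 0"]) (auto simp: J)
  next
    case True
    then obtain a b where nc: "U a \<noteq> U b" by blast
    obtain C \<alpha> where C: "C > 0" "0 \<le> \<alpha>" "\<alpha> < 1" "\<And>x. x \<ge> 0 \<Longrightarrow> U x \<le> C * (rpow x \<alpha> + 1)" using ii by blast
    obtain \<kappa> N where \<kappa>: "\<kappa> > 0" and G: "weighted_growth U \<kappa> N"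
      using utility_weighted_growth[OF U_mono U_concave nc C] by blast
    have U[measurable]: "U \<in> borel_measurable borel" by (rule borel_measurable_mono[OF U_mono])
    \<comment> \<open>A finite concave function on the real line is continuous, which lets limits
      pass inside \<open>U\<close>.\<close>
    have Uc: "continuous_on UNIV U"
      using continuous_on_minus[OF convex_on_continuous[OF open_UNIV U_concave[unfolded concave_on_def]]] by simp
    have ad: "adapted Fl T S" if "S \<in> SS" for S using SS_adapted that by blast
    have q: "\<forall>t\<in>{1..T}. \<exists>\<beta> \<kappa>. loss_bound M Fl T S t \<beta> \<kappa>" if "S \<in> SS" for S
      unfolding loss_bound_def by (rule bspec[OF iii that])
    note est = market_estimates[OF ad q G \<kappa> U, where ?w0.0 = w0]
    have wm: "wealth S T w0 \<phi> \<in> borel_measurable M" if "S \<in> SS" "\<phi> \<in> strategies Fl T" for S \<phi>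
      by (rule meas_M[OF order_refl wealth_meas[OF ad[OF that(1)] that(2)]]) simp
    obtain S0 where S0: "S0 \<in> SS" using SS_ne by blast
    obtain R where R: "\<forall>c. \<exists>V b Vs bs. weight M V \<and> (\<forall>t\<in>{1..T}. weight M (Vs t)) \<and>
       (\<forall>\<phi>. Dvalued M Fl T S0 \<phi> \<longrightarrow> ereal c \<le> ?e S0 \<phi> \<longrightarrow> controlled U w0 S0 c R V b Vs bs \<phi>)"
      using est[OF S0 S0] by (elim exE)
    have proj: "\<exists>\<psi>. Dvalued M Fl T S0 \<psi> \<and> (\<forall>S\<in>SS. ?e S \<psi> = ?e S \<phi>)" if st: "\<phi> \<in> strategies Fl T" for \<phi>
    proof -
      obtain \<psi> where \<psi>: "Dvalued M Fl T S0 \<psi>" "\<forall>S\<in>SS. AE \<omega> in M. wealth S T w0 \<psi> \<omega> = wealth S T w0 \<phi> \<omega>"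
        using Dvalued_projection[OF i ad S0 st] by blast
      have "?e S \<psi> = ?e S \<phi>" if "S \<in> SS" for S
      proof (rule ext_expect_cong_AE)
        have "AE \<omega> in M. wealth S T w0 \<psi> \<omega> = wealth S T w0 \<phi> \<omega>" using \<psi>(2) that by blast
        then show "AE \<omega> in M. U (wealth S T w0 \<psi> \<omega>) = U (wealth S T w0 \<phi> \<omega>)" by eventually_elim simp
      qed
      with \<psi>(1) show ?thesis by blast
    qed
    \<comment> \<open>The estimate is used at level c = R: a value above \<open>R\<close> would be
      controlled, hence at most \<open>R\<close>.\<close>
    have up: "?e S0 \<psi> \<le> ereal R" if D: "Dvalued M Fl T S0 \<psi>" for \<psi>
    proof (rule ccontr)
      assume n: "\<not> ?thesis"
      then have "ereal R \<le> ?e S0 \<psi>" by simp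
      then obtain V b Vs bs where "controlled U w0 S0 R R V b Vs bs \<psi>" using R D by blast
      then have "integrable M (\<lambda>\<omega>. U (wealth S0 T w0 \<psi> \<omega>)) \<and> (\<integral>\<omega>. U (wealth S0 T w0 \<psi> \<omega>) \<partial>M) \<le> R"
        by (simp add: controlled_def)
      then show False using n by (simp add: ext_expect_integrable)
    qed
    let ?u = "value_fn M Fl T SS U w0"
    have "?J \<phi> \<le> ereal R" if \<phi>: "\<phi> \<in> strategies Fl T" for \<phi>
    proof -
      obtain \<psi> where \<psi>: "Dvalued M Fl T S0 \<psi>" "\<forall>S\<in>SS. ?e S \<psi> = ?e S \<phi>" using proj[OF \<phi>] by blast
      have "?J \<phi> \<le> ?e S0 \<phi>" by (rule INF_lower[OF S0])
      also have "\<dots> = ?e S0 \<psi>" using \<psi>(2) S0 by simp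
      also have "\<dots> \<le> ereal R" by (rule up[OF \<psi>(1)])
      finally show ?thesis .
    qed
    then have u1: "?u \<le> ereal R" unfolding value_fn_def by (intro SUP_least)
    \<comment> \<open>Doing nothing is a strategy, so the value is at least U(w0); together with the
      cap \<open>R\<close> it is a real number.\<close>
    have "ereal (U w0) \<le> ?J (\<lambda>_ _. 0)" by (rule INF_greatest) (simp only: e0)
    also have "\<dots> \<le> ?u" unfolding value_fn_def by (rule SUP_upper[OF zero])
    finally have u2: "ereal (U w0) \<le> ?u" .
    obtain r where r: "?u = ereal r" using u1 u2 by (cases ?u) auto
    \<comment> \<open>Near-optimality is required in all markets simultaneously, although the bounds
      for the selection will come from \<open>S0\<close> alone.\<close>
    define D where "D n = {\<phi>. Dvalued M Fl T S0 \<phi> \<and> (\<forall>S\<in>SS. ereal (r - 1 / Suc n) \<le> ?e S \<phi>)}" for n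
    have cle: "r - 1 / Suc n \<le> r - 1 / Suc m" if "n \<le> m" for n m
      using that by (simp add: frac_le)
    have Ddec: "D m \<subseteq> D n" if nm: "n \<le> m" for n m
    proof
      fix \<phi> assume "\<phi> \<in> D m"
      then have m: "Dvalued M Fl T S0 \<phi>" "\<And>S. S \<in> SS \<Longrightarrow> ereal (r - 1 / Suc m) \<le> ?e S \<phi>" by (simp_all add: D_def)
      have "ereal (r - 1 / Suc n) \<le> ?e S \<phi>" if "S \<in> SS" for S
        by (rule order_trans[OF _ m(2)[OF that]]) (simp only: ereal_less_eq cle[OF nm])
      then show "\<phi> \<in> D n" using m(1) by (simp add: D_def)
    qed
    have Dne: "D n \<noteq> {}" for n
    proof -
      have "ereal (r - 1 / Suc n) < ?u" unfolding r by simp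
      then obtain \<phi> where \<phi>: "\<phi> \<in> strategies Fl T" "ereal (r - 1 / Suc n) < ?J \<phi>"
        unfolding value_fn_def less_SUP_iff by blast
      obtain \<psi> where \<psi>: "Dvalued M Fl T S0 \<psi>" "\<forall>S\<in>SS. ?e S \<psi> = ?e S \<phi>" using proj[OF \<phi>(1)] by blast
      have "ereal (r - 1 / Suc n) \<le> ?e S \<psi>" if "S \<in> SS" for S
      proof -
        have "ereal (r - 1 / Suc n) \<le> ?J \<phi>" using \<phi>(2) by (rule less_imp_le)
        also have "\<dots> \<le> ?e S \<phi>" by (rule INF_lower[OF that])
        finally show ?thesis using \<psi>(2) that by simp
      qed
      then have "\<psi> \<in> D n" using \<psi>(1) by (simp add: D_def)
      then show ?thesis by blast
    qed
    have Dstr: "\<phi> \<in> strategies Fl T" if "\<phi> \<in> D n" for \<phi> n using that by (simp add: D_def Dvalued_def)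
    have DS: "Dvalued M Fl T S \<phi>" if "\<phi> \<in> D n" "S \<in> SS" for \<phi> n S
      using Dvalued_transfer[OF i S0 that(2)] that(1) by (simp add: D_def)
    \<comment> \<open>Concavity bounds the utility of the midpoint below by an integrable average,
      and the weighted wealth bounds it above. Integrability matters because
      \<open>ext_expect\<close> falls to minus infinity when the negative part is not
      integrable.\<close>
    have Dconv: "mid \<phi> \<psi> \<in> D n" if p: "\<phi> \<in> D n" "\<psi> \<in> D n" for \<phi> \<psi> n
    proof -
      let ?c = "r - 1 / Suc n"
      have Dm: "Dvalued M Fl T S0 (mid \<phi> \<psi>)" using p by (intro Dvalued_mid) (auto simp: D_def)
      have "ereal ?c \<le> ?e S (mid \<phi> \<psi>)" if S: "S \<in> SS" for S
      proof -
        obtain R V b Vs bs where V: "weight M V" and b: "\<And>\<phi>. Dvalued M Fl T S \<phi> \<Longrightarrow> ereal ?c \<le> ?e S \<phi> \<Longrightarrow>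
           controlled U w0 S ?c R V b Vs bs \<phi>"
          using est[OF S S] by blast
        let ?W = "\<lambda>\<phi> \<omega>. wealth S T w0 \<phi> \<omega>"
        have b1: "integrable M (\<lambda>\<omega>. U (?W \<phi> \<omega>))" "?c \<le> (\<integral>\<omega>. U (?W \<phi> \<omega>) \<partial>M)" "integrable M (\<lambda>\<omega>. V \<omega> * max 0 (?W \<phi> \<omega>))"
          and b2: "integrable M (\<lambda>\<omega>. U (?W \<psi> \<omega>))" "?c \<le> (\<integral>\<omega>. U (?W \<psi> \<omega>) \<partial>M)" "integrable M (\<lambda>\<omega>. V \<omega> * max 0 (?W \<psi> \<omega>))"
          using b[OF DS[OF p(1) S]] b[OF DS[OF p(2) S]] p S by (simp_all add: D_def controlled_def del: of_nat_Suc)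
        have [measurable]: "wealth S T w0 (mid \<phi> \<psi>) \<in> borel_measurable M" using Dm by (intro wm S) (simp add: Dvalued_def)
        note [measurable] = weight_meas[OF V]
        have conc: "(U (?W \<phi> \<omega>) + U (?W \<psi> \<omega>)) / 2 \<le> U (?W (mid \<phi> \<psi>) \<omega>)" for \<omega>
          using concave_onD[OF U_concave, of "1/2" "?W \<phi> \<omega>" "?W \<psi> \<omega>"] unfolding wealth_mid by (simp add: add_divide_distrib)
        have iavg: "integrable M (\<lambda>\<omega>. (U (?W \<phi> \<omega>) + U (?W \<psi> \<omega>)) / 2)"
          by (intro integrable_divide Bochner_Integration.integrable_add b1 b2)
        have im: "integrable M (\<lambda>\<omega>. U (?W (mid \<phi> \<psi>) \<omega>))"
        proof (rule integrable_utility[OF V G \<kappa> U])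
          show "integrable M (\<lambda>\<omega>. V \<omega> * max 0 (?W (mid \<phi> \<psi>) \<omega>))"
          proof (rule Bochner_Integration.integrable_bound)
            show "integrable M (\<lambda>\<omega>. (V \<omega> * max 0 (?W \<phi> \<omega>) + V \<omega> * max 0 (?W \<psi> \<omega>)) / 2)"
              by (intro integrable_divide Bochner_Integration.integrable_add b1 b2)
            show "AE \<omega> in M. norm (V \<omega> * max 0 (?W (mid \<phi> \<psi>) \<omega>)) \<le> norm ((V \<omega> * max 0 (?W \<phi> \<omega>) + V \<omega> * max 0 (?W \<psi> \<omega>)) / 2)"
              using weight_AE[OF V]
            proof eventually_elim
              case (elim \<omega>)
              have "max 0 (?W (mid \<phi> \<psi>) \<omega>) \<le> (max 0 (?W \<phi> \<omega>) + max 0 (?W \<psi> \<omega>)) / 2"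
                unfolding wealth_mid by (rule max.boundedI) (auto intro!: divide_right_mono add_mono)
              then have "V \<omega> * max 0 (?W (mid \<phi> \<psi>) \<omega>) \<le> V \<omega> * ((max 0 (?W \<phi> \<omega>) + max 0 (?W \<psi> \<omega>)) / 2)"
                using elim by (intro mult_left_mono) auto
              moreover have "0 \<le> V \<omega> * max 0 (?W (mid \<phi> \<psi>) \<omega>)" using elim by simp
              moreover have "V \<omega> * ((max 0 (?W \<phi> \<omega>) + max 0 (?W \<psi> \<omega>)) / 2) = (V \<omega> * max 0 (?W \<phi> \<omega>) + V \<omega> * max 0 (?W \<psi> \<omega>)) / 2"
                by (simp only: distrib_left times_divide_eq_right)
              ultimately have "\<bar>V \<omega> * max 0 (?W (mid \<phi> \<psi>) \<omega>)\<bar> \<le> (V \<omega> * max 0 (?W \<phi> \<omega>) + V \<omega> * max 0 (?W \<psi> \<omega>)) / 2"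
                by (simp only: abs_of_nonneg)
              then show ?case unfolding real_norm_def by (rule order_trans) (rule abs_ge_self)
            qed
          qed measurable
          show "integrable M (\<lambda>\<omega>. max 0 (- U (?W (mid \<phi> \<psi>) \<omega>)))"
          proof (rule Bochner_Integration.integrable_bound[OF iavg])
            have "norm (max 0 (- U (?W (mid \<phi> \<psi>) \<omega>))) \<le> norm ((U (?W \<phi> \<omega>) + U (?W \<psi> \<omega>)) / 2)" for \<omega>
              using conc[of \<omega>] unfolding real_norm_def by linarith
            then show "AE \<omega> in M. norm (max 0 (- U (?W (mid \<phi> \<psi>) \<omega>))) \<le> norm ((U (?W \<phi> \<omega>) + U (?W \<psi> \<omega>)) / 2)" by (intro AE_I2)
          qed measurable
        qed measurable
        have "?c \<le> (\<integral>\<omega>. (U (?W \<phi> \<omega>) + U (?W \<psi> \<omega>)) / 2 \<partial>M)" using b1 b2 by simp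
        also have "\<dots> \<le> (\<integral>\<omega>. U (?W (mid \<phi> \<psi>) \<omega>) \<partial>M)" by (rule integral_mono[OF iavg im conc])
        finally show ?thesis by (simp add: ext_expect_integrable[OF im])
      qed
      with Dm show ?thesis by (simp add: D_def)
    qed
    \<comment> \<open>The level r - 1 is the threshold defining \<open>D 0\<close>, which contains
      every \<open>D n\<close>.\<close>
    obtain V b Vs bs where Vs: "\<And>t. t \<in> {1..T} \<Longrightarrow> weight M (Vs t)"
      and ctl: "\<And>\<phi>. Dvalued M Fl T S0 \<phi> \<Longrightarrow> ereal (r - 1) \<le> ?e S0 \<phi> \<Longrightarrow> controlled U w0 S0 (r - 1) R V b Vs bs \<phi>"
      using R by blast
    have D0: "Dvalued M Fl T S0 \<phi> \<and> ereal (r - 1) \<le> ?e S0 \<phi>" if "\<phi> \<in> D 0" for \<phi> using that S0 by (simp add: D_def)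
    obtain \<psi> where \<psi>: "\<And>n. \<psi> n \<in> D n" "\<And>t. t \<in> {1..T} \<Longrightarrow> AE \<omega> in M. Cauchy (\<lambda>n. \<psi> n t \<omega>)"
    proof -
      have "\<exists>\<psi>. (\<forall>n. \<psi> n \<in> D n) \<and> (\<forall>t\<in>{1..T}. AE \<omega> in M. Cauchy (\<lambda>n. \<psi> n t \<omega>))"
      proof (rule midpoint_convex_selection[where V=Vs and b=bs])
        fix \<phi> t assume p: "\<phi> \<in> D 0" and t: "t \<in> {1..T}"
        show "\<phi> t \<in> borel_measurable M"
          by (rule meas_M[of "t - 1"]) (use Dstr[OF p] t in \<open>auto simp: strategies_def\<close>)
        show "integrable M (\<lambda>\<omega>. Vs t \<omega> * norm (\<phi> t \<omega>))" "(\<integral>\<omega>. Vs t \<omega> * norm (\<phi> t \<omega>) \<partial>M) \<le> bs t"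
          using ctl[of \<phi>] D0[OF p] t by (simp_all add: controlled_def)
      qed (use Dne Ddec Dconv Vs in auto)
      then show thesis using that by blast
    qed
    \<comment> \<open>\<open>lim\<close> is total, so each component is measurable on the whole
      space; its values off the null set of divergence do not affect expectations.\<close>
    define \<phi> where "\<phi> t \<omega> = lim (\<lambda>n. \<psi> n t \<omega>)" for t \<omega>
    have \<phi>: "\<phi> \<in> strategies Fl T" unfolding strategies_def
    proof (intro CollectI ballI)
      fix t assume t: "t \<in> {1..T}"
      have "\<psi> n t \<in> borel_measurable (Fl (t - 1))" for n using Dstr[OF \<psi>(1)] t by (simp add: strategies_def)
      then show "\<phi> t \<in> borel_measurable (Fl (t - 1))" unfolding \<phi>_def[abs_def] by (rule borel_measurable_lim_metric)
    qed
    have "AE \<omega> in M. \<forall>t\<in>{1..T}. Cauchy (\<lambda>n. \<psi> n t \<omega>)" using \<psi>(2) by (intro AE_finite_allI) auto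
    then have lim: "AE \<omega> in M. (\<lambda>n. wealth S T w0 (\<psi> n) \<omega>) \<longlonglongrightarrow> wealth S T w0 \<phi> \<omega>" for S
    proof eventually_elim
      case (elim \<omega>)
      have "(\<lambda>n. \<psi> n t \<omega>) \<longlonglongrightarrow> \<phi> t \<omega>" if "t \<in> {1..T}" for t
        using elim that unfolding \<phi>_def by (simp add: Cauchy_convergent_iff convergent_LIMSEQ_iff)
      then show ?case unfolding wealth_def by (intro tendsto_add tendsto_sum tendsto_inner tendsto_const) auto
    qed
    have "ereal r \<le> ?e S \<phi>" if S: "S \<in> SS" for S
    proof -
      \<comment> \<open>Fresh weight and bounds for this market: the sequence was selected with the
        bounds of \<open>S0\<close>, but it is near-optimal in S as well, so the estimates of S at
        level r - 1 apply to it.\<close>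
      obtain R V b Vs bs where V: "weight M V" and b: "\<And>\<phi>. Dvalued M Fl T S \<phi> \<Longrightarrow> ereal (r - 1) \<le> ?e S \<phi> \<Longrightarrow>
           controlled U w0 S (r - 1) R V b Vs bs \<phi>"
        using est[OF S S] by blast
      have e1: "ereal (r - 1 / Suc n) \<le> ?e S (\<psi> n)" for n using \<psi>(1)[of n] S by (simp add: D_def)
      have "\<psi> n \<in> D 0" for n using \<psi>(1)[of n] Ddec[of 0 n] by auto
      then have "ereal (r - 1) \<le> ?e S (\<psi> n)" for n using S by (simp add: D_def)
      note ctl' = b[OF DS[OF \<psi>(1) S] this]
      have b': "integrable M (\<lambda>\<omega>. U (wealth S T w0 (\<psi> n) \<omega>))"
         "integrable M (\<lambda>\<omega>. V \<omega> * max 0 (wealth S T w0 (\<psi> n) \<omega>))" "(\<integral>\<omega>. V \<omega> * max 0 (wealth S T w0 (\<psi> n) \<omega>) \<partial>M) \<le> b" for n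
        using ctl'[of n] by (simp_all add: controlled_def)
      have "integrable M (\<lambda>\<omega>. U (wealth S T w0 \<phi> \<omega>)) \<and> r \<le> (\<integral>\<omega>. U (wealth S T w0 \<phi> \<omega>) \<partial>M)"
      proof (rule utility_upper_semicontinuous[OF V G \<kappa> Uc _ _ lim[of S] b'(2,3,1)])
        show "r - 1 / Suc n \<le> (\<integral>\<omega>. U (wealth S T w0 (\<psi> n) \<omega>) \<partial>M)" for n
          using e1[of n] by (simp add: ext_expect_integrable[OF b'(1)] del: of_nat_Suc)
        show "(\<lambda>n. r - 1 / Suc n) \<longlonglongrightarrow> r"
          using tendsto_diff[OF tendsto_const LIMSEQ_inverse_real_of_nat, of r] by (simp add: inverse_eq_divide)
      qed (use wm S \<phi> Dstr[OF \<psi>(1)] in auto)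
      then show ?thesis by (simp add: ext_expect_integrable)
    qed
    then have "ereal r \<le> ?J \<phi>" by (intro INF_greatest)
    moreover have "?J \<phi> \<le> ?u" unfolding value_fn_def by (rule SUP_upper[OF \<phi>])
    ultimately have "?u = ?J \<phi>" using r by simp
    then show ?thesis using \<phi> r by (intro bexI[of _ \<phi>]) auto
  qed
qed

end
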